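(* Let $n \ge 2$ be an integer, let $\beta_1, \dots, \beta_n$ be positive real numbers, and let $q(x) = \beta_1 x_1^2 + \cdots + \beta_n x_n^2$ for $x \in \mathbf{R}^n$. Let $E = \{x \in \mathbf{R}^n : q(x) < 1\}$, $\partial E = \{x \in \mathbf{R}^n : q(x) = 1\}$ and $\bar{E} = \{x \in \mathbf{R}^n : q(x) \le 1\}$. Suppose $f$ is a polynomial on $\mathbf{R}^n$ (with real coefficients). Then the following are equivalent: (a) $\displaystyle \int_{\partial E} \frac{f}{\|\nabla q\|} \, dA = 0$. (b) There exists a harmonic polynomial $h$ on $\mathbf{R}^n$ with $\deg h \le \deg f$ such that $\nabla h \cdot \nabla q = f$ on $\partial E$. (c) There exists a harmonic function $h$ on $\bar{E}$ such that $D_{\mathbf{n}} h = \dfrac{f}{\|\nabla q\|}$ on $\partial E$.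
   Context: $dA$ denotes the usual surface area measure on the ellipsoid $\partial E$, and $\|\cdot\|$ is the Euclidean norm. The gradient of $q$ is $(\nabla q)(x) = 2(\beta_1 x_1, \dots, \beta_n x_n)$. The outward-pointing unit normal at $x \in \partial E$ is $\mathbf{n}(x) = \nabla q(x)/\|\nabla q(x)\|$, and for a smooth function $h$ on $\bar{E}$ the outward normal derivative on $\partial E$ is $D_{\mathbf{n}} h = \nabla h \cdot \mathbf{n} = \nabla h \cdot \dfrac{\nabla q}{\|\nabla q\|}$. A function is harmonic if its Laplacian $\Delta h = \sum_{j=1}^n \partial^2 h/\partial x_j^2$ is zero; "harmonic on the closed set $\bar{E}$" means that $h$ extends to a harmonic function on an open set containing $\bar{E}$. Polynomials have real coefficients, and the degree of the zero polynomial is taken to be $-\infty$. *)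

theory Defs
  imports "HOL-Analysis.Analysis"
begin

subsection \<open>Surface area as Hausdorff measure\<close>

text \<open>
  Surface area on a hypersurface of the Euclidean space \<open>real ^ 'n\<close> is the Hausdorff measure of
  dimension \<open>CARD('n) - 1\<close>. The weight \<open>unit_ball_vol d * (diameter S / 2) ^ d\<close> is the volume of a
  \<open>d\<close>-dimensional ball with the diameter of \<open>S\<close>; this normalization makes the Hausdorff measure
  agree with \<open>d\<close>-dimensional Lebesgue measure on \<open>d\<close>-dimensional planes and with classical surface
  area on smooth surfaces. The empty set is treated separately because \<open>0 ^ 0 = 1\<close>, and covering
  sets must be bounded because the \<open>diameter\<close> of an unbounded set is unspecified.
\<close>

definition hausdorff_weight :: "nat \<Rightarrow> 'a::metric_space set \<Rightarrow> ennreal" where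
  "hausdorff_weight d S =
     (if S = {} then 0 else ennreal (unit_ball_vol (real d) * (diameter S / 2) ^ d))"

definition hausdorff_premeasure :: "nat \<Rightarrow> real \<Rightarrow> 'a::metric_space set \<Rightarrow> ennreal" where
  "hausdorff_premeasure d \<delta> A =
     (INF U \<in> {U :: nat \<Rightarrow> 'a set. A \<subseteq> (\<Union>i. U i) \<and> (\<forall>i. bounded (U i) \<and> diameter (U i) \<le> \<delta>)}.
        \<Sum>i. hausdorff_weight d (U i))"

definition hausdorff_outer :: "nat \<Rightarrow> 'a::metric_space set \<Rightarrow> ennreal" where
  "hausdorff_outer d A = (SUP \<delta>\<in>{0<..}. hausdorff_premeasure d \<delta> A)"

text \<open>
  \<open>hausdorff_outer d\<close> is a metric outer measure, hence countably additive on Borel sets, so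
  \<open>measure_of\<close> does not fall back to the zero measure here.
\<close>

definition hausdorff_measure :: "nat \<Rightarrow> 'a::metric_space measure" where
  "hausdorff_measure d = measure_of UNIV (sets borel) (hausdorff_outer d)"

definition surface_measure :: "(real ^ 'n) measure" where
  "surface_measure = hausdorff_measure (CARD('n) - 1)"


subsection \<open>Partial derivatives and harmonic functions\<close>

text \<open>Meaningful only where \<open>h\<close> is differentiable, which \<open>C2_on\<close> ensures.\<close>

definition partial :: "'n \<Rightarrow> (real ^ 'n \<Rightarrow> real) \<Rightarrow> real ^ 'n \<Rightarrow> real" where
  "partial j h x = frechet_derivative h (at x) (axis j 1)"

definition gradient :: "(real ^ 'n \<Rightarrow> real) \<Rightarrow> real ^ 'n \<Rightarrow> real ^ 'n" where
  "gradient h x = (\<chi> j. partial j h x)"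

definition laplacian :: "(real ^ 'n \<Rightarrow> real) \<Rightarrow> real ^ 'n \<Rightarrow> real" where
  "laplacian h x = (\<Sum>j\<in>UNIV. partial j (partial j h) x)"

definition C2_on :: "(real ^ 'n) set \<Rightarrow> (real ^ 'n \<Rightarrow> real) \<Rightarrow> bool" where
  "C2_on U h \<longleftrightarrow>
     (\<forall>x\<in>U. h differentiable (at x)) \<and>
     (\<forall>i. \<forall>x\<in>U. partial i h differentiable (at x)) \<and>
     (\<forall>i j. continuous_on U (partial j (partial i h)))"

definition harmonic_on :: "(real ^ 'n) set \<Rightarrow> (real ^ 'n \<Rightarrow> real) \<Rightarrow> bool" where
  "harmonic_on U h \<longleftrightarrow> open U \<and> C2_on U h \<and> (\<forall>x\<in>U. laplacian h x = 0)"

text \<open>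
  Here \<open>h\<close> itself is the harmonic extension of the function on \<open>K\<close>; its values away from the
  neighbourhood \<open>U\<close> are irrelevant.
\<close>

definition harmonic_on_closed :: "(real ^ 'n) set \<Rightarrow> (real ^ 'n \<Rightarrow> real) \<Rightarrow> bool" where
  "harmonic_on_closed K h \<longleftrightarrow> (\<exists>U. open U \<and> K \<subseteq> U \<and> harmonic_on U h)"


subsection \<open>Degree of a polynomial function\<close>

definition degree_le :: "(real ^ 'n \<Rightarrow> real) \<Rightarrow> nat \<Rightarrow> bool" where
  "degree_le f d \<longleftrightarrow>
     (\<exists>c :: ('n \<Rightarrow> nat) \<Rightarrow> real. \<forall>x.
        f x = (\<Sum>\<alpha> | (\<Sum>i\<in>UNIV. \<alpha> i) \<le> d. c \<alpha> * (\<Prod>i\<in>UNIV. (x $ i) ^ \<alpha> i)))"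

text \<open>
  Total degree; intended for \<open>real_polynomial_function f\<close>, where some \<open>degree_le f d\<close> holds.
\<close>

definition poly_degree :: "(real ^ 'n \<Rightarrow> real) \<Rightarrow> ereal" where
  "poly_degree f =
     (if f = (\<lambda>x. 0) then -\<infinity> else ereal (real (LEAST d. degree_le f d)))"


subsection \<open>The ellipsoid\<close>

definition quad :: "real ^ 'n \<Rightarrow> real ^ 'n \<Rightarrow> real" where
  "quad \<beta> x = (\<Sum>j\<in>UNIV. \<beta> $ j * (x $ j)\<^sup>2)"

definition ellipsoid_boundary :: "real ^ 'n \<Rightarrow> (real ^ 'n) set" where
  "ellipsoid_boundary \<beta> = {x. quad \<beta> x = 1}"

definition closed_ellipsoid :: "real ^ 'n \<Rightarrow> (real ^ 'n) set" where
  "closed_ellipsoid \<beta> = {x. quad \<beta> x \<le> 1}"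

definition unit_normal :: "real ^ 'n \<Rightarrow> real ^ 'n \<Rightarrow> real ^ 'n" where
  "unit_normal \<beta> x = gradient (quad \<beta>) x /\<^sub>R norm (gradient (quad \<beta>) x)"

definition normal_derivative :: "real ^ 'n \<Rightarrow> (real ^ 'n \<Rightarrow> real) \<Rightarrow> real ^ 'n \<Rightarrow> real" where
  "normal_derivative \<beta> h x = gradient h x \<bullet> unit_normal \<beta> x"

end

theory Submission
  imports Defs "HOL-Library.Function_Algebras"
begin

text \<open>
  The normal derivative condition is tested against the weighted surface integral
  \<open>f \<mapsto> \<integral> f / \<parallel>\<nabla>q\<parallel> dA\<close>. Hausdorff measure on a hyperplane and the Lebesgue measure of the cone over a
  subset of that hyperplane are both translation invariant, hence proportional (Fubini); near a
  point of the ellipsoid the radial projection from the tangent plane is almost isometric, so the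
  weighted surface measure is a constant multiple of the cone measure
  \<open>A \<mapsto> vol {t a | a \<in> A, 0 < t < 1}\<close>. For the latter the divergence theorem is proved directly: a field
  multiplied by \<open>1 - q ^ m\<close> vanishes on the boundary, so its divergence integrates to zero, and
  \<open>m \<rightarrow> \<infinity>\<close> leaves the boundary term. Hence the integral vanishes for the boundary data of every
  harmonic function. Conversely, the linear map
  \<open>(h, g) \<mapsto> (\<nabla>h \<bullet> \<nabla>q + h 0 + (q - 1) g, \<Delta>h)\<close> sends pairs of polynomials of degrees \<open>\<le> m\<close> and \<open>\<le> m - 2\<close> to
  such pairs and is injective by the energy method, so it is onto; if the
  integral of \<open>f\<close> vanishes, then the preimage of \<open>(f, 0)\<close> has \<open>h 0 = 0\<close> and \<open>h\<close> solves the problem.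
\<close>

subsection \<open>Hausdorff measure\<close>

text \<open>The weight 1 / |grad q| is what makes radial cones appear: x \<bullet> grad q = 2 on the
  boundary, so the tangent plane at x has distance 2 / |grad q| from the origin, and a thin cone
  with base dA has volume proportional to dA / |grad q|. Cone volume needs no parametrization of the
  surface. As condition (a) only asks for a vanishing integral, the constant of proportionality has
  to be positive but is never computed. The Neumann operator alone is not bijective: constants lie
  in its kernel, and data of nonzero weighted mean are out of reach of harmonic functions. The
  rank-one term h 0 repairs both defects at once. The term (q - 1) g is present because the
  condition holds on the boundary only, while the unknowns are polynomials on the whole space. It
  vanishes on the boundary, and g has the degree of the Laplacian, so domain and target are the same
  finite-dimensional space and injectivity suffices.\<close>

lemma ennreal_le_cmult_INF:
  fixes a c :: ennreal
  assumes c: "0 < c" "c \<noteq> top" and le: "\<And>i. i \<in> I \<Longrightarrow> a \<le> c * f i"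
  shows "a \<le> c * (INF i\<in>I. f i)"
proof -
  have "a / c \<le> (INF i\<in>I. f i)"
    by (rule INF_greatest, rule divide_le_posI_ennreal) (use c le in simp_all)
  then have "c * (a / c) \<le> c * (INF i\<in>I. f i)"
    by (rule mult_left_mono) simp
  moreover have "c * (a / c) = a"
    unfolding ennreal_times_divide
    by (subst mult.commute) (rule mult_divide_eq_ennreal[OF less_imp_neq[OF c(1), symmetric] c(2)])
  ultimately show ?thesis by simp
qed

lemma hausdorff_weight_empty [simp]: "hausdorff_weight d {} = 0"
  by (simp add: hausdorff_weight_def)

definition hausdorff_covers :: "real \<Rightarrow> 'a::metric_space set \<Rightarrow> (nat \<Rightarrow> 'a set) set" where
  "hausdorff_covers \<delta> A = {U. A \<subseteq> (\<Union>i. U i) \<and> (\<forall>i. bounded (U i) \<and> diameter (U i) \<le> \<delta>)}"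

lemma hausdorff_premeasure_alt:
  "hausdorff_premeasure d \<delta> A = (INF U\<in>hausdorff_covers \<delta> A. \<Sum>i. hausdorff_weight d (U i))"
  by (simp add: hausdorff_premeasure_def hausdorff_covers_def)

lemma hausdorff_premeasure_le:
  assumes "U \<in> hausdorff_covers \<delta> A"
  shows "hausdorff_premeasure d \<delta> A \<le> (\<Sum>i. hausdorff_weight d (U i))"
  unfolding hausdorff_premeasure_alt using assms by (intro INF_lower) auto

lemma hausdorff_premeasure_empty: "\<delta> \<ge> 0 \<Longrightarrow> hausdorff_premeasure d \<delta> {} = 0"
  using hausdorff_premeasure_le[of "\<lambda>_. {}" \<delta> "{}" d] by (simp add: hausdorff_covers_def)

lemma hausdorff_premeasure_mono:
  assumes "A \<subseteq> B" "\<delta>' \<le> \<delta>"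
  shows "hausdorff_premeasure d \<delta> A \<le> hausdorff_premeasure d \<delta>' B"
proof -
  have "hausdorff_covers \<delta>' B \<subseteq> hausdorff_covers \<delta> A"
    using assms by (auto simp: hausdorff_covers_def intro: order_trans)
  then show ?thesis
    unfolding hausdorff_premeasure_alt by (rule INF_superset_mono) simp
qed

lemma hausdorff_premeasure_le_outer:
  "\<delta> > 0 \<Longrightarrow> hausdorff_premeasure d \<delta> A \<le> hausdorff_outer d A"
  unfolding hausdorff_outer_def by (rule SUP_upper) auto

lemma hausdorff_outer_empty [simp]: "hausdorff_outer d {} = 0"
  unfolding hausdorff_outer_def by (auto simp: hausdorff_premeasure_empty)

lemma hausdorff_outer_mono: "A \<subseteq> B \<Longrightarrow> hausdorff_outer d A \<le> hausdorff_outer d B"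
  unfolding hausdorff_outer_def by (rule SUP_mono) (use hausdorff_premeasure_mono in blast)

text \<open>Near-optimal covers of the \<open>A n\<close>, with excess e / 2^(n+1), are merged into
  one sequence along the pairing of indices; the excesses add up to e.\<close>

lemma hausdorff_premeasure_UN:
  "hausdorff_premeasure d \<delta> (\<Union>n. A n) \<le> (\<Sum>n. hausdorff_premeasure d \<delta> (A n))"
proof (rule ennreal_le_epsilon)
  let ?P = "hausdorff_premeasure d \<delta>"
  fix e :: real assume "0 < e" "(\<Sum>n. ?P (A n)) < top"
  then have *: "?P (A n) < ?P (A n) + e * (1/2)^Suc n" for n
    by (auto simp add: less_top dest!: ennreal_suminf_lessD)
  have "\<exists>U \<in> hausdorff_covers \<delta> (A n). (\<Sum>i. hausdorff_weight d (U i)) < ?P (A n) + e * (1/2)^Suc n" for n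
    using *[of n] by (subst (asm) (1) hausdorff_premeasure_alt) (simp add: INF_less_iff)
  then obtain B where B: "\<And>n. B n \<in> hausdorff_covers \<delta> (A n)"
    and Ble: "\<And>n. (\<Sum>i. hausdorff_weight d (B n i)) \<le> ?P (A n) + e * (1/2)^(Suc n)"
    by (metis less_imp_le)
  define C where "C = case_prod B o prod_decode"
  have sbB: "A n \<subseteq> (\<Union>i. B n i)" for n using B by (auto simp: hausdorff_covers_def)
  have "(\<Union>n. A n) \<subseteq> (\<Union>i. C i)"
    using sbB by (auto simp add: C_def subset_eq) (metis prod.case prod_encode_inverse)
  moreover have "bounded (C i) \<and> diameter (C i) \<le> \<delta>" for i
    using B by (auto simp: hausdorff_covers_def C_def split: prod.split)
  ultimately have "C \<in> hausdorff_covers \<delta> (\<Union>n. A n)"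
    by (auto simp: hausdorff_covers_def)
  then have "?P (\<Union>n. A n) \<le> (\<Sum>i. hausdorff_weight d (C i))"
    by (rule hausdorff_premeasure_le)
  also have "\<dots> = (\<Sum>n. \<Sum>i. hausdorff_weight d (B n i))"
    unfolding C_def comp_def by (intro suminf_ennreal_2dimen) auto
  also have "\<dots> \<le> (\<Sum>n. ?P (A n) + e * (1/2) ^ Suc n)"
    by (intro suminf_le suminf_nonneg allI Ble) auto
  also have "... = (\<Sum>n. ?P (A n)) + (\<Sum>n. ennreal e * ennreal ((1/2) ^ Suc n))"
    using \<open>0 < e\<close> by (subst suminf_add[symmetric])
                     (auto simp del: ennreal_suminf_cmult simp add: ennreal_mult[symmetric])
  also have "\<dots> = (\<Sum>n. ?P (A n)) + e"
    unfolding ennreal_suminf_cmult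
    by (subst suminf_ennreal_eq[OF zero_le_power power_half_series]) auto
  finally show "?P (\<Union>n. A n) \<le> (\<Sum>n. ?P (A n)) + e" .
qed

lemma hausdorff_outer_UN:
  "hausdorff_outer d (\<Union>n. A n) \<le> (\<Sum>n. hausdorff_outer d (A n))"
  unfolding hausdorff_outer_def[of d "\<Union>n. A n"]
proof (rule SUP_least)
  fix \<delta> :: real assume "\<delta> \<in> {0<..}"
  then have "\<delta> > 0" by simp
  have "hausdorff_premeasure d \<delta> (\<Union>n. A n) \<le> (\<Sum>n. hausdorff_premeasure d \<delta> (A n))"
    by (rule hausdorff_premeasure_UN)
  also have "\<dots> \<le> (\<Sum>n. hausdorff_outer d (A n))"
    by (intro suminf_le hausdorff_premeasure_le_outer \<open>\<delta> > 0\<close>) auto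
  finally show "hausdorff_premeasure d \<delta> (\<Union>n. A n) \<le> (\<Sum>n. hausdorff_outer d (A n))" .
qed

lemma outer_measure_space_hausdorff: "outer_measure_space (Pow UNIV) (hausdorff_outer d)"
  by (auto simp: outer_measure_space_def positive_def increasing_def countably_subadditive_def
      hausdorff_outer_mono hausdorff_outer_UN)

lemma hausdorff_outer_Un: "hausdorff_outer d (A \<union> B) \<le> hausdorff_outer d A + hausdorff_outer d B"
proof -
  interpret sigma_algebra UNIV "Pow UNIV" by (rule sigma_algebra_Pow)
  have "subadditive (Pow UNIV) (hausdorff_outer d :: 'a set \<Rightarrow> ennreal)"
    using outer_measure_space_hausdorff
    by (intro countably_subadditive_subadditive) (auto simp: outer_measure_space_def)
  from subadditiveD[OF this, of A "B - A"] have "hausdorff_outer d (A \<union> (B - A)) \<le> hausdorff_outer d A + hausdorff_outer d (B - A)"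
    by auto
  also have "\<dots> \<le> hausdorff_outer d A + hausdorff_outer d B"
    by (intro add_mono hausdorff_outer_mono) auto
  finally show ?thesis by simp
qed

section \<open>Additivity on separated sets and measurability of Borel sets\<close>

lemma hausdorff_premeasure_separated:
  assumes \<eta>: "\<And>a b. a \<in> A \<Longrightarrow> b \<in> B \<Longrightarrow> dist a b \<ge> \<eta>" and "\<delta> < \<eta>"
  shows "hausdorff_premeasure d \<delta> A + hausdorff_premeasure d \<delta> B \<le> hausdorff_premeasure d \<delta> (A \<union> B)"
  unfolding hausdorff_premeasure_alt[of d \<delta> "A \<union> B"]
proof (rule INF_greatest)
  fix U assume U: "U \<in> hausdorff_covers \<delta> (A \<union> B)"
  \<comment> \<open>A set of diameter at most \<delta> < \<eta> cannot meet both \<open>A\<close>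
    and \<open>B\<close>, so each member of the cover is charged to at most one side.\<close>
  define V where "V i = (if U i \<inter> A \<noteq> {} then U i else {})" for i
  define W where "W i = (if U i \<inter> B \<noteq> {} then U i else {})" for i
  \<comment> \<open>The empty sets put into \<open>V\<close> and \<open>W\<close> have diameter 0,
    so 0 \<le> \<delta> is required; the existence of any cover forces it.\<close>
  have "bounded (U 0)" "diameter (U 0) \<le> \<delta>" using U by (simp_all add: hausdorff_covers_def)
  then have \<delta>: "0 \<le> \<delta>" using diameter_ge_0[of "U 0"] by simp
  have V: "V \<in> hausdorff_covers \<delta> A"
    using U \<delta> unfolding hausdorff_covers_def V_def by (auto split: if_splits) blast
  have W: "W \<in> hausdorff_covers \<delta> B"
    using U \<delta> unfolding hausdorff_covers_def W_def by (auto split: if_splits) blast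
  have le: "hausdorff_weight d (V i) + hausdorff_weight d (W i) \<le> hausdorff_weight d (U i)" for i
  proof (cases "U i \<inter> A \<noteq> {} \<and> U i \<inter> B \<noteq> {}")
    case True
    then obtain a b where "a \<in> A" "b \<in> B" "a \<in> U i" "b \<in> U i" by auto
    moreover have "bounded (U i)" "diameter (U i) \<le> \<delta>" using U by (auto simp: hausdorff_covers_def)
    ultimately have False
      using \<eta>[of a b] diameter_bounded_bound[of "U i" a b] \<open>\<delta> < \<eta>\<close> by auto
    then show ?thesis ..
  qed (auto simp: V_def W_def)
  have "hausdorff_premeasure d \<delta> A + hausdorff_premeasure d \<delta> B
    \<le> (\<Sum>i. hausdorff_weight d (V i)) + (\<Sum>i. hausdorff_weight d (W i))"
    using V W by (intro add_mono hausdorff_premeasure_le)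
  also have "\<dots> = (\<Sum>i. hausdorff_weight d (V i) + hausdorff_weight d (W i))"
    by (rule suminf_add) auto
  also have "\<dots> \<le> (\<Sum>i. hausdorff_weight d (U i))"
    by (intro suminf_le le) auto
  finally show "hausdorff_premeasure d \<delta> A + hausdorff_premeasure d \<delta> B \<le> (\<Sum>i. hausdorff_weight d (U i))" .
qed

lemma hausdorff_outer_separated:
  assumes \<eta>: "\<And>a b. a \<in> A \<Longrightarrow> b \<in> B \<Longrightarrow> dist a b \<ge> \<eta>" and "\<eta> > 0"
  shows "hausdorff_outer d A + hausdorff_outer d B \<le> hausdorff_outer d (A \<union> B)"
proof -
  have "hausdorff_outer d A + hausdorff_outer d B
    = (SUP \<delta>\<in>{0<..}. hausdorff_premeasure d \<delta> A + hausdorff_premeasure d \<delta> B)"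
    unfolding hausdorff_outer_def
  proof (rule SUP_add_directed_ennreal[symmetric])
    fix i j :: real assume "i \<in> {0<..}" "j \<in> {0<..}"
    then show "\<exists>k\<in>{0<..}. hausdorff_premeasure d i A + hausdorff_premeasure d j B
      \<le> hausdorff_premeasure d k A + hausdorff_premeasure d k B"
      by (intro bexI[of _ "min i j"] add_mono hausdorff_premeasure_mono) auto
  qed
  also have "\<dots> \<le> hausdorff_outer d (A \<union> B)"
  proof (rule SUP_least)
    fix \<delta> :: real assume "\<delta> \<in> {0<..}"
    define \<delta>' where "\<delta>' = min \<delta> (\<eta> / 2)"
    have \<delta>': "0 < \<delta>'" "\<delta>' < \<eta>" "\<delta>' \<le> \<delta>" using \<open>\<delta> \<in> _\<close> \<open>\<eta> > 0\<close> by (auto simp: \<delta>'_def)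
    have "hausdorff_premeasure d \<delta> A + hausdorff_premeasure d \<delta> B
      \<le> hausdorff_premeasure d \<delta>' A + hausdorff_premeasure d \<delta>' B"
      using \<delta>' by (intro add_mono hausdorff_premeasure_mono) auto
    also have "\<dots> \<le> hausdorff_premeasure d \<delta>' (A \<union> B)"
      using \<delta>' by (intro hausdorff_premeasure_separated[OF \<eta>])
    also have "\<dots> \<le> hausdorff_outer d (A \<union> B)"
      using \<delta>' by (intro hausdorff_premeasure_le_outer)
    finally show "hausdorff_premeasure d \<delta> A + hausdorff_premeasure d \<delta> B \<le> hausdorff_outer d (A \<union> B)" .
  qed
  finally show ?thesis .
qed

text \<open>Only every other shell is used: two of them are separated by a skipped shell, whose
  width bounds their distance because \<open>g\<close> is 1-Lipschitz, so the outer measure is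
  additive on them.\<close>

lemma hausdorff_outer_sum_shells:
  fixes g :: "'a::metric_space \<Rightarrow> real"
  assumes g: "\<And>x y. g x - g y \<le> dist x y" and t: "strict_mono t"
    and RA: "\<And>i::nat. R i \<subseteq> A \<inter> {x. t (2 * i) \<le> - g x \<and> - g x < t (2 * i + 1)}"
  shows "(\<Sum>i<N. hausdorff_outer d (R i)) \<le> hausdorff_outer d A"
proof -
  have "(\<Sum>i<N. hausdorff_outer d (R i)) \<le> hausdorff_outer d (\<Union>i<N. R i)"
  proof (induction N)
    case (Suc N)
    have tm: "t i \<le> t j" if "i \<le> j" for i j using t that by (simp add: strict_mono_less_eq)
    have "(\<Sum>i<Suc N. hausdorff_outer d (R i)) \<le> hausdorff_outer d (\<Union>i<N. R i) + hausdorff_outer d (R N)"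
      using Suc by (simp add: add_right_mono)
    also have "\<dots> \<le> hausdorff_outer d ((\<Union>i<N. R i) \<union> R N)"
    proof (cases "N = 0")
      case False
      show ?thesis
      proof (rule hausdorff_outer_separated)
        show "t (2 * N) - t (2 * N - 1) > 0" using t False by (simp add: strict_mono_less)
        fix a b assume "a \<in> (\<Union>i<N. R i)" "b \<in> R N"
        then obtain i where i: "i < N" "a \<in> R i" by auto
        have "t (2 * i + 1) \<le> t (2 * N - 1)" using i by (intro tm) auto
        then show "t (2 * N) - t (2 * N - 1) \<le> dist a b"
          using RA[of i] RA[of N] i \<open>b \<in> R N\<close> g[of a b] by force
      qed
    qed simp
    finally show ?case by (simp add: lessThan_Suc Un_commute)
  qed simp
  also have "\<dots> \<le> hausdorff_outer d A"
    using RA by (intro hausdorff_outer_mono) auto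
  finally show ?thesis .
qed

text \<open>Caratheodory's argument for metric outer measures: a thin layer around \<open>F\<close>
  is removed from \<open>A - F\<close>. What remains has positive distance from \<open>F\<close>,
  and the layer consists of shells whose measures form a convergent series, so that dropping it
  costs arbitrarily little.\<close>

lemma closed_caratheodory_hausdorff:
  fixes F :: "'a::metric_space set"
  assumes "closed F"
  shows "hausdorff_outer d (A \<inter> F) + hausdorff_outer d (A - F) \<le> hausdorff_outer d A"
\<comment> \<open>\<open>infdist\<close> to the empty set is 0 by convention and says nothing about
  distance, so an empty \<open>F\<close> is split off.\<close>
proof (cases "F = {} \<or> hausdorff_outer d A = \<infinity>")
  case False
  then have ne: "F \<noteq> {}" and fin: "hausdorff_outer d A < \<infinity>" by (auto simp: less_top)
  let ?H = "hausdorff_outer d"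
  define t where "t n = - 1 / (real n + 1)" for n :: nat
  have t: "strict_mono t"
    by (rule strict_monoI_Suc) (simp add: t_def field_simps)
  let ?g = "\<lambda>x. infdist x F"
  have g: "?g x - ?g y \<le> dist x y" for x y
    using infdist_triangle[of x F y] by simp
  define R where "R n = A \<inter> {x. t n \<le> - ?g x \<and> - ?g x < t (Suc n)}" for n
  define S where "S n = A \<inter> {x. - ?g x < t n}" for n
  \<comment> \<open>\<open>hausdorff_outer_sum_shells\<close> speaks of even indices; shifting
    \<open>t\<close> by one index makes it apply to the odd shells.\<close>
  have half: "(\<Sum>i<N. ?H (R (2 * i))) \<le> ?H A" "(\<Sum>i<N. ?H (R (2 * i + 1))) \<le> ?H A" for N
  proof -
    show "(\<Sum>i<N. ?H (R (2 * i))) \<le> ?H A"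
      by (rule hausdorff_outer_sum_shells[OF g t]) (auto simp: R_def)
    show "(\<Sum>i<N. ?H (R (2 * i + 1))) \<le> ?H A"
      by (rule hausdorff_outer_sum_shells[OF g, where t = "\<lambda>n. t (Suc n)"])
         (use t in \<open>auto simp: R_def strict_mono_def\<close>)
  qed
  have "(\<Sum>i<N. ?H (R i)) \<le> 2 * ?H A" for N
  proof -
    have "(\<Sum>i<N. ?H (R i)) \<le> (\<Sum>i<2 * N. ?H (R i))"
      by (rule sum_mono2) auto
    also have "\<dots> = (\<Sum>i<N. ?H (R (2 * i))) + (\<Sum>i<N. ?H (R (2 * i + 1)))"
      by (induction N) (simp_all add: algebra_simps)
    also have "\<dots> \<le> 2 * ?H A"
      using add_mono[OF half] by (simp add: mult_2)
    finally show ?thesis .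
  qed
  then have "(\<Sum>i. ?H (R i)) \<le> 2 * ?H A"
    by (simp add: suminf_eq_SUP SUP_le_iff)
  then have sfin: "(\<Sum>i. ?H (R i)) \<noteq> \<infinity>"
    using fin by (auto simp: ennreal_mult_eq_top_iff top_unique)
  have *: "?H (A \<inter> F) + ?H (A - F) \<le> ?H A + (\<Sum>i. ?H (R (i + n)))" for n
  proof -
    have "A - F \<subseteq> S n \<union> (\<Union>i. R (i + n))"
    proof
      fix x assume x: "x \<in> A - F"
      then have pos: "?g x > 0"
        using assms ne in_closed_iff_infdist_zero infdist_nonneg by (metis DiffD2 order_le_less)
      show "x \<in> S n \<union> (\<Union>i. R (i + n))"
      proof (cases "- ?g x < t n")
        case False
        obtain m :: nat where m: "inverse (real (Suc m)) < ?g x" using reals_Archimedean[OF pos] by blast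
        then have "- ?g x < t m" by (simp add: t_def inverse_eq_divide add.commute)
        then have ex: "\<exists>k. - ?g x < t k" by blast
        define k where "k = (LEAST k. - ?g x < t k)"
        have k: "- ?g x < t k" unfolding k_def using ex by (rule LeastI_ex)
        have "n < k"
          using False k t by (meson linorder_not_less order_less_le_trans strict_mono_less_eq)
        then have "\<not> - ?g x < t (k - 1)" using not_less_Least[of "k - 1"] unfolding k_def
          by (metis diff_less k_def less_nat_zero_code not_gr_zero zero_less_one)
        then have "x \<in> R (k - 1 - n + n)" using k \<open>n < k\<close> x by (auto simp: R_def)
        then show ?thesis by blast
      qed (use x in \<open>auto simp: S_def\<close>)
    qed
    then have "?H (A - F) \<le> ?H (S n \<union> (\<Union>i. R (i + n)))" by (rule hausdorff_outer_mono)
    also have "\<dots> \<le> ?H (S n) + ?H (\<Union>i. R (i + n))" by (rule hausdorff_outer_Un)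
    also have "\<dots> \<le> ?H (S n) + (\<Sum>i. ?H (R (i + n)))"
      by (intro add_left_mono hausdorff_outer_UN)
    finally have "?H (A \<inter> F) + ?H (A - F) \<le> (?H (A \<inter> F) + ?H (S n)) + (\<Sum>i. ?H (R (i + n)))"
      by (simp add: add.assoc add_left_mono)
    also have "?H (A \<inter> F) + ?H (S n) \<le> ?H (A \<inter> F \<union> S n)"
    proof (rule hausdorff_outer_separated)
      show "1 / (real n + 1) > 0" by simp
      fix a b assume "a \<in> A \<inter> F" "b \<in> S n"
      then show "1 / (real n + 1) \<le> dist a b"
        using g[of b a] by (auto simp: S_def t_def dist_commute)
    qed
    also have "\<dots> \<le> ?H A" by (rule hausdorff_outer_mono) (auto simp: S_def)
    finally show ?thesis by (simp add: add_right_mono)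
  qed
  \<comment> \<open>The first n terms are added to both sides and complete the tail to the whole
    series. This replaces a limit of tails; the series is finite and can be cancelled at the
    end.\<close>
  have "(\<Sum>i<n. ?H (R i)) + (?H (A \<inter> F) + ?H (A - F)) \<le> ?H A + (\<Sum>i. ?H (R i))" for n
  proof -
    have "(\<Sum>i. ?H (R i)) = (\<Sum>i. ?H (R (i + n))) + (\<Sum>i<n. ?H (R i))"
      by (rule suminf_offset) auto
    then show ?thesis using add_left_mono[OF *[of n], of "\<Sum>i<n. ?H (R i)"] by (simp add: ac_simps)
  qed
  then have "(\<Sum>i. ?H (R i)) + (?H (A \<inter> F) + ?H (A - F)) \<le> ?H A + (\<Sum>i. ?H (R i))"
    by (rule ennreal_suminf_bound_add)
  then show ?thesis
    using sfin by (simp add: add.commute[of "?H A"] ennreal_add_left_cancel_le)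
qed (auto simp: top_greatest)

lemma borel_subset_lambda_system_hausdorff:
  "sets (borel :: 'a::metric_space measure) \<subseteq> lambda_system UNIV (Pow UNIV) (hausdorff_outer d)"
proof -
  interpret sigma_algebra UNIV "Pow UNIV :: 'a set set" by (rule sigma_algebra_Pow)
  let ?L = "lambda_system UNIV (Pow UNIV) (hausdorff_outer d :: 'a set \<Rightarrow> _)"
  have L: "sigma_algebra UNIV ?L"
    using caratheodory_lemma[OF outer_measure_space_hausdorff, of d] by (simp add: measure_space_def)
  have "closed F \<Longrightarrow> F \<in> ?L" for F
    unfolding lambda_system_eq
    by (auto intro!: antisym closed_caratheodory_hausdorff)
       (metis Int_Diff_Un hausdorff_outer_Un)
  then have "sigma_sets UNIV (Collect closed) \<subseteq> ?L"
    using sigma_algebra.sigma_sets_subset[OF L, of "Collect closed"] by blast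
  then show ?thesis
    by (simp add: borel_eq_closed)
qed

lemma sets_hausdorff_measure [simp, measurable_cong]: "sets (hausdorff_measure d) = sets borel"
  unfolding hausdorff_measure_def
  by (metis sets.sets_measure_of_eq space_borel)

text \<open>Caratheodory's theorem supplies the countable additivity without which
  \<open>measure_of\<close> would yield the zero measure.\<close>

lemma emeasure_hausdorff_measure:
  fixes A :: "'a::metric_space set"
  assumes "A \<in> sets borel"
  shows "emeasure (hausdorff_measure d) A = hausdorff_outer d A"
proof -
  interpret sigma_algebra UNIV "Pow UNIV :: 'a set set" by (rule sigma_algebra_Pow)
  have "measure_space UNIV (sets borel) (hausdorff_outer d :: 'a set \<Rightarrow> _)"
    using measure_down[OF caratheodory_lemma[OF outer_measure_space_hausdorff, of d] _
        borel_subset_lambda_system_hausdorff[of d]] sets.sigma_algebra_axioms[of borel]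
    by simp
  then show ?thesis
    unfolding hausdorff_measure_def using assms
    by (intro emeasure_measure_of_sigma) (auto simp: measure_space_def sets.sigma_algebra_axioms)
qed

section \<open>Behaviour under Lipschitz maps and isometries\<close>

lemma diameter_lipschitz_image:
  assumes L: "\<And>x y. x \<in> S \<Longrightarrow> y \<in> S \<Longrightarrow> dist (\<phi> x) (\<phi> y) \<le> L * dist x y"
    and "0 \<le> L" "bounded S"
  shows "bounded (\<phi> ` S)" "diameter (\<phi> ` S) \<le> L * diameter S"
proof -
  have *: "dist (\<phi> x) (\<phi> y) \<le> L * diameter S" if "x \<in> S" "y \<in> S" for x y
    using L[OF that] diameter_bounded_bound[OF \<open>bounded S\<close> that] \<open>0 \<le> L\<close>
    by (meson mult_left_mono order_trans)
  show "bounded (\<phi> ` S)"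
  proof (cases "S = {}")
    case False
    then obtain x where "x \<in> S" by auto
    then show ?thesis using * by (auto simp: bounded_def)
  qed simp
  show "diameter (\<phi> ` S) \<le> L * diameter S"
    using * \<open>0 \<le> L\<close> diameter_ge_0[OF \<open>bounded S\<close>]
    by (cases "S = {}") (auto simp: diameter_def intro!: cSUP_least mult_nonneg_nonneg)
qed

lemma hausdorff_outer_lipschitz_image:
  assumes L: "\<And>x y. x \<in> A \<Longrightarrow> y \<in> A \<Longrightarrow> dist (\<phi> x) (\<phi> y) \<le> L * dist x y" and "0 < L"
  shows "hausdorff_outer d (\<phi> ` A) \<le> ennreal (L ^ d) * hausdorff_outer d A"
  unfolding hausdorff_outer_def[of d "\<phi> ` A"]
proof (rule SUP_least)
  fix \<delta> :: real assume "\<delta> \<in> {0<..}"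
  then have \<delta>: "\<delta> > 0" "\<delta> / L > 0" using \<open>0 < L\<close> by auto
  have "hausdorff_premeasure d \<delta> (\<phi> ` A) \<le> ennreal (L ^ d) * (\<Sum>i. hausdorff_weight d (U i))"
    if U: "U \<in> hausdorff_covers (\<delta> / L) A" for U
  proof -
    \<comment> \<open>The cover is intersected with \<open>A\<close>, where the Lipschitz bound is
      available, and has scale \<delta> / L so that its image has scale \<delta>.\<close>
    have b: "bounded (U i \<inter> A)" and dU: "diameter (U i \<inter> A) \<le> diameter (U i)" "diameter (U i) \<le> \<delta> / L" for i
      using U by (auto simp: hausdorff_covers_def intro: diameter_subset)
    have im: "bounded (\<phi> ` (U i \<inter> A))" "diameter (\<phi> ` (U i \<inter> A)) \<le> L * diameter (U i \<inter> A)" for i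
      using diameter_lipschitz_image[of "U i \<inter> A" \<phi> L] L b \<open>0 < L\<close> by auto
    have le: "diameter (\<phi> ` (U i \<inter> A)) \<le> L * diameter (U i)" for i
      using im(2)[of i] dU(1)[of i] \<open>0 < L\<close> by (meson mult_left_mono order_trans less_imp_le)
    have "diameter (\<phi> ` (U i \<inter> A)) \<le> \<delta>" for i
      using le[of i] dU(2)[of i] \<open>0 < L\<close> by (simp add: pos_le_divide_eq mult.commute)
    then have "(\<lambda>i. \<phi> ` (U i \<inter> A)) \<in> hausdorff_covers \<delta> (\<phi> ` A)"
      using U im(1) unfolding hausdorff_covers_def by auto blast
    then have "hausdorff_premeasure d \<delta> (\<phi> ` A) \<le> (\<Sum>i. hausdorff_weight d (\<phi> ` (U i \<inter> A)))"
      by (rule hausdorff_premeasure_le)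
    also have "\<dots> \<le> (\<Sum>i. ennreal (L ^ d) * hausdorff_weight d (U i))"
    proof (intro suminf_le)
      fix i
      have "unit_ball_vol d * (diameter (\<phi> ` (U i \<inter> A)) / 2) ^ d \<le> unit_ball_vol d * (L * (diameter (U i) / 2)) ^ d"
        using le[of i] diameter_ge_0[OF im(1)[of i]]
        by (intro mult_left_mono power_mono) (auto simp: unit_ball_vol_nonneg)
      also have "\<dots> = L ^ d * (unit_ball_vol d * (diameter (U i) / 2) ^ d)"
        by (simp add: power_mult_distrib power_divide)
      finally show "hausdorff_weight d (\<phi> ` (U i \<inter> A)) \<le> ennreal (L ^ d) * hausdorff_weight d (U i)"
        using \<open>0 < L\<close> by (auto simp: hausdorff_weight_def ennreal_mult'[symmetric] intro!: ennreal_leI)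
    qed auto
    also have "\<dots> = ennreal (L ^ d) * (\<Sum>i. hausdorff_weight d (U i))"
      by (rule ennreal_suminf_cmult)
    finally show ?thesis .
  qed
  then have "hausdorff_premeasure d \<delta> (\<phi> ` A) \<le> ennreal (L ^ d) * hausdorff_premeasure d (\<delta> / L) A"
    unfolding hausdorff_premeasure_alt[of d "\<delta> / L"]
    using \<open>0 < L\<close> by (intro ennreal_le_cmult_INF) auto
  also have "\<dots> \<le> ennreal (L ^ d) * hausdorff_outer d A"
    by (intro mult_left_mono hausdorff_premeasure_le_outer \<delta>) auto
  finally show "hausdorff_premeasure d \<delta> (\<phi> ` A) \<le> ennreal (L ^ d) * hausdorff_outer d A" .
qed

lemma hausdorff_outer_isometric_image:
  assumes "\<And>x y. x \<in> A \<Longrightarrow> y \<in> A \<Longrightarrow> dist (\<phi> x) (\<phi> y) = dist x y"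
  shows "hausdorff_outer d (\<phi> ` A) = hausdorff_outer d A"
proof (rule antisym)
  show "hausdorff_outer d (\<phi> ` A) \<le> hausdorff_outer d A"
    using hausdorff_outer_lipschitz_image[of A \<phi> 1 d] assms by simp
  have inj: "inj_on \<phi> A"
    using assms by (metis dist_eq_0_iff inj_onI)
  have "dist (inv_into A \<phi> x) (inv_into A \<phi> y) \<le> 1 * dist x y" if "x \<in> \<phi> ` A" "y \<in> \<phi> ` A" for x y
    using that inj assms by auto
  then have "hausdorff_outer d (inv_into A \<phi> ` (\<phi> ` A)) \<le> ennreal (1 ^ d) * hausdorff_outer d (\<phi> ` A)"
    by (rule hausdorff_outer_lipschitz_image[OF _ zero_less_one])
  then show "hausdorff_outer d A \<le> hausdorff_outer d (\<phi> ` A)"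
    using inj by (simp add: image_image)
qed

subsection \<open>Lebesgue measure, linear maps and cones\<close>

text \<open>Fixing \<open>B\<close>, this is the uniqueness of translation invariant measures up to a factor.\<close>

lemma translation_invariant_cross:
  fixes M N :: "'a::euclidean_space measure"
  assumes sets [measurable_cong]: "sets M = sets borel" "sets N = sets borel"
    and sf: "sigma_finite_measure M" "sigma_finite_measure N"
    and V: "subspace V" "AE x in M. x \<in> V" "AE x in N. x \<in> V"
    and inv: "\<And>v. v \<in> V \<Longrightarrow> distr M borel (\<lambda>x. x + v) = M" "\<And>v. v \<in> V \<Longrightarrow> distr N borel (\<lambda>x. x + v) = N"
    and A [measurable]: "A \<in> sets borel" and B [measurable]: "B \<in> sets borel"
  shows "emeasure M A * emeasure N B = emeasure M (uminus -` B) * emeasure N A"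
proof -
  interpret M: sigma_finite_measure M by fact
  interpret N: sigma_finite_measure N by fact
  interpret P: pair_sigma_finite M N ..
  interpret Q: pair_sigma_finite N M ..
  have N_inv: "(\<integral>\<^sup>+y. f y \<partial>N) = (\<integral>\<^sup>+y. f (y + v) \<partial>N)" if "v \<in> V" "f \<in> borel_measurable borel" for f v
    using that by (subst inv(2)[OF that(1), symmetric], subst nn_integral_distr) auto
  have M_inv: "(\<integral>\<^sup>+y. f y \<partial>M) = (\<integral>\<^sup>+y. f (y + v) \<partial>M)" if "v \<in> V" "f \<in> borel_measurable borel" for f v
    using that by (subst inv(1)[OF that(1), symmetric], subst nn_integral_distr) auto
  have [measurable]: "uminus -` B \<in> sets borel"
    using measurable_sets[OF borel_measurable_uminus[OF measurable_ident] B] by (simp add: id_def)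
  \<comment> \<open>The measure of the pairs with x in A and y - x in B is computed twice:
    invariance of N alone gives the left side, invariance of M followed by that of N the right side.
    The shifts are allowed almost everywhere because both measures live on \<open>V\<close>.\<close>
  have "emeasure M A * emeasure N B = (\<integral>\<^sup>+x. indicator A x * (\<integral>\<^sup>+y. indicator B y \<partial>N) \<partial>M)"
    by (simp add: nn_integral_multc sets)
  also have "\<dots> = (\<integral>\<^sup>+x. (\<integral>\<^sup>+y. indicator A x * indicator B (y - x) \<partial>N) \<partial>M)"
  proof (rule nn_integral_cong_AE, use V(2) in eventually_elim)
    fix x assume "x \<in> V"
    then have "- x \<in> V" using V(1) by (simp add: subspace_neg)
    then have "(\<integral>\<^sup>+y. indicator B y \<partial>N) = (\<integral>\<^sup>+y. indicator B (y - x) \<partial>N)"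
      by (subst N_inv[of "-x"]) auto
    then show "indicator A x * (\<integral>\<^sup>+y. indicator B y \<partial>N) = (\<integral>\<^sup>+y. indicator A x * indicator B (y - x) \<partial>N)"
      by (simp add: nn_integral_cmult)
  qed
  also have "\<dots> = (\<integral>\<^sup>+y. (\<integral>\<^sup>+x. indicator A x * indicator B (y - x) \<partial>M) \<partial>N)"
    by (rule P.Fubini'[symmetric]) measurable
  also have "\<dots> = (\<integral>\<^sup>+y. (\<integral>\<^sup>+x. indicator A (x + y) * indicator B (- x) \<partial>M) \<partial>N)"
  proof (rule nn_integral_cong_AE, use V(3) in eventually_elim)
    fix y assume "y \<in> V"
    then show "(\<integral>\<^sup>+x. indicator A x * indicator B (y - x) \<partial>M) = (\<integral>\<^sup>+x. indicator A (x + y) * indicator B (- x) \<partial>M)"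
      by (subst M_inv[of y]) auto
  qed
  also have "\<dots> = (\<integral>\<^sup>+x. (\<integral>\<^sup>+y. indicator A (x + y) * indicator B (- x) \<partial>N) \<partial>M)"
    by (rule P.Fubini') measurable
  also have "\<dots> = (\<integral>\<^sup>+x. indicator B (- x) * (\<integral>\<^sup>+y. indicator A y \<partial>N) \<partial>M)"
  proof (rule nn_integral_cong_AE, use V(2) in eventually_elim)
    fix x assume "x \<in> V"
    then have "(\<integral>\<^sup>+y. indicator A y \<partial>N) = (\<integral>\<^sup>+y. indicator A (x + y) \<partial>N)"
      by (subst N_inv[of x]) (auto simp: add.commute)
    then show "(\<integral>\<^sup>+y. indicator A (x + y) * indicator B (- x) \<partial>N) = indicator B (- x) * (\<integral>\<^sup>+y. indicator A y \<partial>N)"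
      unfolding mult.commute[of _ "indicator B (- x)"]
      by (simp add: nn_integral_cmult)
  qed
  also have "\<dots> = (\<integral>\<^sup>+x. indicator (uminus -` B) x * emeasure N A \<partial>M)"
    by (simp add: sets indicator_vimage o_def)
  also have "\<dots> = emeasure M (uminus -` B) * emeasure N A"
    by (subst nn_integral_multc) (auto simp: sets)
  finally show ?thesis .
qed

text \<open>For C inside the hyperplane {y. y \<bullet> b = 1} this is the set of all t y with y in
  C and 0 < t < 1. Normalizing z makes it a preimage of C, hence Borel, and compatible with
  preimages under linear maps. Points of C off the hyperplane do not contribute.\<close>

definition cone_over :: "real ^ 'n \<Rightarrow> (real ^ 'n) set \<Rightarrow> (real ^ 'n) set" where
  "cone_over b C = {z. 0 < z \<bullet> b \<and> z \<bullet> b < 1 \<and> z /\<^sub>R (z \<bullet> b) \<in> C}"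

lemma cone_over_borel [measurable]: "C \<in> sets borel \<Longrightarrow> cone_over b C \<in> sets borel"
proof -
  assume C: "C \<in> sets borel"
  have "(\<lambda>z. z /\<^sub>R (z \<bullet> b)) \<in> borel_measurable borel" by measurable
  then have [measurable]: "(\<lambda>z. z /\<^sub>R (z \<bullet> b)) -` C \<in> sets borel"
    using C measurable_sets[of "\<lambda>z. z /\<^sub>R (z \<bullet> b)" borel borel C] by simp
  have "cone_over b C = {z. 0 < z \<bullet> b \<and> z \<bullet> b < 1} \<inter> (\<lambda>z. z /\<^sub>R (z \<bullet> b)) -` C"
    by (auto simp: cone_over_def)
  also have "\<dots> \<in> sets borel" by measurable
  finally show ?thesis .
qed

lemma cone_over_linear_vimage:
  assumes "linear L" "\<And>z. L z \<bullet> b' = z \<bullet> b"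
  shows "L -` cone_over b' C = cone_over b (L -` C)"
  using assms by (auto simp: cone_over_def linear_cmul)

section \<open>Volume factors of linear maps\<close>

lemma sigma_finite_measure_balls:
  fixes M :: "'a::real_normed_vector measure"
  assumes "sets M = sets borel" "\<And>r. emeasure M (ball 0 r) < \<infinity>"
  shows "sigma_finite_measure M"
proof
  show "\<exists>A. countable A \<and> A \<subseteq> sets M \<and> \<Union> A = space M \<and> (\<forall>a\<in>A. emeasure M a \<noteq> \<infinity>)"
  proof (intro exI[of _ "range (\<lambda>n::nat. ball 0 (real n))"] conjI)
    have "\<exists>n::nat. norm x < real n" for x :: 'a by (rule reals_Archimedean2)
    then show "\<Union> (range (\<lambda>n::nat. ball 0 (real n))) = space M"
      using sets_eq_imp_space_eq[OF assms(1)] by auto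
  qed (use assms in \<open>auto simp: less_top\<close>)
qed

lemma emeasure_lborel_open_pos:
  fixes S :: "'a::euclidean_space set"
  assumes "open S" "S \<noteq> {}"
  shows "emeasure lborel S > 0"
proof -
  have "emeasure lebesgue S \<noteq> 0"
    using open_not_negligible[OF assms] assms(1) by (subst (asm) negligible_iff_emeasure0) auto
  then show ?thesis using assms(1) by (simp add: zero_less_iff_neq_zero)
qed

text \<open>For invertible L the factor c is |det L|. Preimages spare the measurability of images,
  and for shears and rotations c follows from symmetries, without any determinant.\<close>

definition lborel_scale :: "('a::euclidean_space \<Rightarrow> 'a) \<Rightarrow> real \<Rightarrow> bool" where
  "lborel_scale L c \<longleftrightarrow> c > 0 \<and> (\<forall>S\<in>sets borel. emeasure lborel S = ennreal c * emeasure lborel (L -` S))"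

lemma linear_vimage_borel: "linear L \<Longrightarrow> S \<in> sets borel \<Longrightarrow> L -` S \<in> sets borel"
  for L :: "'a::euclidean_space \<Rightarrow> 'a"
  using measurable_sets[of L borel borel S]
  by (simp add: borel_measurable_continuous_onI linear_continuous_on linear_conv_bounded_linear)

text \<open>The image of Lebesgue measure under L is translation invariant and finite on balls, so
  it is a multiple of Lebesgue measure; the unit ball fixes the multiple.\<close>

lemma lborel_scale_exists:
  fixes L :: "'a::euclidean_space \<Rightarrow> 'a"
  assumes L: "linear L" and L': "linear L'" "\<And>x. L' (L x) = x" "\<And>x. L (L' x) = x"
  obtains c where "lborel_scale L c" "bounded S \<Longrightarrow> bounded (L -` S)"
proof -
  have Lm [measurable]: "L \<in> borel_measurable borel"
    using L by (simp add: borel_measurable_continuous_onI linear_continuous_on linear_conv_bounded_linear)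
  have vim: "L -` S = L' ` S" for S using L' by (auto simp: image_iff) metis
  have bdd: "bounded (L -` S)" if "bounded S" for S
    unfolding vim using that L'(1) by (simp add: bounded_linear_image linear_conv_bounded_linear)
  define N where "N = distr lborel borel L"
  have N: "emeasure N S = emeasure lborel (L -` S)" if "S \<in> sets borel" for S
    using that by (simp add: N_def emeasure_distr)
  have Nball: "emeasure N (ball 0 r) < \<infinity>" for r
    using bdd[of "ball 0 r"] using emeasure_bounded_finite by (auto simp: N)
  have "open (L -` ball 0 1)"
    using L by (simp add: open_vimage linear_continuous_on linear_conv_bounded_linear)
  moreover have "0 \<in> L -` ball 0 1" using L by (simp add: linear_0)
  ultimately have Npos: "emeasure N (ball 0 1) > 0"
    unfolding N[OF borel_open[OF open_ball]] by (intro emeasure_lborel_open_pos) auto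
  have cross: "emeasure lborel A * emeasure N (ball 0 1) = emeasure lborel (uminus -` ball (0::'a) 1) * emeasure N A"
    if "A \<in> sets borel" for A
  proof (rule translation_invariant_cross[where V = UNIV and M = lborel and N = N])
    show "sigma_finite_measure N"
      using Nball by (intro sigma_finite_measure_balls) (auto simp: N_def)
    fix v :: 'a
    show "distr lborel borel (\<lambda>x. x + v) = lborel"
    proof -
      have "(\<lambda>x. x + v) = (+) v" by (auto simp: add.commute)
      then show ?thesis by (simp add: lborel_distr_plus)
    qed
    show "distr N borel (\<lambda>x. x + v) = N"
    proof -
      have "distr N borel (\<lambda>x. x + v) = distr lborel borel (\<lambda>x. L (L' v + x))"
        unfolding N_def using L L' by (subst distr_distr) (auto simp: o_def linear_add add.commute)
      also have "\<dots> = distr (distr lborel borel ((+) (L' v))) borel L"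
        by (subst distr_distr) (auto simp: o_def)
      finally show ?thesis by (simp add: lborel_distr_plus N_def)
    qed
  qed (use that in \<open>auto simp: N_def sigma_finite_lborel\<close>)
  have neg: "uminus -` ball 0 1 = (ball 0 1 :: 'a set)" by auto
  obtain p q where p: "emeasure N (ball 0 1) = ennreal p" "p > 0"
    and q: "emeasure lborel (ball (0::'a) 1) = ennreal q" "q > 0"
  proof -
    have *: "\<exists>r>0. x = ennreal r" if "0 < x" "x < \<infinity>" for x
      using that by (cases x) auto
    from *[OF Npos Nball] *[OF emeasure_lborel_open_pos emeasure_bounded_finite, of "ball (0::'a) 1"]
    show thesis using that by auto
  qed
  show ?thesis
  proof (rule that)
    have "emeasure lborel A = ennreal (q / p) * emeasure lborel (L -` A)" if A: "A \<in> sets borel" for A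
    proof -
      have "emeasure lborel A = emeasure lborel A * ennreal p * ennreal (1 / p)"
        using p by (simp add: mult.assoc ennreal_mult[symmetric])
      also have "\<dots> = ennreal q * emeasure N A * ennreal (1 / p)"
        using cross[OF A] p q neg by simp
      also have "\<dots> = (ennreal q * ennreal (1 / p)) * emeasure N A" by (simp only: ac_simps)
      also have "ennreal q * ennreal (1 / p) = ennreal (q / p)"
        using p q by (simp add: ennreal_mult[symmetric])
      finally show ?thesis using A by (simp add: N)
    qed
    then show "lborel_scale L (q / p)" using p q by (simp add: lborel_scale_def)
  qed (rule bdd)
qed

lemma lborel_scaleD:
  "lborel_scale L c \<Longrightarrow> S \<in> sets borel \<Longrightarrow> emeasure lborel S = ennreal c * emeasure lborel (L -` S)"
  by (simp add: lborel_scale_def)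

text \<open>This lets algebraic identities between maps determine their factors: composition
  multiplies them, and the identity has factor 1.\<close>

lemma lborel_scale_unique:
  fixes L :: "'a::euclidean_space \<Rightarrow> 'a"
  assumes "lborel_scale L c" "lborel_scale L c'"
  shows "c = c'"
proof -
  let ?B = "ball (0::'a) 1"
  have c: "c > 0" "c' > 0" using assms by (auto simp: lborel_scale_def)
  have fin: "emeasure lborel ?B < \<infinity>" by (rule emeasure_bounded_finite) simp
  have pos: "emeasure lborel ?B > 0" by (rule emeasure_lborel_open_pos) auto
  have eq: "emeasure lborel ?B = ennreal c * emeasure lborel (L -` ?B)"
    "emeasure lborel ?B = ennreal c' * emeasure lborel (L -` ?B)"
    using assms by (auto dest!: lborel_scaleD[where S = ?B])
  obtain r where r: "emeasure lborel (L -` ?B) = ennreal r" "r \<ge> 0"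
    using eq(1) fin c by (cases "emeasure lborel (L -` ?B)") (auto simp: ennreal_mult_top)
  have "r \<noteq> 0" using eq(1) pos r by auto
  then show ?thesis using eq r c by (simp add: ennreal_mult[symmetric])
qed

lemma lborel_scale_id: "lborel_scale (\<lambda>x. x) 1"
  by (simp add: lborel_scale_def)

lemma lborel_scale_compose:
  assumes "lborel_scale L c" "lborel_scale M d" "linear L"
  shows "lborel_scale (\<lambda>x. L (M x)) (c * d)"
  unfolding lborel_scale_def
proof (intro conjI ballI)
  show "c * d > 0" using assms by (auto simp: lborel_scale_def)
  fix S :: "'a set" assume S: "S \<in> sets borel"
  have "emeasure lborel S = ennreal c * (ennreal d * emeasure lborel (M -` (L -` S)))"
    using lborel_scaleD[OF assms(1) S] lborel_scaleD[OF assms(2) linear_vimage_borel[OF assms(3) S]] by simp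
  then show "emeasure lborel S = ennreal (c * d) * emeasure lborel ((\<lambda>x. L (M x)) -` S)"
    using assms by (simp add: lborel_scale_def ennreal_mult mult.assoc vimage_def)
qed

text \<open>Conjugation with the reflection \<open>D\<close> inverts the shear, so the square of its factor is 1.\<close>

lemma lborel_scale_shear:
  fixes v :: "real ^ 'n"
  assumes v: "v $ k = 0"
  shows "lborel_scale (\<lambda>z. z + z $ k *\<^sub>R v) 1"
proof -
  define S where "S v z = z + z $ k *\<^sub>R v" for v z :: "real ^ 'n"
  define D where "D z = z - (2 * z $ k) *\<^sub>R axis k 1" for z :: "real ^ 'n"
  have lin: "linear (S v)" "linear D" for v
    by (auto intro!: linearI simp: S_def D_def algebra_simps)
  have SS: "S v (S (- v) z) = z" "S (- v) (S v z) = z" for z using v by (auto simp: S_def algebra_simps)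
  have DD: "D (D z) = z" for z by (auto simp: D_def algebra_simps axis_def vec_eq_iff)
  have DSD: "D (S v (D z)) = S (- v) z" for z
    using v by (auto simp: D_def S_def algebra_simps axis_def vec_eq_iff)
  obtain c where c: "lborel_scale (S v) c" using lborel_scale_exists[OF lin(1) lin(1) SS(2,1)] by metis
  obtain d where d: "lborel_scale D d" using lborel_scale_exists[OF lin(2) lin(2) DD DD] by metis
  have pos: "c > 0" "d > 0" using c d by (auto simp: lborel_scale_def)
  have "d * d = 1"
    using lborel_scale_unique[OF lborel_scale_compose[OF d d lin(2)]] lborel_scale_id by (simp add: DD)
  then have dcd: "d * (c * d) = c" by (metis mult.commute mult.left_commute mult.right_neutral)
  have "lborel_scale (S (- v)) (d * (c * d))"
    using lborel_scale_compose[OF d lborel_scale_compose[OF c d lin(1)] lin(2)] by (simp add: DSD)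
  then have "lborel_scale (S (- v)) c" by (simp only: dcd)
  from lborel_scale_compose[OF c this lin(1)] have "lborel_scale (\<lambda>x::real ^ 'n. x) (c * c)" by (simp add: SS)
  then have "c * c = 1" using lborel_scale_unique lborel_scale_id by blast
  then have "c = 1" using pos by (simp add: square_eq_1_iff)
  then show ?thesis using c by (simp add: S_def[abs_def])
qed

text \<open>The unit ball is its own preimage and has finite positive volume, which forces the
  factor 1.\<close>

lemma lborel_scale_orthogonal:
  fixes R :: "real ^ 'n \<Rightarrow> real ^ 'n"
  assumes R: "orthogonal_transformation R"
  shows "lborel_scale R 1"
proof -
  let ?B = "ball (0::real ^ 'n) 1"
  have bij: "bij R" "linear R" and R': "orthogonal_transformation (inv R)"
    using R orthogonal_transformation_bij orthogonal_transformation_linear orthogonal_transformation_inv by auto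
  then have "linear (inv R)" "\<And>x. inv R (R x) = x" "\<And>x. R (inv R x) = x"
    using orthogonal_transformation_linear by (auto simp: bij_def surj_f_inv_f)
  then obtain c where c: "lborel_scale R c" using lborel_scale_exists[OF bij(2)] by metis
  have "R -` ?B = ?B" using R by (auto simp: orthogonal_transformation_norm)
  then have *: "emeasure lborel ?B = ennreal c * emeasure lborel ?B"
    using lborel_scaleD[OF c, of ?B] by simp
  have "emeasure lborel ?B > 0" "emeasure lborel ?B < \<infinity>"
    by (auto intro!: emeasure_lborel_open_pos emeasure_bounded_finite[simplified])
  then obtain q where q: "emeasure lborel ?B = ennreal q" "q > 0"
    by (cases "emeasure lborel ?B") auto
  have "c > 0" using c by (simp add: lborel_scale_def)
  then have "ennreal q = ennreal (c * q)" using * q by (simp add: ennreal_mult'[symmetric])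
  then have "c = 1" using q(2) \<open>c > 0\<close> by simp
  then show ?thesis using c by simp
qed

lemma lborel_scale_diagonal:
  fixes a :: "'n::finite \<Rightarrow> real"
  assumes "\<And>i. a i > 0"
  shows "lborel_scale (\<lambda>z. \<chi> i. a i * z $ i) (\<Prod>i\<in>UNIV. a i)" "linear (\<lambda>z. \<chi> i. a i * z $ i)"
proof -
  let ?L = "\<lambda>z. \<chi> i. a i * z $ i"
  show lin: "linear ?L" by (auto intro!: linearI simp: vec_eq_iff algebra_simps)
  define c where "c j = (\<Sum>i\<in>UNIV. a i * j $ i)" for j :: "real ^ 'n"
  have c: "c (axis i 1) = a i" for i by (simp add: c_def axis_def if_distrib cong: if_cong)
  have B: "Basis = range (\<lambda>i::'n. axis i (1::real))" by (auto simp: Basis_vec_def)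
  have inj: "inj (\<lambda>i::'n. axis i (1::real))" by (auto simp: inj_on_def axis_eq_axis)
  have T: "(0 + (\<Sum>j\<in>Basis. (c j * (x \<bullet> j)) *\<^sub>R j)) = ?L x" for x
    unfolding B by (subst sum.reindex[OF inj]) (simp add: c inner_axis vec_eq_iff, simp add: axis_def if_distrib cong: if_cong)
  have P: "(\<Prod>j\<in>Basis. \<bar>c j\<bar>) = (\<Prod>i\<in>UNIV. a i)"
    unfolding B by (subst prod.reindex[OF inj]) (use assms in \<open>simp add: c less_imp_le\<close>)
  have "lborel = density (distr lborel borel (\<lambda>x. 0 + (\<Sum>j\<in>Basis. (c j * (x \<bullet> j)) *\<^sub>R j))) (\<lambda>_. (\<Prod>j\<in>Basis. \<bar>c j\<bar>))"
    by (rule lborel_affine_euclidean) (use assms in \<open>auto simp: B c less_imp_neq[symmetric]\<close>)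
  then have eq: "lborel = density (distr lborel borel ?L) (\<lambda>_. (\<Prod>i\<in>UNIV. a i))"
    by (simp only: T P)
  have [measurable]: "?L \<in> borel_measurable borel"
    using lin by (simp add: borel_measurable_continuous_onI linear_continuous_on linear_conv_bounded_linear)
  show "lborel_scale ?L (\<Prod>i\<in>UNIV. a i)"
    unfolding lborel_scale_def
  proof (intro conjI ballI)
    fix S :: "(real ^ 'n) set" assume S [measurable]: "S \<in> sets borel"
    show "emeasure lborel S = ennreal (\<Prod>i\<in>UNIV. a i) * emeasure lborel (?L -` S)"
      by (subst eq) (simp add: emeasure_density nn_integral_cmult_indicator emeasure_distr)
  qed (use assms in \<open>simp add: prod_pos\<close>)
qed

section \<open>Volumes of cones over moved bases\<close>

lemma emeasure_cone_over_linear: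
  fixes L :: "real ^ 'n \<Rightarrow> real ^ 'n"
  assumes "linear L" "\<And>z. L z \<bullet> b' = z \<bullet> b" "lborel_scale L c" "C \<in> sets borel"
  shows "emeasure lborel (cone_over b' C) = ennreal c * emeasure lborel (cone_over b (L -` C))"
  using lborel_scaleD[OF assms(3), of "cone_over b' C"] assms
  by (simp add: cone_over_linear_vimage[OF assms(1,2)])

text \<open>A translation inside the hyperplane {z. z $ k = 1} extends to a shear of the whole
  space, which fixes coordinate k and preserves volume.\<close>

lemma emeasure_cone_over_translate:
  fixes v :: "real ^ 'n"
  assumes "v $ k = 0" "C \<in> sets borel"
  shows "emeasure lborel (cone_over (axis k 1) C) = emeasure lborel (cone_over (axis k 1) ((\<lambda>y. y + v) -` C))"
proof -
  let ?L = "\<lambda>z. z + z $ k *\<^sub>R v"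
  have "linear ?L" by (auto intro!: linearI simp: algebra_simps)
  then have "emeasure lborel (cone_over (axis k 1) C) = ennreal 1 * emeasure lborel (cone_over (axis k 1) (?L -` C))"
    using assms by (intro emeasure_cone_over_linear lborel_scale_shear) (auto simp: inner_axis)
  also have "cone_over (axis k 1) (?L -` C) = cone_over (axis k 1) ((\<lambda>y. y + v) -` C)"
    by (auto simp: cone_over_def inner_axis)
  finally show ?thesis by simp
qed

section \<open>Hausdorff measure of pieces of hyperplanes\<close>

lemma hausdorff_premeasure_finite_cover:
  assumes F: "finite F" and cov: "A \<subseteq> (\<Union>f\<in>F. U f)"
    and U: "\<And>f. f \<in> F \<Longrightarrow> bounded (U f)" "\<And>f. f \<in> F \<Longrightarrow> diameter (U f) \<le> r" and r: "0 \<le> r" "r \<le> \<delta>"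
  shows "hausdorff_premeasure d \<delta> A \<le> of_nat (card F) * ennreal (unit_ball_vol d * (r / 2) ^ d)"
proof -
  obtain g where g: "bij_betw g {..<card F} F"
    using ex_bij_betw_nat_finite[OF F] by (auto simp: atLeast0LessThan)
  define V where "V i = (if i < card F then U (g i) else {})" for i
  have gF: "g i \<in> F" if "i < card F" for i using g that by (auto simp: bij_betw_def)
  have "A \<subseteq> (\<Union>i. V i)"
  proof
    fix x assume "x \<in> A"
    then obtain f where f: "f \<in> F" "x \<in> U f" using cov by auto
    then obtain i where "i < card F" "f = g i" using g by (auto simp: bij_betw_def)
    then show "x \<in> (\<Union>i. V i)" using f by (auto simp: V_def intro!: exI[of _ i])
  qed
  moreover have "bounded (V i) \<and> diameter (V i) \<le> \<delta>" for i
    using U gF r by (auto simp: V_def intro: order_trans)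
  ultimately have "V \<in> hausdorff_covers \<delta> A" by (simp add: hausdorff_covers_def)
  then have "hausdorff_premeasure d \<delta> A \<le> (\<Sum>i. hausdorff_weight d (V i))"
    by (rule hausdorff_premeasure_le)
  also have "\<dots> = (\<Sum>i<card F. hausdorff_weight d (V i))"
    by (rule suminf_finite) (auto simp: V_def)
  also have "\<dots> \<le> (\<Sum>i<card F. ennreal (unit_ball_vol d * (r / 2) ^ d))"
  proof (rule sum_mono)
    fix i assume "i \<in> {..<card F}"
    then show "hausdorff_weight d (V i) \<le> ennreal (unit_ball_vol d * (r / 2) ^ d)"
      using U[OF gF[of i]] diameter_ge_0[of "U (g i)"]
      by (auto simp: V_def hausdorff_weight_def intro!: ennreal_leI mult_left_mono power_mono divide_right_mono)
  qed
  finally show ?thesis by simp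
qed

text \<open>A grid of mesh 1 / N has N^(n-1) cells of diameter at most n / N, so the total weight of
  the cover is independent of N, however small the scale \<delta>.\<close>

lemma hausdorff_outer_unit_cube_finite:
  "hausdorff_outer (CARD('n) - 1) {y :: real ^ 'n. y $ k = 0 \<and> (\<forall>i. i \<noteq> k \<longrightarrow> 0 \<le> y $ i \<and> y $ i \<le> 1)} < \<infinity>"
    (is "hausdorff_outer ?d ?Q < _")
proof -
  let ?n = "CARD('n)"
  have n: "?n \<ge> 1" by (simp add: Suc_leI)
  have bound: "hausdorff_premeasure ?d \<delta> ?Q \<le> ennreal (unit_ball_vol ?d * (?n / 2) ^ ?d)" if \<delta>: "\<delta> > 0" for \<delta>
  proof -
    obtain N :: nat where N0: "real ?n / \<delta> < real N" using reals_Archimedean2 by blast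
    then have N: "N > 0" using \<delta> by (metis divide_nonneg_pos gr0I not_less of_nat_0 of_nat_0_le_iff)
    have Nd: "?n / N \<le> \<delta>" using N0 N \<delta> by (simp add: field_simps)
    define F where "F = PiE (UNIV :: 'n set) (\<lambda>i. if i = k then {0::nat} else {..<N})"
    have F: "finite F" unfolding F_def by (rule finite_PiE) auto
    have "card F = (\<Prod>i\<in>(UNIV :: 'n set). if i = k then 1 else N)"
      unfolding F_def by (subst card_PiE) (auto intro!: prod.cong)
    also have "\<dots> = (\<Prod>i\<in>UNIV - {k}. N)"
      by (rule prod.mono_neutral_cong_right) auto
    also have "\<dots> = N ^ ?d" by simp
    finally have cF: "card F = N ^ ?d" .
    define U where "U f = {y :: real ^ 'n. y $ k = 0 \<and> (\<forall>i. i \<noteq> k \<longrightarrow> real (f i) / N \<le> y $ i \<and> y $ i \<le> (real (f i) + 1) / N)}" for f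
    have dist_U: "norm (x - y) \<le> ?n / N" if "x \<in> U f" "y \<in> U f" for x y f
    proof -
      have "norm (x - y) \<le> (\<Sum>i\<in>UNIV. \<bar>(x - y) $ i\<bar>)" by (rule norm_le_l1_cart)
      also have "\<dots> \<le> (\<Sum>i\<in>(UNIV::'n set). 1 / N)"
      proof (rule sum_mono)
        fix i :: 'n
        show "\<bar>(x - y) $ i\<bar> \<le> 1 / N"
        proof (cases "i = k")
          case False
          then have "real (f i) / N \<le> x $ i" "x $ i \<le> real (f i) / N + 1 / N"
             "real (f i) / N \<le> y $ i" "y $ i \<le> real (f i) / N + 1 / N"
            using that by (auto simp: U_def add_divide_distrib)
          then show ?thesis by simp
        qed (use that in \<open>auto simp: U_def\<close>)
      qed
      finally show ?thesis by simp
    qed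
    have "hausdorff_premeasure ?d \<delta> ?Q \<le> of_nat (card F) * ennreal (unit_ball_vol ?d * ((?n / N) / 2) ^ ?d)"
    proof (rule hausdorff_premeasure_finite_cover[OF F])
      show "?Q \<subseteq> (\<Union>f\<in>F. U f)"
      proof
        fix y assume y: "y \<in> ?Q"
        \<comment> \<open>The cap at N - 1 puts the points of the face y $ i = 1 into the last
          cell.\<close>
        define f where "f i = (if i = k then 0 else min (N - 1) (nat \<lfloor>N * y $ i\<rfloor>))" for i
        have "f \<in> F" using N by (auto simp: F_def f_def)
        moreover have "y \<in> U f"
          unfolding U_def
        proof (intro CollectI conjI allI impI)
          fix i assume i: "i \<noteq> k"
          then have yi: "0 \<le> y $ i" "y $ i \<le> 1" using y by auto
          have fi: "f i = min (N - 1) (nat \<lfloor>N * y $ i\<rfloor>)" using i by (simp add: f_def)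
          have fl: "real (nat \<lfloor>N * y $ i\<rfloor>) \<le> N * y $ i" "N * y $ i < real (nat \<lfloor>N * y $ i\<rfloor>) + 1"
            using yi N by simp_all
          have "real (f i) \<le> N * y $ i" using fl(1) fi by linarith
          then show "real (f i) / N \<le> y $ i" using N by (simp add: field_simps)
          have "N * y $ i \<le> real (f i) + 1"
          proof (cases "nat \<lfloor>N * y $ i\<rfloor> \<le> N - 1")
            case True then show ?thesis using fl(2) fi by simp
          next
            case False
            then have "real (f i) + 1 = N" using fi N by (simp add: of_nat_diff)
            then show ?thesis using yi N mult_left_mono[of "y $ i" 1 "real N"] by simp
          qed
          then show "y $ i \<le> (real (f i) + 1) / N" using N by (simp add: field_simps)
        qed (use y in auto)
        ultimately show "y \<in> (\<Union>f\<in>F. U f)" by blast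
      qed
      fix f
      show "bounded (U f)"
      proof (cases "U f = {}")
        case False
        then obtain x where "x \<in> U f" by auto
        then have "\<forall>y\<in>U f. dist x y \<le> ?n / N" using dist_U by (auto simp: dist_norm)
        then show ?thesis unfolding bounded_def by blast
      qed simp
      show "diameter (U f) \<le> ?n / N"
        by (rule diameter_le) (use dist_U in auto)
    qed (use Nd in auto)
    also have "\<dots> = ennreal (N ^ ?d * (unit_ball_vol ?d * ((?n / N) / 2) ^ ?d))"
      by (simp add: cF ennreal_mult ennreal_of_nat_eq_real_of_nat unit_ball_vol_nonneg)
    also have "N ^ ?d * (unit_ball_vol ?d * ((?n / N) / 2) ^ ?d) = unit_ball_vol ?d * (?n / 2) ^ ?d"
      using N by (simp add: power_divide power_mult_distrib)
    finally show ?thesis .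
  qed
  have "hausdorff_outer ?d ?Q \<le> ennreal (unit_ball_vol ?d * (?n / 2) ^ ?d)"
    unfolding hausdorff_outer_def by (rule SUP_least) (use bound in auto)
  then show ?thesis by (simp add: order_le_less_trans)
qed

lemma cone_over_bounded:
  assumes "bounded C"
  shows "bounded (cone_over b C)"
proof -
  obtain B where B: "B > 0" "\<And>y. y \<in> C \<Longrightarrow> norm y \<le> B" using assms by (auto simp: bounded_pos)
  have "norm z \<le> B" if "z \<in> cone_over b C" for z
  proof -
    let ?t = "z \<bullet> b"
    have t: "0 < ?t" "?t < 1" "norm (z /\<^sub>R ?t) \<le> B"
      using that B(2)[of "z /\<^sub>R ?t"] by (simp_all add: cone_over_def)
    then have "norm z \<le> ?t * B" by (simp add: field_simps)
    also have "\<dots> \<le> 1 * B" using t B by (intro mult_right_mono) auto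
    finally show ?thesis by simp
  qed
  then show ?thesis by (auto simp: bounded_iff)
qed

text \<open>A shear moves the centre to \<open>axis k 1\<close>; scaling the n - 1 other axes by r
  then contributes r^(n-1), the same power of the size as in the Hausdorff weight.\<close>

lemma emeasure_cone_over_cball:
  fixes x :: "real ^ 'n"
  assumes n: "CARD('n) \<ge> 2" and x: "x $ k = 1" and r: "0 \<le> r"
  shows "emeasure lborel (cone_over (axis k 1) (cball x r))
    \<le> ennreal (r ^ (CARD('n) - 1)) * emeasure lborel (cone_over (axis k 1) (cball (axis k 1) 1))"
proof -
  let ?e = "axis k 1 :: real ^ 'n"
  have "emeasure lborel (cone_over ?e (cball x r)) = emeasure lborel (cone_over ?e ((\<lambda>y. y + (x - ?e)) -` cball x r))"
    by (rule emeasure_cone_over_translate) (use x in \<open>auto simp: axis_def\<close>)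
  also have "(\<lambda>y. y + (x - ?e)) -` cball x r = cball ?e r"
    by (auto simp: dist_norm algebra_simps)
  also have "emeasure lborel (cone_over ?e (cball ?e r))
    \<le> ennreal (r ^ (CARD('n) - 1)) * emeasure lborel (cone_over ?e (cball ?e 1))"
  \<comment> \<open>For r = 0 the scaling map is singular. The cone is then part of the axis k and
    lies in another coordinate hyperplane, which exists because n \<ge> 2.\<close>
  proof (cases "r = 0")
    case True
    have "UNIV - {k} \<noteq> {}"
    proof
      assume "UNIV - {k} = {}"
      then have "CARD('n) \<le> card {k}" by (intro card_mono) auto
      then show False using n by simp
    qed
    then obtain j where j: "j \<noteq> k" by auto
    have "cone_over ?e (cball ?e r) \<subseteq> {z. axis j 1 \<bullet> z = 0}"
    proof
      fix z assume "z \<in> cone_over ?e (cball ?e r)"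
      then have "z \<bullet> ?e \<noteq> 0" "z /\<^sub>R (z \<bullet> ?e) = ?e" using True by (auto simp: cone_over_def)
      then have "z = (z \<bullet> ?e) *\<^sub>R ?e" by (metis scaleR_one scaleR_scaleR right_inverse)
      then have "z $ j = ((z \<bullet> ?e) *\<^sub>R ?e) $ j" by simp
      then have "z $ j = 0" using j by (simp add: axis_def)
      then show "z \<in> {z. axis j 1 \<bullet> z = 0}" by (simp add: inner_axis')
    qed
    moreover have "negligible {z. axis j (1::real) \<bullet> z = 0}"
      by (rule negligible_hyperplane) auto
    ultimately have "negligible (cone_over ?e (cball ?e r))" using negligible_subset by blast
    then have "emeasure lebesgue (cone_over ?e (cball ?e r)) = 0"
      by (subst (asm) negligible_iff_emeasure0) auto
    then show ?thesis by simp
  next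
    case False
    then have r: "r > 0" using r by simp
    define a where "a i = (if i = k then 1 else r)" for i
    let ?L = "\<lambda>z :: real ^ 'n. \<chi> i. a i * z $ i"
    have a: "a i > 0" for i using r by (simp add: a_def)
    have pa: "(\<Prod>i\<in>UNIV. a i) = r ^ (CARD('n) - 1)"
    proof -
      have "(\<Prod>i\<in>UNIV. a i) = (\<Prod>i\<in>UNIV - {k}. r)"
        by (rule prod.mono_neutral_cong_right) (auto simp: a_def)
      then show ?thesis by simp
    qed
    have "emeasure lborel (cone_over ?e (cball ?e r)) = ennreal (r ^ (CARD('n) - 1)) * emeasure lborel (cone_over ?e (?L -` cball ?e r))"
      unfolding pa[symmetric]
      by (rule emeasure_cone_over_linear[OF lborel_scale_diagonal(2) _ lborel_scale_diagonal(1)])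
         (use a in \<open>auto simp: inner_axis a_def\<close>)
    also have "cone_over ?e (?L -` cball ?e r) \<subseteq> cone_over ?e (cball ?e 1)"
    proof -
      have "dist ?e y \<le> 1" if "y $ k = 1" "dist ?e (?L y) \<le> r" for y
      proof -
        have "?e - ?L y = r *\<^sub>R (?e - y)" using that by (auto simp: vec_eq_iff a_def axis_def)
        then show ?thesis using that r by (simp add: dist_norm)
      qed
      then show ?thesis by (auto simp: cone_over_def inner_axis)
    qed
    then have "emeasure lborel (cone_over ?e (?L -` cball ?e r)) \<le> emeasure lborel (cone_over ?e (cball ?e 1))"
      by (rule emeasure_mono) simp
    finally show ?thesis by (simp add: mult_left_mono)
  qed
  finally show ?thesis .
qed

text \<open>A lower bound for Hausdorff measure, which rules out that it vanishes on the hyperplane.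
  Each relevant set of a cover meets Q in a subset of the ball around a point of Q with the diameter
  of the set as radius, and the cone over that ball has controlled volume.\<close>

lemma cone_over_le_hausdorff:
  assumes n: "CARD('n) \<ge> 2"
  shows "\<exists>c>0. \<forall>Q \<subseteq> {y :: real ^ 'n. y $ k = 1}. 
    emeasure lborel (cone_over (axis k 1) Q) \<le> ennreal c * hausdorff_outer (CARD('n) - 1) Q"
proof -
  let ?e = "axis k 1 :: real ^ 'n" and ?d = "CARD('n) - 1"
  have "emeasure lborel (cone_over ?e (cball ?e 1)) < \<infinity>"
    by (intro emeasure_bounded_finite cone_over_bounded) auto
  then obtain K where K: "K \<ge> 0" "emeasure lborel (cone_over ?e (cball ?e 1)) = ennreal K"
    by (cases "emeasure lborel (cone_over ?e (cball ?e 1))") auto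
  define w where "w = unit_ball_vol (real ?d)"
  have w: "w > 0" by (simp add: w_def)
  \<comment> \<open>2^d / w undoes the normalization w (diameter / 2)^d of the weight; K + 1 in
    place of K keeps c positive.\<close>
  define c where "c = (K + 1) * 2 ^ ?d / w"
  have c: "c > 0" using K w by (simp add: c_def)
  have "emeasure lborel (cone_over ?e Q) \<le> ennreal c * hausdorff_outer ?d Q" if Q: "Q \<subseteq> {y. y $ k = 1}" for Q
  proof -
    have "emeasure lborel (cone_over ?e Q) \<le> ennreal c * (\<Sum>i. hausdorff_weight ?d (U i))"
      if U: "U \<in> hausdorff_covers 1 Q" for U
    proof -
      define x where "x i = (SOME x. x \<in> U i \<inter> Q)" for i
      have x: "x i \<in> U i \<inter> Q" if "U i \<inter> Q \<noteq> {}" for i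
        unfolding x_def by (rule someI_ex) (use that in auto)
      define B where "B i = (if U i \<inter> Q = {} then {} else cball (x i) (diameter (U i)))" for i
      have bU: "bounded (U i)" for i using U by (simp add: hausdorff_covers_def)
      have UB: "U i \<inter> Q \<subseteq> B i" for i
      proof
        fix y assume y: "y \<in> U i \<inter> Q"
        then have "dist (x i) y \<le> diameter (U i)"
          using x[of i] by (intro diameter_bounded_bound[OF bU]) auto
        then show "y \<in> B i" using y by (auto simp: B_def)
      qed
      have "Q \<subseteq> (\<Union>i. B i)" using U UB by (fastforce simp: hausdorff_covers_def)
      then have "cone_over ?e Q \<subseteq> (\<Union>i. cone_over ?e (B i))" by (fastforce simp: cone_over_def)
      then have "emeasure lborel (cone_over ?e Q) \<le> emeasure lborel (\<Union>i. cone_over ?e (B i))"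
        by (rule emeasure_mono) (auto simp: B_def)
      also have "\<dots> \<le> (\<Sum>i. emeasure lborel (cone_over ?e (B i)))"
        by (rule emeasure_subadditive_countably) (auto simp: B_def)
      also have "\<dots> \<le> (\<Sum>i. ennreal c * hausdorff_weight ?d (U i))"
      proof (rule suminf_le)
        fix i
        show "emeasure lborel (cone_over ?e (B i)) \<le> ennreal c * hausdorff_weight ?d (U i)"
        proof (cases "U i \<inter> Q = {}")
          case False
          then have xk: "x i $ k = 1" using x Q by auto
          let ?r = "diameter (U i)"
          have r: "?r \<ge> 0" using bU by (rule diameter_ge_0)
          have "emeasure lborel (cone_over ?e (B i)) \<le> ennreal (?r ^ ?d) * ennreal K"
            using emeasure_cone_over_cball[OF n xk r] K False by (simp add: B_def)
          also have "\<dots> = ennreal (?r ^ ?d * K)" using r K by (simp add: ennreal_mult)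
          also have "\<dots> \<le> ennreal (c * (w * (?r / 2) ^ ?d))"
          proof (rule ennreal_leI)
            have "c * (w * (?r / 2) ^ ?d) = ?r ^ ?d * (K + 1)" using w by (simp add: c_def power_divide)
            then show "?r ^ ?d * K \<le> c * (w * (?r / 2) ^ ?d)" using r by (simp add: mult_left_mono)
          qed
          also have "\<dots> = ennreal c * hausdorff_weight ?d (U i)"
            using False c w r by (auto simp: hausdorff_weight_def ennreal_mult w_def)
          finally show ?thesis .
        qed (simp add: B_def cone_over_def)
      qed auto
      finally show ?thesis by simp
    qed
    then have "emeasure lborel (cone_over ?e Q) \<le> ennreal c * hausdorff_premeasure ?d 1 Q"
      unfolding hausdorff_premeasure_alt using c by (intro ennreal_le_cmult_INF) auto
    also have "\<dots> \<le> ennreal c * hausdorff_outer ?d Q"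
      by (intro mult_left_mono hausdorff_premeasure_le_outer) auto
    finally show ?thesis .
  qed
  then show ?thesis using c by blast
qed

lemma hausdorff_outer_coordinate_plane_finite:
  assumes "bounded A" "A \<subseteq> {y :: real ^ 'n. y $ k = 0}"
  shows "hausdorff_outer (CARD('n) - 1) A < \<infinity>"
proof -
  let ?d = "CARD('n) - 1"
  let ?Q = "{y :: real ^ 'n. y $ k = 0 \<and> (\<forall>i. i \<noteq> k \<longrightarrow> 0 \<le> y $ i \<and> y $ i \<le> 1)}"
  obtain r where r: "r > 0" "\<And>x. x \<in> A \<Longrightarrow> norm x \<le> r" using assms(1) by (auto simp: bounded_pos)
  let ?c = "\<chi> i. if i = k then 0 else r"
  let ?g = "\<lambda>y. (2 * r) *\<^sub>R y - ?c"
  have "A \<subseteq> ?g ` ?Q"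
  proof
    fix x assume x: "x \<in> A"
    let ?y = "(1 / (2 * r)) *\<^sub>R (x + ?c)"
    have ab: "\<bar>x $ i\<bar> \<le> r" for i using r(2)[OF x] component_le_norm_cart[of x i] by linarith
    have xi: "x $ i \<le> r" "- r \<le> x $ i" for i using ab[of i] by linarith+
    have "0 \<le> ?y $ i \<and> ?y $ i \<le> 1" if "i \<noteq> k" for i
      using xi[of i] r(1) that by (simp add: field_simps)
    moreover have "?y $ k = 0" using x assms(2) by auto
    ultimately have "?y \<in> ?Q" by simp
    moreover have "x = ?g ?y" using r by (simp add: vec_eq_iff)
    ultimately show "x \<in> ?g ` ?Q" by blast
  qed
  then have "hausdorff_outer ?d A \<le> hausdorff_outer ?d (?g ` ?Q)" by (rule hausdorff_outer_mono)
  also have "\<dots> \<le> ennreal ((2 * r) ^ ?d) * hausdorff_outer ?d ?Q"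
    using r by (intro hausdorff_outer_lipschitz_image) (auto simp: dist_norm simp flip: scaleR_diff_right)
  also have "\<dots> < \<infinity>"
    using hausdorff_outer_unit_cube_finite[of k] by (simp add: ennreal_mult_less_top)
  finally show ?thesis .
qed

text \<open>Carried to the linear hyperplane \<open>V\<close> by a shift along
  \<open>axis k 1\<close>, both measures are invariant under translations in \<open>V\<close>:
  Hausdorff measure by isometry, cone volume by shears. The values p and q on the unit ball fix the
  ratio.\<close>

lemma hausdorff_cone_coordinate_plane:
  assumes n: "CARD('n) \<ge> 2"
  shows "\<exists>c>0. \<forall>C\<in>sets borel. C \<subseteq> {y :: real ^ 'n. y $ k = 1} \<longrightarrow>
    hausdorff_outer (CARD('n) - 1) C = ennreal c * emeasure lborel (cone_over (axis k 1) C)"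
proof -
  let ?e = "axis k 1 :: real ^ 'n" and ?d = "CARD('n) - 1"
  let ?H = "hausdorff_outer ?d :: (real ^ 'n) set \<Rightarrow> _"
  let ?B = "cball (0 :: real ^ 'n) 1"
  define V where "V = {y :: real ^ 'n. y $ k = 0}"
  have V [measurable]: "V \<in> sets borel" unfolding V_def by measurable
  have subV: "subspace V" unfolding V_def by (auto simp: subspace_def)
  define M where "M = density (hausdorff_measure ?d) (indicator V)"
  have sM [measurable_cong, simp]: "sets M = sets borel" by (simp add: M_def)
  have M: "emeasure M A = ?H (V \<inter> A)" if "A \<in> sets borel" for A
    using that by (simp add: M_def emeasure_restricted emeasure_hausdorff_measure)
  define g where "g z = z /\<^sub>R (z \<bullet> ?e) - ?e" for z :: "real ^ 'n"
  have g [measurable]: "g \<in> borel_measurable borel" unfolding g_def by measurable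
  define S where "S = {z :: real ^ 'n. 0 < z \<bullet> ?e \<and> z \<bullet> ?e < 1}"
  have S [measurable]: "S \<in> sets borel" unfolding S_def by measurable
  define N where "N = distr (density lborel (indicator S)) borel g"
  have sN [measurable_cong, simp]: "sets N = sets borel" by (simp add: N_def)
  have shift [measurable]: "(\<lambda>y. y + v) -` A \<in> sets borel" if "A \<in> sets borel" for v and A :: "(real ^ 'n) set"
    using measurable_sets[of "\<lambda>y. y + v" borel borel A] that by simp
  have N: "emeasure N A = emeasure lborel (cone_over ?e ((\<lambda>y. y + (- ?e)) -` A))" if A: "A \<in> sets borel" for A
  proof -
    have "emeasure N A = emeasure lborel (S \<inter> g -` A)"
      unfolding N_def using A measurable_sets[OF g A] by (simp add: emeasure_distr emeasure_restricted)
    also have "S \<inter> g -` A = cone_over ?e ((\<lambda>y. y + (- ?e)) -` A)"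
      by (auto simp: S_def cone_over_def g_def)
    finally show ?thesis .
  qed
  have iso: "?H ((\<lambda>y. y + v) ` A) = ?H A" for v A
    by (rule hausdorff_outer_isometric_image) simp
  have Mfin: "emeasure M (ball 0 r) < \<infinity>" for r
    by (subst M) (auto intro!: hausdorff_outer_coordinate_plane_finite[where k = k, simplified] bounded_Int simp: V_def)
  have Nfin: "emeasure N A < \<infinity>" if "bounded A" "A \<in> sets borel" for A
  proof -
    have "bounded ((\<lambda>y. y + (- ?e)) -` A)"
    proof -
      have "(\<lambda>y. y + (- ?e)) -` A = (\<lambda>y. ?e + y) ` A" by (auto simp: image_iff algebra_simps) (metis diff_add_cancel)
      then show ?thesis using that by (simp add: bounded_translation)
    qed
    then show ?thesis unfolding N[OF that(2)] by (intro emeasure_bounded_finite cone_over_bounded)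
  qed
  have cross: "emeasure M A * emeasure N ?B = emeasure M (uminus -` ?B) * emeasure N A" if "A \<in> sets borel" for A
  proof (rule translation_invariant_cross[where V = V])
    show "sigma_finite_measure M" using Mfin by (intro sigma_finite_measure_balls) auto
    show "sigma_finite_measure N" using Nfin by (intro sigma_finite_measure_balls) auto
    show "AE x in M. x \<in> V" unfolding M_def by (subst AE_density) (auto simp: indicator_def)
    have "g z \<in> V" if "z \<in> S" for z using that by (auto simp: g_def V_def S_def inner_axis)
    then show "AE x in N. x \<in> V" unfolding N_def
      by (subst AE_distr_iff) (auto simp: AE_density indicator_def)
    fix v assume v: "v \<in> V"
    show "distr M borel (\<lambda>x. x + v) = M"
    proof (rule measure_eqI)
      fix A assume "A \<in> sets (distr M borel (\<lambda>x. x + v))"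
      then have A: "A \<in> sets borel" by simp
      have "V \<inter> A = (\<lambda>y. y + v) ` (V \<inter> (\<lambda>y. y + v) -` A)"
        using v by (auto simp: V_def image_iff intro!: bexI[of _ "x - v" for x])
      then have "?H (V \<inter> A) = ?H (V \<inter> (\<lambda>y. y + v) -` A)" using iso by metis
      moreover have "(\<lambda>x. x + v) \<in> measurable M borel" by measurable
      ultimately show "emeasure (distr M borel (\<lambda>x. x + v)) A = emeasure M A"
        using A shift[OF A] by (simp add: emeasure_distr M sets_eq_imp_space_eq[OF sM])
    qed simp
    show "distr N borel (\<lambda>x. x + v) = N"
    proof (rule measure_eqI)
      fix A assume "A \<in> sets (distr N borel (\<lambda>x. x + v))"
      then have A: "A \<in> sets borel" by simp
      have "emeasure N ((\<lambda>y. y + v) -` A) = emeasure N A"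
        unfolding N[OF A] N[OF shift[OF A]]
      proof -
        have eq: "(\<lambda>y. y + (- ?e)) -` (\<lambda>y. y + v) -` A = (\<lambda>y. y + v) -` (\<lambda>y. y + (- ?e)) -` A"
          by (auto simp: algebra_simps)
        show "emeasure lborel (cone_over ?e ((\<lambda>y. y + (- ?e)) -` (\<lambda>y. y + v) -` A))
          = emeasure lborel (cone_over ?e ((\<lambda>y. y + (- ?e)) -` A))"
          unfolding eq by (rule emeasure_cone_over_translate[symmetric]) (use v in \<open>simp add: V_def\<close>, rule shift[OF A])
      qed
      moreover have "(\<lambda>x. x + v) \<in> measurable N borel" by measurable
      ultimately show "emeasure (distr N borel (\<lambda>x. x + v)) A = emeasure N A"
        using A by (simp add: emeasure_distr sets_eq_imp_space_eq[OF sN])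
    qed simp
  qed (use that subV in auto)
  have neg: "uminus -` ?B = ?B" by auto
  have NB: "emeasure N ?B = emeasure lborel (cone_over ?e (cball ?e 1))"
  proof -
    have "(\<lambda>y. y + (- ?e)) -` ?B = cball ?e 1" by (auto simp: dist_norm norm_minus_commute)
    then show ?thesis by (simp only: N[OF borel_closed[OF closed_cball]])
  qed
  have NBpos: "emeasure N ?B > 0"
  proof -
    \<comment> \<open>An open piece of the cone, through which its volume is seen to be
      positive.\<close>
    define W where "W = {z :: real ^ 'n. 0 < z \<bullet> ?e} \<inter> {z. z \<bullet> ?e < 1} \<inter> {z. norm (z - (z \<bullet> ?e) *\<^sub>R ?e) < z \<bullet> ?e}"
    have "open W" unfolding W_def
      by (intro open_Int open_Collect_less continuous_intros)
    moreover have "(1/2) *\<^sub>R ?e \<in> W" by (simp add: W_def inner_axis)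
    ultimately have "emeasure lborel W > 0" by (intro emeasure_lborel_open_pos) auto
    also have "W \<subseteq> cone_over ?e (cball ?e 1)"
    proof
      fix z assume z: "z \<in> W"
      let ?t = "z \<bullet> ?e"
      have t: "?t > 0" "?t < 1" "norm (z - ?t *\<^sub>R ?e) < ?t" using z by (auto simp: W_def)
      have "?t *\<^sub>R (z /\<^sub>R ?t - ?e) = z - ?t *\<^sub>R ?e" using t by (simp add: scaleR_diff_right)
      then have "?t * norm (z /\<^sub>R ?t - ?e) < ?t" using t by (metis abs_of_pos norm_scaleR)
      then have "norm (z /\<^sub>R ?t - ?e) < 1" using t by simp
      then show "z \<in> cone_over ?e (cball ?e 1)" using t by (auto simp: cone_over_def dist_norm norm_minus_commute)
    qed
    then have "emeasure lborel W \<le> emeasure lborel (cone_over ?e (cball ?e 1))" by (rule emeasure_mono) simp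
    finally show ?thesis by (simp add: NB)
  qed
  \<comment> \<open>Invariance and finiteness on balls would also allow M = 0; the lower bound by
    cone volume excludes this and makes the constant positive.\<close>
  have MBpos: "emeasure M ?B > 0"
  proof -
    let ?Q = "(\<lambda>y. y + ?e) ` (V \<inter> ?B)"
    obtain c where c: "c > 0" "\<And>Q. Q \<subseteq> {y. y $ k = 1} \<Longrightarrow> emeasure lborel (cone_over ?e Q) \<le> ennreal c * ?H Q"
      using cone_over_le_hausdorff[OF n, of k] by blast
    have "cone_over ?e (cball ?e 1) \<subseteq> cone_over ?e ?Q"
    proof
      fix z assume z: "z \<in> cone_over ?e (cball ?e 1)"
      let ?y = "z /\<^sub>R (z \<bullet> ?e) - ?e"
      have "?y \<in> V \<inter> ?B" using z by (auto simp: cone_over_def V_def inner_axis dist_norm norm_minus_commute)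
      then have "?y + ?e \<in> ?Q" by (rule imageI)
      then show "z \<in> cone_over ?e ?Q" using z by (simp add: cone_over_def)
    qed
    moreover have Qb: "?Q \<in> sets borel"
    proof -
      have "?Q = (\<lambda>y. y + (- ?e)) -` (V \<inter> ?B)" by (auto simp: image_iff) (metis diff_add_cancel IntI mem_cball_0)
      then show ?thesis by (simp only:) (rule shift, simp)
    qed
    ultimately have "emeasure lborel (cone_over ?e (cball ?e 1)) \<le> emeasure lborel (cone_over ?e ?Q)"
      by (intro emeasure_mono) auto
    also have "\<dots> \<le> ennreal c * ?H ?Q" by (rule c) (auto simp: V_def)
    also have "?H ?Q = emeasure M ?B" by (simp only: iso M[OF borel_closed[OF closed_cball]])
    finally have "0 < ennreal c * emeasure M ?B" using NBpos NB by (metis order_less_le_trans)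
    then show ?thesis by (simp add: ennreal_zero_less_mult_iff)
  qed
  have "emeasure M ?B < \<infinity>"
    by (subst M) (auto intro!: hausdorff_outer_coordinate_plane_finite[where k = k, simplified] bounded_Int simp: V_def)
  then obtain p where p: "emeasure M ?B = ennreal p" "p > 0" using MBpos by (cases "emeasure M ?B") auto
  have "emeasure N ?B < \<infinity>" by (rule Nfin) auto
  then obtain q where q: "emeasure N ?B = ennreal q" "q > 0" using NBpos by (cases "emeasure N ?B") auto
  have "?H C = ennreal (p / q) * emeasure lborel (cone_over ?e C)"
    if C: "C \<in> sets borel" and Ck: "C \<subseteq> {y. y $ k = 1}" for C
  proof -
    let ?A = "(\<lambda>y. y + ?e) -` C"
    have CA: "C = (\<lambda>y. y + ?e) ` (V \<inter> ?A)"
    proof (intro set_eqI iffI)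
      fix x assume "x \<in> C"
      then have "x - ?e \<in> V \<inter> ?A" using Ck by (auto simp: V_def)
      then have "x - ?e + ?e \<in> (\<lambda>y. y + ?e) ` (V \<inter> ?A)" by (rule imageI)
      then show "x \<in> (\<lambda>y. y + ?e) ` (V \<inter> ?A)" by simp
    qed auto
    have "?H C = emeasure M ?A" by (subst CA) (simp only: iso M[OF shift[OF C]])
    also have "\<dots> = emeasure M ?A * ennreal q * ennreal (1 / q)"
      using q by (simp add: mult.assoc ennreal_mult[symmetric])
    also have "\<dots> = ennreal p * emeasure N ?A * ennreal (1 / q)"
      using cross[OF shift[OF C]] p q neg by simp
    also have "\<dots> = (ennreal p * ennreal (1 / q)) * emeasure N ?A" by (simp only: ac_simps)
    also have "ennreal p * ennreal (1 / q) = ennreal (p / q)"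
      using p q by (simp add: ennreal_mult[symmetric])
    also have "emeasure N ?A = emeasure lborel (cone_over ?e C)"
      unfolding N[OF shift[OF C]] by (simp add: vimage_def)
    finally show ?thesis .
  qed
  then show ?thesis using p q by (intro exI[of _ "p / q"]) auto
qed

text \<open>One constant serves all hyperplanes: L shrinks the axis k by 1 / |b| and rotates it
  towards b, so it maps {y. y $ k = 1} isometrically onto {y. y \<bullet> b = 1} and scales volume
  by 1 / |b|, the distance of the latter plane from the origin.\<close>

theorem hausdorff_cone_hyperplane:
  assumes n: "CARD('n) \<ge> 2"
  shows "\<exists>c>0. \<forall>b :: real ^ 'n. b \<noteq> 0 \<longrightarrow> (\<forall>C\<in>sets borel. C \<subseteq> {y. y \<bullet> b = 1} \<longrightarrow>
    hausdorff_outer (CARD('n) - 1) C = ennreal (c * norm b) * emeasure lborel (cone_over b C))"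
proof -
  obtain k :: 'n where "True" by simp
  let ?e = "axis k 1 :: real ^ 'n" and ?d = "CARD('n) - 1"
  let ?H = "hausdorff_outer ?d :: (real ^ 'n) set \<Rightarrow> _"
  obtain c where c: "c > 0" and H: "\<And>C. C \<in> sets borel \<Longrightarrow> C \<subseteq> {y. y $ k = 1} \<Longrightarrow>
      ?H C = ennreal c * emeasure lborel (cone_over ?e C)"
    using hausdorff_cone_coordinate_plane[OF n, of k] by blast
  have "?H C = ennreal (c * norm b) * emeasure lborel (cone_over b C)"
    if b: "b \<noteq> 0" and C: "C \<in> sets borel" and Cb: "C \<subseteq> {y. y \<bullet> b = 1}" for b C
  proof -
    obtain R where R: "orthogonal_transformation R" "R ?e = b /\<^sub>R norm b"
      using orthogonal_transformation_exists[of ?e "b /\<^sub>R norm b"] b by auto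
    have Rlin: "linear R" using R(1) by (rule orthogonal_transformation_linear)
    define a where "a i = (if i = k then 1 / norm b else 1)" for i
    let ?D = "\<lambda>z :: real ^ 'n. \<chi> i. a i * z $ i"
    have a: "a i > 0" for i using b by (simp add: a_def)
    have pa: "(\<Prod>i\<in>UNIV. a i) = 1 / norm b" by (simp add: a_def)
    define L where "L z = R (?D z)" for z
    have Llin: "linear L" unfolding L_def using linear_compose[OF lborel_scale_diagonal(2)[of a, OF a] Rlin] by (simp add: o_def)
    have Lscale: "lborel_scale L (1 / norm b)"
      using lborel_scale_compose[OF lborel_scale_orthogonal[OF R(1)] lborel_scale_diagonal(1)[of a, OF a] Rlin]
      by (simp add: pa L_def[abs_def])
    have Lb: "L z \<bullet> b = z \<bullet> ?e" for z
    proof -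
      have "b = norm b *\<^sub>R R ?e" using R(2) b by simp
      then have "L z \<bullet> b = norm b * (R (?D z) \<bullet> R ?e)" unfolding L_def by (metis inner_scaleR_right)
      also have "\<dots> = norm b * (?D z \<bullet> ?e)" using R(1) by (simp add: orthogonal_transformation_def)
      also have "\<dots> = z \<bullet> ?e" using b by (simp add: inner_axis a_def)
      finally show ?thesis .
    qed
    have Lm: "L -` C \<in> sets borel" using Llin C by (rule linear_vimage_borel)
    have surj: "C \<subseteq> range L"
    proof
      fix y assume "y \<in> C"
      obtain x where x: "y = R x" using orthogonal_transformation_surj[OF R(1)] by (metis surjD)
      have "?D (\<chi> i. x $ i / a i) = x" using a by (simp add: vec_eq_iff less_imp_neq[symmetric])
      then have "L (\<chi> i. x $ i / a i) = y" unfolding L_def x by (rule arg_cong)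
      then show "y \<in> range L" by (metis rangeI)
    qed
    have "?H C = ?H (L ` (L -` C))" using surj by (simp add: image_vimage_eq Int_absorb2)
    also have "\<dots> = ?H (L -` C)"
    proof (rule hausdorff_outer_isometric_image)
      fix x y assume "x \<in> L -` C" "y \<in> L -` C"
      then have "L x \<bullet> b = 1" "L y \<bullet> b = 1" using Cb by auto
      then have xy: "x $ k = 1" "y $ k = 1" by (auto simp: Lb inner_axis)
      have "dist (L x) (L y) = dist (?D x) (?D y)"
        unfolding L_def dist_norm linear_diff[OF Rlin, symmetric] by (rule orthogonal_transformation_norm[OF R(1)])
      also have "?D x - ?D y = x - y" using xy by (auto simp: vec_eq_iff a_def)
      then have "dist (?D x) (?D y) = dist x y" by (simp only: dist_norm)
      finally show "dist (L x) (L y) = dist x y" .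
    qed
    also have "\<dots> = ennreal c * emeasure lborel (cone_over ?e (L -` C))"
    proof (rule H[OF Lm])
      have "L x \<bullet> b = 1" if "L x \<in> C" for x using that Cb by auto
      then show "L -` C \<subseteq> {y. y $ k = 1}" by (auto simp: Lb inner_axis)
    qed
    also have "emeasure lborel (cone_over ?e (L -` C)) = ennreal (norm b) * emeasure lborel (cone_over b C)"
      unfolding emeasure_cone_over_linear[OF Llin Lb Lscale C] using b
      by (simp add: mult.assoc[symmetric] ennreal_mult[symmetric])
    also have "ennreal c * (ennreal (norm b) * emeasure lborel (cone_over b C)) = ennreal (c * norm b) * emeasure lborel (cone_over b C)"
      using c by (simp add: ennreal_mult mult.assoc)
    finally show ?thesis .
  qed
  then show ?thesis using c by blast
qed

subsection \<open>The surface measure of the ellipsoid\<close>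

text \<open>Half the gradient of q. If q x0 = 1, the tangent plane at x0 is {y. y \<bullet> weighted
  \<beta> x0 = 1}, the form that \<open>cone_over\<close> works with.\<close>

definition weighted :: "real ^ 'n \<Rightarrow> real ^ 'n \<Rightarrow> real ^ 'n" where
  "weighted \<beta> x = (\<chi> j. \<beta> $ j * x $ j)"

lemma quad_eq_inner: "quad \<beta> x = x \<bullet> weighted \<beta> x"
  by (simp add: quad_def weighted_def inner_vec_def power2_eq_square algebra_simps)

lemma inner_weighted_commute: "x \<bullet> weighted \<beta> y = y \<bullet> weighted \<beta> x"
  by (simp add: weighted_def inner_vec_def algebra_simps)

lemma linear_weighted: "linear (weighted \<beta>)"
  by (rule linearI) (simp_all add: weighted_def vec_eq_iff algebra_simps)

lemma quad_scaleR: "quad \<beta> (t *\<^sub>R x) = t\<^sup>2 * quad \<beta> x"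
  by (simp add: quad_eq_inner linear_cmul[OF linear_weighted] power2_eq_square)

lemma quad_zero [simp]: "quad \<beta> 0 = 0"
  by (simp add: quad_def)

lemma quad_has_derivative:
  "(quad \<beta> has_derivative (\<lambda>h. 2 * (weighted \<beta> x \<bullet> h))) (at x within S)"
proof -
  have lin: "(weighted \<beta> has_derivative weighted \<beta>) (at x within S)"
    using linear_weighted by (intro bounded_linear_imp_has_derivative) (simp add: linear_conv_bounded_linear)
  have "((\<lambda>x. x \<bullet> weighted \<beta> x) has_derivative (\<lambda>h. x \<bullet> weighted \<beta> h + h \<bullet> weighted \<beta> x)) (at x within S)"
    by (intro has_derivative_inner has_derivative_ident lin)
  then show ?thesis
    unfolding quad_eq_inner[abs_def]
    by (rule has_derivative_eq_rhs) (simp add: inner_weighted_commute[of x] inner_commute)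
qed

lemma gradient_quad: "gradient (quad \<beta>) x = 2 *\<^sub>R weighted \<beta> x"
  by (simp add: gradient_def partial_def vec_eq_iff inner_axis
      frechet_derivative_at[OF quad_has_derivative[of \<beta> x UNIV], symmetric])

lemma continuous_on_quad [continuous_intros]: "continuous_on S f \<Longrightarrow> continuous_on S (\<lambda>x. quad \<beta> (f x))"
  unfolding quad_def by (intro continuous_intros)

lemma continuous_on_weighted [continuous_intros]: "continuous_on S f \<Longrightarrow> continuous_on S (\<lambda>x. weighted \<beta> (f x))"
  unfolding weighted_def by (intro continuous_intros)

lemma measurable_quad [measurable]: "quad \<beta> \<in> borel_measurable borel"
  by (intro borel_measurable_continuous_onI continuous_intros)

lemma measurable_weighted [measurable]: "weighted \<beta> \<in> borel_measurable borel"
  by (intro borel_measurable_continuous_onI continuous_intros)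

section \<open>From local to global comparison of measures\<close>

lemma measure_le_finite_cover:
  assumes s: "sets M = sets borel" "sets P = sets borel" and F: "finite F" "\<And>N. N \<in> F \<Longrightarrow> open N"
    and le: "\<And>N A. N \<in> F \<Longrightarrow> A \<in> sets borel \<Longrightarrow> A \<subseteq> N \<inter> K \<Longrightarrow> emeasure M A \<le> c * emeasure P A"
    and A: "A \<in> sets borel" "A \<subseteq> \<Union>F \<inter> K"
  shows "emeasure M A \<le> c * emeasure P A"
  using F le A
proof (induction F arbitrary: A rule: finite_induct)
  case (insert N F)
  have [measurable]: "A \<in> sets borel" "N \<in> sets borel" using insert by auto
  have split: "emeasure Q A = emeasure Q (A \<inter> N) + emeasure Q (A - N)" if "sets Q = sets borel" for Q
  proof -
    have "A = (A \<inter> N) \<union> (A - N)" by auto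
    then show ?thesis using that by (subst plus_emeasure) auto
  qed
  have "emeasure M (A \<inter> N) \<le> c * emeasure P (A \<inter> N)"
    using insert.prems(4) by (intro insert.prems(2)[of N]) (simp, measurable, blast)
  moreover have "emeasure M (A - N) \<le> c * emeasure P (A - N)"
  proof (rule insert.IH)
    show "A - N \<in> sets borel" by measurable
    show "A - N \<subseteq> \<Union>F \<inter> K" using insert.prems(4) by blast
  qed (use insert.prems(1,2) in blast)+
  ultimately show ?case
    unfolding split[OF s(1)] split[OF s(2)] distrib_left by (rule add_mono)
qed simp

text \<open>The factor c survives the passage to finitely many neighbourhoods because A is cut into
  disjoint pieces, each inside one of them.\<close>

lemma measure_le_locally:
  fixes K :: "'a::metric_space set"
  assumes s: "sets M = sets borel" "sets P = sets borel" and K: "compact K"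
    and le: "\<And>x. x \<in> K \<Longrightarrow> \<exists>N. open N \<and> x \<in> N \<and> (\<forall>A\<in>sets borel. A \<subseteq> N \<inter> K \<longrightarrow> emeasure M A \<le> c * emeasure P A)"
    and A: "A \<in> sets borel" "A \<subseteq> K"
  shows "emeasure M A \<le> c * emeasure P A"
proof -
  let ?C = "{N. open N \<and> (\<forall>A\<in>sets borel. A \<subseteq> N \<inter> K \<longrightarrow> emeasure M A \<le> c * emeasure P A)}"
  have "K \<subseteq> \<Union>?C" using le by blast
  then obtain F where F: "F \<subseteq> ?C" "finite F" "K \<subseteq> \<Union>F"
    using compactE[OF K, of ?C] by blast
  show ?thesis
    by (rule measure_le_finite_cover[OF s F(2), where K = K]) (use F A in auto)
qed

lemma ennreal_le_mult_gt_one: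
  fixes x y :: ennreal
  assumes "\<And>\<theta>. \<theta> > 1 \<Longrightarrow> x \<le> ennreal \<theta> * y"
  shows "x \<le> y"
proof (cases y)
  case (real r)
  show ?thesis
  proof (rule ennreal_le_epsilon)
    fix e :: real assume e: "e > 0"
    \<comment> \<open>The excess over r is e r / (r + 1) \<le> e; the summand 1 keeps the
      denominator positive when r = 0.\<close>
    have "x \<le> ennreal (1 + e / (r + 1)) * ennreal r"
      using assms[of "1 + e / (r + 1)"] e real by simp
    also have "\<dots> = ennreal ((1 + e / (r + 1)) * r)" using e real by (simp add: ennreal_mult)
    also have "\<dots> \<le> ennreal (r + e)"
    proof (rule ennreal_leI)
      have "e * r \<le> e * (r + 1)" using e by simp
      then have "e / (r + 1) * r \<le> e" using real(1) by (simp add: divide_simps)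
      then show "(1 + e / (r + 1)) * r \<le> r + e" by (simp add: algebra_simps)
    qed
    finally show "x \<le> y + ennreal e" using e real by simp
  qed
qed simp

section \<open>The ellipsoid, its radial projection and the cone measure\<close>

locale ellipsoid =
  fixes \<beta> :: "real ^ 'n"
  assumes dim: "CARD('n) \<ge> 2" and pos: "\<And>j. \<beta> $ j > 0"
begin

abbreviation "q \<equiv> quad \<beta>"
abbreviation "bdry \<equiv> ellipsoid_boundary \<beta>"

lemma quad_nonneg [simp]: "0 \<le> q x"
  by (simp add: quad_def sum_nonneg pos less_imp_le)

lemma quad_eq_0_iff: "q x = 0 \<longleftrightarrow> x = 0"
  using pos by (auto simp: quad_def sum_nonneg_eq_0_iff less_imp_le vec_eq_iff less_imp_neq[symmetric])

lemma quad_pos_iff: "0 < q x \<longleftrightarrow> x \<noteq> 0"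
  using quad_eq_0_iff quad_nonneg by (metis order_le_less order_less_irrefl)

lemma quad_lower_bound: "\<exists>m>0. \<forall>x. m * (norm x)\<^sup>2 \<le> q x"
proof -
  let ?m = "Min (range (\<lambda>j. \<beta> $ j))"
  have m: "?m > 0" using pos by (subst Min_gr_iff) auto
  have "?m * (norm x)\<^sup>2 \<le> q x" for x
  proof -
    have "(norm x)\<^sup>2 = (\<Sum>j\<in>UNIV. (x $ j)\<^sup>2)"
      by (simp add: norm_vec_def L2_set_def sum_nonneg)
    then show ?thesis
      unfolding quad_def by (simp add: sum_distrib_left) (intro sum_mono mult_right_mono Min_le, auto)
  qed
  then show ?thesis using m by blast
qed

lemma bounded_quad_le: "bounded {x. q x \<le> r}"
proof -
  obtain m where m: "m > 0" "\<And>x. m * (norm x)\<^sup>2 \<le> q x" using quad_lower_bound by blast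
  have "norm x \<le> sqrt (r / m)" if "q x \<le> r" for x
  proof (rule real_le_rsqrt)
    show "(norm x)\<^sup>2 \<le> r / m" using m(2)[of x] m(1) that by (simp add: field_simps)
  qed
  then show ?thesis by (auto simp: bounded_iff)
qed

lemma compact_bdry: "compact bdry"
proof -
  have "closed {x. q x = 1}" by (intro closed_Collect_eq continuous_intros)
  moreover have "bounded {x. q x = 1}" by (rule bounded_subset[OF bounded_quad_le[of 1]]) auto
  ultimately show ?thesis by (simp add: ellipsoid_boundary_def compact_eq_bounded_closed)
qed

definition radial :: "real ^ 'n \<Rightarrow> real ^ 'n" where
  "radial x = x /\<^sub>R sqrt (q x)"

lemma measurable_radial [measurable]: "radial \<in> borel_measurable borel"
  unfolding radial_def by measurable

lemma radial_bdry: "x \<noteq> 0 \<Longrightarrow> radial x \<in> bdry"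
  using quad_pos_iff[of x]
  by (simp add: ellipsoid_boundary_def radial_def quad_scaleR power_inverse)

lemma radial_scaleR: "t > 0 \<Longrightarrow> radial (t *\<^sub>R x) = radial x"
  by (simp add: radial_def quad_scaleR real_sqrt_mult)

text \<open>The centre is left out because \<open>radial\<close> sends it to 0, which is not on the
  boundary.\<close>

definition punctured :: "(real ^ 'n) set" where
  "punctured = {x. 0 < q x \<and> q x < 1}"

lemma punctured_borel [measurable]: "punctured \<in> sets borel"
  unfolding punctured_def by measurable

definition solid_cone :: "(real ^ 'n) set \<Rightarrow> (real ^ 'n) set" where
  "solid_cone A = punctured \<inter> radial -` A"

lemma vimage_radial_borel [measurable]: "A \<in> sets borel \<Longrightarrow> radial -` A \<in> sets borel"
  using measurable_sets[OF measurable_radial, of A] by simp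

lemma solid_cone_borel [measurable]: "A \<in> sets borel \<Longrightarrow> solid_cone A \<in> sets borel"
  unfolding solid_cone_def by (intro sets.Int punctured_borel vimage_radial_borel)

text \<open>As an image measure it is countably additive for free, and integrals against it pull
  back to Lebesgue integrals over the solid ellipsoid.\<close>

definition cone_measure :: "(real ^ 'n) measure" where
  "cone_measure = distr (density lborel (indicator punctured)) borel radial"

lemma sets_cone_measure [simp, measurable_cong]: "sets cone_measure = sets borel"
  by (simp add: cone_measure_def)

lemma emeasure_cone_measure: "A \<in> sets borel \<Longrightarrow> emeasure cone_measure A = emeasure lborel (solid_cone A)"
  by (simp add: cone_measure_def emeasure_distr emeasure_restricted solid_cone_def)

definition surface_density :: "(real ^ 'n) measure" where
  "surface_density = density (hausdorff_measure (CARD('n) - 1))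
     (\<lambda>x. ennreal (indicator bdry x / norm (gradient q x)))"

lemma sets_surface_density [simp, measurable_cong]: "sets surface_density = sets borel"
  by (simp add: surface_density_def)

lemma bdry_borel [measurable]: "bdry \<in> sets borel"
  using compact_bdry by (simp add: borel_closed compact_imp_closed)

lemma weighted_bound: "\<exists>K>0. \<forall>x. norm (weighted \<beta> x) \<le> K * norm x"
  using linear_weighted linear_bounded_pos by (metis mult.commute)

text \<open>On the tangent plane at \<open>x\<^sub>0\<close> the radial projection is an isometry to first order, because there
  \<open>q y - q z = (y + z - 2 x\<^sub>0) \<bullet> weighted (y - z)\<close> is small compared with \<open>y - z\<close>.\<close>

lemma radial_almost_isometric:
  assumes x0: "q x0 = 1" and \<epsilon>: "0 < \<epsilon>" "\<epsilon> < 1"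
  shows "\<exists>\<delta>>0. \<forall>y z. dist x0 y < \<delta> \<longrightarrow> dist x0 z < \<delta> \<longrightarrow> (y - z) \<bullet> weighted \<beta> x0 = 0 \<longrightarrow>
    norm (radial y - radial z - (y - z)) \<le> \<epsilon> * norm (y - z)"
proof -
  obtain K where K: "K > 0" "\<And>x. norm (weighted \<beta> x) \<le> K * norm x" using weighted_bound by blast
  have "isCont (\<lambda>y. 1 / sqrt (q y)) x0"
    using x0 continuous_on_quad[OF continuous_on_id, of UNIV \<beta>]
    by (intro continuous_intros) (auto simp: continuous_on_eq_continuous_at)
  then have "\<forall>\<^sub>F y in nhds x0. dist (1 / sqrt (q y)) 1 < \<epsilon> / 2"
    using \<epsilon> x0 by (intro tendstoD) (auto simp: isCont_def tendsto_nhds_iff)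
  then obtain \<delta>1 where \<delta>1: "\<delta>1 > 0" "\<And>y. dist y x0 < \<delta>1 \<Longrightarrow> \<bar>1 / sqrt (q y) - 1\<bar> < \<epsilon> / 2"
    by (auto simp: eventually_nhds_metric dist_real_def)
  define R where "R = norm x0 + 1"
  \<comment> \<open>The change of scale between y and z turns out to cost at most 16 K R \<delta> |y
    - z|; the denominator 32 K R makes this half of the permitted error.\<close>
  define \<delta> where "\<delta> = min (min \<delta>1 1) (\<epsilon> / (32 * K * R))"
  have R: "R > 0" by (simp add: R_def add_nonneg_pos)
  have \<delta>: "\<delta> > 0" "\<delta> \<le> \<delta>1" "\<delta> \<le> 1" "\<delta> \<le> \<epsilon> / (32 * K * R)"
    using \<delta>1 \<epsilon> K R by (auto simp: \<delta>_def)
  show ?thesis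
  proof (intro exI[of _ \<delta>] conjI allI impI)
    fix y z assume y: "dist x0 y < \<delta>" and z: "dist x0 z < \<delta>" and yz: "(y - z) \<bullet> weighted \<beta> x0 = 0"
    define s where "s x = 1 / sqrt (q x)" for x
    have sy: "\<bar>s y - 1\<bar> < \<epsilon> / 2" "\<bar>s z - 1\<bar> < \<epsilon> / 2"
      using \<delta>1(2) y z \<delta>(2) unfolding s_def by (auto simp: dist_commute)
    have sy2: "0 < s y" "0 < s z" "s y \<le> 2" "s z \<le> 2" using sy \<epsilon> by linarith+
    have q: "0 < q y" "0 < q z" using sy2 quad_nonneg[of y] quad_nonneg[of z] unfolding s_def
      by (metis div_by_0 less_irrefl order_le_less real_sqrt_zero)+
    \<comment> \<open>Two errors: y - z is scaled by a factor near 1, and y and z are scaled by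
      different factors.\<close>
    have eq: "radial y - radial z - (y - z) = (s y - 1) *\<^sub>R (y - z) + (s y - s z) *\<^sub>R z"
      by (simp add: radial_def s_def algebra_simps inverse_eq_divide)
    have sdiff: "s y - s z = (q z - q y) * (s y * s z * (1 / (sqrt (q y) + sqrt (q z))))"
    proof -
      have gen: "1 / u - 1 / v = ((v - u) * (u + v)) * (1 / u * (1 / v) * (1 / (u + v)))"
        if "u > 0" "v > 0" for u v :: real
      proof -
        have "((v - u) * (u + v)) * (1 / u * (1 / v) * (1 / (u + v)))
          = ((v - u) * (1 / u * (1 / v))) * ((u + v) * (1 / (u + v)))" by (simp only: ac_simps)
        also have "(u + v) * (1 / (u + v)) = 1" using that by simp
        finally show ?thesis using that by (simp add: field_simps)
      qed
      have "q z - q y = (sqrt (q z) - sqrt (q y)) * (sqrt (q y) + sqrt (q z))"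
        using q by (simp add: algebra_simps real_sqrt_mult_self)
      then show ?thesis unfolding s_def using gen[of "sqrt (q y)" "sqrt (q z)"] q by simp
    qed
    have "1 / (sqrt (q y) + sqrt (q z)) \<le> 1 / sqrt (q y)" using q by (intro frac_le) auto
    then have s3: "1 / (sqrt (q y) + sqrt (q z)) \<le> 2" using sy2 by (simp add: s_def)
    have "\<bar>s y * s z * (1 / (sqrt (q y) + sqrt (q z)))\<bar> \<le> 2 * 2 * 2"
      unfolding abs_mult using sy2 s3 q by (intro mult_mono) auto
    then have "\<bar>s y - s z\<bar> \<le> \<bar>q z - q y\<bar> * 8"
      unfolding sdiff abs_mult[of "q z - q y"] by (intro mult_left_mono) auto
    moreover have "\<bar>q z - q y\<bar> \<le> (2 * \<delta>) * (K * norm (y - z))"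
    proof -
      have "q z - q y = (z + y) \<bullet> weighted \<beta> (z - y)"
        by (simp add: quad_eq_inner linear_diff[OF linear_weighted] inner_diff_right inner_add_left inner_weighted_commute[of z \<beta> y])
      also have "x0 \<bullet> weighted \<beta> (z - y) = 0"
        using yz by (simp add: inner_weighted_commute[of x0] inner_diff_left)
      then have "(z + y) \<bullet> weighted \<beta> (z - y) = ((z - x0) + (y - x0)) \<bullet> weighted \<beta> (z - y)"
        unfolding inner_add_left inner_diff_left by simp
      finally have "\<bar>q z - q y\<bar> \<le> norm ((z - x0) + (y - x0)) * norm (weighted \<beta> (z - y))"
        by (simp add: Cauchy_Schwarz_ineq2)
      also have "\<dots> \<le> (2 * \<delta>) * (K * norm (z - y))"
      proof (intro mult_mono K)
        have "norm ((z - x0) + (y - x0)) \<le> norm (z - x0) + norm (y - x0)" by (rule norm_triangle_ineq)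
        then show "norm ((z - x0) + (y - x0)) \<le> 2 * \<delta>" using y z by (simp add: dist_norm norm_minus_commute)
      qed (use \<delta> in auto)
      finally show ?thesis by (simp add: norm_minus_commute)
    qed
    moreover have "norm z \<le> R" using z \<delta> norm_triangle_ineq2[of z x0] by (auto simp: R_def dist_norm norm_minus_commute)
    ultimately have "\<bar>s y - s z\<bar> * norm z \<le> ((2 * \<delta>) * (K * norm (y - z)) * 8) * R"
      using \<delta> K R by (intro mult_mono) auto
    also have "\<dots> = \<delta> * (16 * K * R) * norm (y - z)" by (simp add: algebra_simps)
    also have "\<dots> \<le> (\<epsilon> / (32 * K * R)) * (16 * K * R) * norm (y - z)"
      using \<delta> K R by (intro mult_right_mono) auto
    also have "\<dots> = \<epsilon> / 2 * norm (y - z)" using K R by simp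
    finally have 2: "\<bar>s y - s z\<bar> * norm z \<le> \<epsilon> / 2 * norm (y - z)" .
    have "norm (radial y - radial z - (y - z)) \<le> norm ((s y - 1) *\<^sub>R (y - z)) + norm ((s y - s z) *\<^sub>R z)"
      unfolding eq by (rule norm_triangle_ineq)
    also have "\<dots> \<le> \<epsilon> / 2 * norm (y - z) + \<epsilon> / 2 * norm (y - z)"
      unfolding norm_scaleR using sy(1) 2 by (intro add_mono mult_right_mono) auto
    finally show "norm (radial y - radial z - (y - z)) \<le> \<epsilon> * norm (y - z)" by simp
  qed (use \<delta> in auto)
qed

end

section \<open>Comparison of the weighted surface measure with the cone measure\<close>

lemma lborel_scale_scaleR:
  fixes t :: real
  assumes "t > 0"
  shows "lborel_scale (\<lambda>z :: real ^ 'n. t *\<^sub>R z) (t ^ CARD('n))"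
proof -
  have "(\<lambda>z :: real ^ 'n. t *\<^sub>R z) = (\<lambda>z. \<chi> i. t * z $ i)" by (auto simp: vec_eq_iff)
  then show ?thesis using lborel_scale_diagonal(1)[of "\<lambda>_ :: 'n. t"] assms by simp
qed

context ellipsoid
begin

text \<open>Central projection carries A to a piece B of the tangent plane at x0, where the formula
  for hyperplanes is exact. \<open>radial\<close> maps B back to A and distorts distances by factors
  between 1 - \<epsilon> and 1 + \<epsilon>, which controls Hausdorff measure. The cones over A and
  B consist of the same rays, cut at lengths whose ratio has these bounds, which controls
  volume.\<close>

lemma surface_cone_chart:
  assumes H: "\<And>b C. b \<noteq> 0 \<Longrightarrow> C \<in> sets borel \<Longrightarrow> C \<subseteq> {y :: real ^ 'n. y \<bullet> b = 1} \<Longrightarrow>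
      hausdorff_outer (CARD('n) - 1) C = ennreal (c * norm b) * emeasure lborel (cone_over b C)"
    and c: "c > 0" and x0: "x0 \<in> bdry" and \<epsilon>: "0 < \<epsilon>" "\<epsilon> < 1"
  shows "\<exists>N. open N \<and> x0 \<in> N \<and> (\<forall>a\<in>N. \<bar>norm (weighted \<beta> a) - norm (weighted \<beta> x0)\<bar> \<le> \<epsilon> * norm (weighted \<beta> x0)) \<and>
    (\<forall>A\<in>sets borel. A \<subseteq> N \<inter> bdry \<longrightarrow>
      hausdorff_outer (CARD('n) - 1) A \<le> ennreal (((1 + \<epsilon>) / (1 - \<epsilon>)) ^ CARD('n) * (c * norm (weighted \<beta> x0))) * emeasure lborel (solid_cone A) \<and>
      ennreal (c * norm (weighted \<beta> x0)) * emeasure lborel (solid_cone A) \<le> ennreal (((1 + \<epsilon>) / (1 - \<epsilon>)) ^ CARD('n)) * hausdorff_outer (CARD('n) - 1) A)"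
proof -
  let ?d = "CARD('n) - 1" and ?n = "CARD('n)"
  let ?H = "hausdorff_outer ?d :: (real ^ 'n) set \<Rightarrow> _"
  define b where "b = weighted \<beta> x0"
  have qx0: "q x0 = 1" using x0 by (simp add: ellipsoid_boundary_def)
  have xb: "x0 \<bullet> b = 1" using qx0 by (simp add: quad_eq_inner b_def)
  then have b: "b \<noteq> 0" by auto
  obtain \<delta>1 where \<delta>1: "\<delta>1 > 0" "\<And>y z. dist x0 y < \<delta>1 \<Longrightarrow> dist x0 z < \<delta>1 \<Longrightarrow> (y - z) \<bullet> b = 0 \<Longrightarrow>
      norm (radial y - radial z - (y - z)) \<le> \<epsilon> * norm (y - z)"
    using radial_almost_isometric[OF qx0 \<epsilon>] unfolding b_def by blast
  have "isCont (\<lambda>y. 1 / sqrt (q y)) x0"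
    using qx0 continuous_on_quad[OF continuous_on_id, of UNIV \<beta>]
    by (intro continuous_intros) (auto simp: continuous_on_eq_continuous_at)
  then have "\<forall>\<^sub>F y in nhds x0. dist (1 / sqrt (q y)) 1 < \<epsilon>"
    using \<epsilon> qx0 by (intro tendstoD) (auto simp: isCont_def tendsto_nhds_iff)
  then obtain \<delta>2 where \<delta>2: "\<delta>2 > 0" "\<And>y. dist y x0 < \<delta>2 \<Longrightarrow> \<bar>1 / sqrt (q y) - 1\<bar> < \<epsilon>"
    by (auto simp: eventually_nhds_metric dist_real_def)
  define \<delta> where "\<delta> = min \<delta>1 \<delta>2"
  have \<delta>: "\<delta> > 0" "\<And>y z. dist x0 y < \<delta> \<Longrightarrow> dist x0 z < \<delta> \<Longrightarrow> (y - z) \<bullet> b = 0 \<Longrightarrow>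
      norm (radial y - radial z - (y - z)) \<le> \<epsilon> * norm (y - z)"
    "\<And>y. dist x0 y < \<delta> \<Longrightarrow> \<bar>1 / sqrt (q y) - 1\<bar> < \<epsilon>"
    using \<delta>1 \<delta>2 by (auto simp: \<delta>_def dist_commute)
  \<comment> \<open>Central projection to the tangent plane, the local inverse of
    \<open>radial\<close>.\<close>
  define P where "P a = a /\<^sub>R (a \<bullet> b)" for a
  have "isCont (\<lambda>a. a \<bullet> b) x0" by (intro continuous_intros)
  then have e1: "\<forall>\<^sub>F a in nhds x0. a \<bullet> b > 0"
    using xb by (intro order_tendstoD) (auto simp: isCont_def tendsto_nhds_iff)
  have "isCont P x0" unfolding P_def using xb by (intro continuous_intros) auto
  then have e2: "\<forall>\<^sub>F a in nhds x0. dist (P a) x0 < \<delta>"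
    using xb \<delta>(1) by (intro tendstoD) (auto simp: isCont_def tendsto_nhds_iff P_def[abs_def])
  have "isCont (\<lambda>a. norm (weighted \<beta> a)) x0"
    using continuous_on_weighted[OF continuous_on_id, of UNIV \<beta>]
    by (intro continuous_intros) (auto simp: continuous_on_eq_continuous_at)
  then have e3: "\<forall>\<^sub>F a in nhds x0. dist (norm (weighted \<beta> a)) (norm b) < \<epsilon> * norm b"
    using \<epsilon> b by (intro tendstoD) (auto simp: isCont_def tendsto_nhds_iff b_def)
  have "\<forall>\<^sub>F a in nhds x0. a \<bullet> b > 0 \<and> dist (P a) x0 < \<delta> \<and> dist (norm (weighted \<beta> a)) (norm b) < \<epsilon> * norm b"
    using e1 e2 e3 by eventually_elim auto
  then obtain N where N: "open N" "x0 \<in> N" "\<And>a. a \<in> N \<Longrightarrow> a \<bullet> b > 0" "\<And>a. a \<in> N \<Longrightarrow> dist (P a) x0 < \<delta>"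
      "\<And>a. a \<in> N \<Longrightarrow> dist (norm (weighted \<beta> a)) (norm b) < \<epsilon> * norm b"
    unfolding eventually_nhds by blast
  have main: "?H A \<le> ennreal (((1 + \<epsilon>) / (1 - \<epsilon>)) ^ ?n * (c * norm b)) * emeasure lborel (solid_cone A) \<and>
      ennreal (c * norm b) * emeasure lborel (solid_cone A) \<le> ennreal (((1 + \<epsilon>) / (1 - \<epsilon>)) ^ ?n) * ?H A"
    if A: "A \<in> sets borel" "A \<subseteq> N \<inter> bdry" for A
  proof -
    define B where "B = {y. y \<bullet> b = 1} \<inter> ball x0 \<delta> \<inter> radial -` A"
    have Bb [measurable]: "B \<in> sets borel"
      unfolding B_def using vimage_radial_borel[OF A(1)] by (intro sets.Int) auto
    have PA: "P a \<in> B" "radial (P a) = a" "sqrt (q (P a)) = 1 / (a \<bullet> b)" if "a \<in> A" for a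
    proof -
      have a: "a \<bullet> b > 0" "q a = 1" "dist (P a) x0 < \<delta>" using that A N by (auto simp: ellipsoid_boundary_def)
      have "radial (P a) = radial a" unfolding P_def by (rule radial_scaleR) (use a in simp)
      also have "\<dots> = a" using a by (simp add: radial_def)
      finally show "radial (P a) = a" .
      then show "P a \<in> B" using a that by (auto simp: B_def P_def dist_commute)
      show "sqrt (q (P a)) = 1 / (a \<bullet> b)"
        using a by (simp add: P_def quad_scaleR real_sqrt_mult divide_inverse)
    qed
    have img: "A = radial ` B"
    proof
      show "A \<subseteq> radial ` B" using PA by (metis image_iff subsetI)
      show "radial ` B \<subseteq> A" by (auto simp: B_def)
    qed
    have near: "norm (radial y - radial z - (y - z)) \<le> \<epsilon> * norm (y - z)" if "y \<in> B" "z \<in> B" for y z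
      using that by (intro \<delta>(2)) (auto simp: B_def inner_diff_left)
    have up: "dist (radial y) (radial z) \<le> (1 + \<epsilon>) * dist y z" if "y \<in> B" "z \<in> B" for y z
      using near[OF that] norm_triangle_ineq2[of "radial y - radial z" "y - z"] by (simp add: dist_norm algebra_simps)
    have lo: "(1 - \<epsilon>) * dist y z \<le> dist (radial y) (radial z)" if "y \<in> B" "z \<in> B" for y z
      using near[OF that] norm_triangle_ineq3[of "radial y - radial z" "y - z"] by (simp add: dist_norm algebra_simps abs_le_iff)
    have HA: "?H A \<le> ennreal ((1 + \<epsilon>) ^ ?d) * ?H B"
      unfolding img using up \<epsilon> by (intro hausdorff_outer_lipschitz_image) auto
    have inj: "inj_on radial B"
      using lo \<epsilon> by (intro inj_onI) (metis dist_eq_0_iff dist_self diff_gt_0_iff_gt mult_le_0_iff not_less zero_le_dist order_antisym)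
    have HB: "?H B \<le> ennreal ((1 / (1 - \<epsilon>)) ^ ?d) * ?H A"
    proof -
      have "?H (inv_into B radial ` A) \<le> ennreal ((1 / (1 - \<epsilon>)) ^ ?d) * ?H A"
      proof (rule hausdorff_outer_lipschitz_image)
        fix x y assume "x \<in> A" "y \<in> A"
        then obtain u v where uv: "u \<in> B" "v \<in> B" "x = radial u" "y = radial v" unfolding img by blast
        then show "dist (inv_into B radial x) (inv_into B radial y) \<le> 1 / (1 - \<epsilon>) * dist x y"
          using lo[OF uv(1,2)] \<epsilon> inj by (simp add: pos_le_divide_eq mult.commute)
      qed (use \<epsilon> in simp)
      moreover have "inv_into B radial ` A = B" unfolding img using inj by (simp add: image_image)
      ultimately show ?thesis by simp
    qed
    have HBcone: "?H B = ennreal (c * norm b) * emeasure lborel (cone_over b B)"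
      by (rule H[OF b Bb]) (auto simp: B_def)
    have sqB: "1 - \<epsilon> < 1 / sqrt (q y)" "1 / sqrt (q y) < 1 + \<epsilon>" if "y \<in> B" for y
      using \<delta>(3)[of y] that by (auto simp: B_def abs_less_iff)
    have scale: "emeasure lborel ((\<lambda>z. t *\<^sub>R z) -` S) = ennreal ((1 / t) ^ ?n) * emeasure lborel S"
      if "t > 0" "S \<in> sets borel" for t and S :: "(real ^ 'n) set"
    proof -
      have "ennreal ((1 / t) ^ ?n) * emeasure lborel S
        = ennreal ((1 / t) ^ ?n) * (ennreal (t ^ ?n) * emeasure lborel ((\<lambda>z. t *\<^sub>R z) -` S))"
        using lborel_scaleD[OF lborel_scale_scaleR[OF that(1)] that(2)] by simp
      also have "\<dots> = emeasure lborel ((\<lambda>z. t *\<^sub>R z) -` S)"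
        using that by (simp add: mult.assoc[symmetric] ennreal_mult[symmetric] power_divide)
      finally show ?thesis ..
    qed
    have vb: "(\<lambda>z. t *\<^sub>R z) -` S \<in> sets borel" if "S \<in> sets borel" for t and S :: "(real ^ 'n) set"
      by (rule linear_vimage_borel[OF _ that]) simp
    have cone1: "emeasure lborel (solid_cone A) \<le> ennreal ((1 + \<epsilon>) ^ ?n) * emeasure lborel (cone_over b B)"
    proof -
      have "solid_cone A \<subseteq> (\<lambda>z. (1 / (1 + \<epsilon>)) *\<^sub>R z) -` cone_over b B"
      proof
        fix z assume z: "z \<in> solid_cone A"
        define a where "a = radial z"
        have a: "a \<in> A" "0 < q z" "q z < 1" using z by (auto simp: solid_cone_def punctured_def a_def)
        have za: "z = sqrt (q z) *\<^sub>R a" using a by (simp add: a_def radial_def)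
        have ab: "a \<bullet> b > 0" using a A N by auto
        have s: "a \<bullet> b < 1 + \<epsilon>" using sqB(2)[OF PA(1)[OF a(1)]] PA(3)[OF a(1)] by simp
        define w where "w = (1 / (1 + \<epsilon>)) *\<^sub>R z"
        have zb: "z \<bullet> b = sqrt (q z) * (a \<bullet> b)" by (subst za) simp
        have w: "w \<bullet> b = sqrt (q z) * (a \<bullet> b) / (1 + \<epsilon>)" using zb by (simp add: w_def)
        have "sqrt (q z) * (a \<bullet> b) < 1 * (1 + \<epsilon>)" using a ab s by (intro mult_strict_mono) auto
        then have wb: "0 < w \<bullet> b" "w \<bullet> b < 1" using a ab \<epsilon> by (auto simp: w)
        have "w /\<^sub>R (w \<bullet> b) = z /\<^sub>R (z \<bullet> b)" using \<epsilon> by (simp add: w_def inverse_eq_divide)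
        also have "\<dots> = P a" using a unfolding P_def zb by (subst (1) za) simp
        finally show "z \<in> (\<lambda>z. (1 / (1 + \<epsilon>)) *\<^sub>R z) -` cone_over b B"
          using wb PA(1)[OF a(1)] unfolding cone_over_def by (simp add: w_def)
      qed
      then have "emeasure lborel (solid_cone A) \<le> emeasure lborel ((\<lambda>z. (1 / (1 + \<epsilon>)) *\<^sub>R z) -` cone_over b B)"
        by (rule emeasure_mono) (use vb[OF cone_over_borel[OF Bb]] in simp)
      also have "\<dots> = ennreal ((1 + \<epsilon>) ^ ?n) * emeasure lborel (cone_over b B)"
        using \<epsilon> by (subst scale) auto
      finally show ?thesis .
    qed
    have cone2: "emeasure lborel (cone_over b B) \<le> ennreal ((1 / (1 - \<epsilon>)) ^ ?n) * emeasure lborel (solid_cone A)"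
    proof -
      have "cone_over b B \<subseteq> (\<lambda>z. (1 - \<epsilon>) *\<^sub>R z) -` solid_cone A"
      proof
        fix z assume "z \<in> cone_over b B"
        then have z: "0 < z \<bullet> b" "z \<bullet> b < 1" "z /\<^sub>R (z \<bullet> b) \<in> B" by (auto simp: cone_over_def)
        define y where "y = z /\<^sub>R (z \<bullet> b)"
        have zy: "z = (z \<bullet> b) *\<^sub>R y" using z by (simp add: y_def)
        have y: "y \<in> B" "radial y \<in> A" using z by (auto simp: y_def B_def)
        have qy: "q y > 0" using sqB(1)[OF y(1)] \<epsilon> quad_nonneg[of y]
          by (metis diff_gt_0_iff_gt div_by_0 less_trans order_le_less order_less_irrefl real_sqrt_zero)
        define w where "w = (1 - \<epsilon>) *\<^sub>R z"
        have wy: "w = ((1 - \<epsilon>) * (z \<bullet> b)) *\<^sub>R y" unfolding w_def by (subst zy) simp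
        have pos: "(1 - \<epsilon>) * (z \<bullet> b) > 0" using \<epsilon> z by simp
        have "radial w = radial y" unfolding wy using pos by (rule radial_scaleR)
        moreover have "q w > 0"
          unfolding wy quad_scaleR using z(1) \<epsilon>(2) qy by (intro mult_pos_pos zero_less_power) simp_all
        moreover have "sqrt (q w) < 1"
        proof -
          have "sqrt (q w) = ((1 - \<epsilon>) * sqrt (q y)) * (z \<bullet> b)" using pos \<epsilon> z by (simp add: wy quad_scaleR real_sqrt_mult)
          also have "(1 - \<epsilon>) * sqrt (q y) < 1" using sqB(1)[OF y(1)] qy by (simp add: pos_less_divide_eq)
          then have "((1 - \<epsilon>) * sqrt (q y)) * (z \<bullet> b) < 1 * 1" using z qy \<epsilon> by (intro mult_strict_mono) auto
          finally show ?thesis by simp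
        qed
        ultimately show "z \<in> (\<lambda>z. (1 - \<epsilon>) *\<^sub>R z) -` solid_cone A"
          using y by (simp add: solid_cone_def punctured_def flip: w_def)
      qed
      then have "emeasure lborel (cone_over b B) \<le> emeasure lborel ((\<lambda>z. (1 - \<epsilon>) *\<^sub>R z) -` solid_cone A)"
        by (rule emeasure_mono) (use vb[OF solid_cone_borel[OF A(1)]] in simp)
      also have "\<dots> = ennreal ((1 / (1 - \<epsilon>)) ^ ?n) * emeasure lborel (solid_cone A)"
        using \<epsilon> A by (subst scale) auto
      finally show ?thesis .
    qed
    have n: "?n = Suc ?d" by simp
    \<comment> \<open>Hausdorff measure brings the exponent n - 1 and volume the exponent n; both
      are raised to n so that one bound serves either direction.\<close>
    have pw: "(1 + \<epsilon>) ^ ?d * (1 / (1 - \<epsilon>)) ^ ?n \<le> ((1 + \<epsilon>) / (1 - \<epsilon>)) ^ ?n"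
    proof -
      have "(1 + \<epsilon>) ^ ?d \<le> (1 + \<epsilon>) ^ ?n" using \<epsilon> by (intro power_increasing) auto
      then have "(1 + \<epsilon>) ^ ?d * (1 / (1 - \<epsilon>)) ^ ?n \<le> (1 + \<epsilon>) ^ ?n * (1 / (1 - \<epsilon>)) ^ ?n"
        using \<epsilon> by (intro mult_right_mono) auto
      then show ?thesis by (simp add: power_divide)
    qed
    have pw2: "(1 + \<epsilon>) ^ ?n * (1 / (1 - \<epsilon>)) ^ ?d \<le> ((1 + \<epsilon>) / (1 - \<epsilon>)) ^ ?n"
    proof -
      have "(1 / (1 - \<epsilon>)) ^ ?d \<le> (1 / (1 - \<epsilon>)) ^ ?n" using \<epsilon> by (intro power_increasing) auto
      then have "(1 + \<epsilon>) ^ ?n * (1 / (1 - \<epsilon>)) ^ ?d \<le> (1 + \<epsilon>) ^ ?n * (1 / (1 - \<epsilon>)) ^ ?n"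
        using \<epsilon> by (intro mult_left_mono) auto
      then show ?thesis by (simp add: power_divide)
    qed
    have 1: "?H A \<le> ennreal (((1 + \<epsilon>) / (1 - \<epsilon>)) ^ ?n * (c * norm b)) * emeasure lborel (solid_cone A)"
    proof -
      have "?H A \<le> ennreal ((1 + \<epsilon>) ^ ?d) * (ennreal (c * norm b) * (ennreal ((1 / (1 - \<epsilon>)) ^ ?n) * emeasure lborel (solid_cone A)))"
        using HA unfolding HBcone by (rule order_trans) (intro mult_left_mono cone2, auto)
      also have "\<dots> = ennreal ((1 + \<epsilon>) ^ ?d * (1 / (1 - \<epsilon>)) ^ ?n * (c * norm b)) * emeasure lborel (solid_cone A)"
        using \<epsilon> c by (simp add: ennreal_mult ac_simps)
      also have "\<dots> \<le> ennreal (((1 + \<epsilon>) / (1 - \<epsilon>)) ^ ?n * (c * norm b)) * emeasure lborel (solid_cone A)"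
        using pw c by (intro mult_right_mono ennreal_leI) auto
      finally show ?thesis .
    qed
    have 2: "ennreal (c * norm b) * emeasure lborel (solid_cone A) \<le> ennreal (((1 + \<epsilon>) / (1 - \<epsilon>)) ^ ?n) * ?H A"
    proof -
      have "ennreal (c * norm b) * emeasure lborel (solid_cone A)
        \<le> ennreal (c * norm b) * (ennreal ((1 + \<epsilon>) ^ ?n) * emeasure lborel (cone_over b B))"
        by (intro mult_left_mono cone1) auto
      also have "\<dots> = ennreal ((1 + \<epsilon>) ^ ?n) * ?H B" unfolding HBcone by (simp only: ac_simps)
      also have "\<dots> \<le> ennreal ((1 + \<epsilon>) ^ ?n) * (ennreal ((1 / (1 - \<epsilon>)) ^ ?d) * ?H A)"
        by (intro mult_left_mono HB) auto
      also have "\<dots> = ennreal ((1 + \<epsilon>) ^ ?n * (1 / (1 - \<epsilon>)) ^ ?d) * ?H A"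
        using \<epsilon> by (simp add: ennreal_mult ac_simps)
      also have "\<dots> \<le> ennreal (((1 + \<epsilon>) / (1 - \<epsilon>)) ^ ?n) * ?H A"
        using pw2 by (intro mult_right_mono ennreal_leI) auto
      finally show ?thesis .
    qed
    show ?thesis using 1 2 by blast
  qed
  show ?thesis
    using N(1,2) N(5) main unfolding b_def[symmetric]
    by (intro exI[of _ N]) (auto simp: dist_real_def less_imp_le)
qed

lemma norm_gradient_quad: "norm (gradient q x) = 2 * norm (weighted \<beta> x)"
  by (simp add: gradient_quad)

lemma emeasure_surface_density:
  assumes "A \<in> sets borel"
  shows "emeasure surface_density A
    = (\<integral>\<^sup>+x. ennreal (indicator bdry x / norm (gradient q x)) * indicator A x \<partial>hausdorff_measure (CARD('n) - 1))"
  unfolding surface_density_def norm_gradient_quad using assms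
  by (subst emeasure_density) auto

lemma surface_density_bounds:
  assumes A: "A \<in> sets borel" "A \<subseteq> bdry" and lu: "0 < l" "\<And>a. a \<in> A \<Longrightarrow> l \<le> norm (weighted \<beta> a)"
    "\<And>a. a \<in> A \<Longrightarrow> norm (weighted \<beta> a) \<le> u"
  shows "emeasure surface_density A \<le> ennreal (1 / (2 * l)) * hausdorff_outer (CARD('n) - 1) A"
    and "hausdorff_outer (CARD('n) - 1) A \<le> ennreal (2 * u) * emeasure surface_density A"
proof -
  let ?H = "hausdorff_measure (CARD('n) - 1) :: (real ^ 'n) measure"
  let ?g = "\<lambda>x. ennreal (indicator bdry x / norm (gradient q x)) * indicator A x"
  have HA: "hausdorff_outer (CARD('n) - 1) A = emeasure ?H A"
    using A by (simp add: emeasure_hausdorff_measure)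
  have "(\<integral>\<^sup>+x. ?g x \<partial>?H) \<le> (\<integral>\<^sup>+x. ennreal (1 / (2 * l)) * indicator A x \<partial>?H)"
  proof (rule nn_integral_mono)
    fix x
    show "?g x \<le> ennreal (1 / (2 * l)) * indicator A x"
      using lu(1) lu(2)[of x] A(2)
      by (auto simp: indicator_def norm_gradient_quad intro!: ennreal_leI frac_le)
  qed
  then show "emeasure surface_density A \<le> ennreal (1 / (2 * l)) * hausdorff_outer (CARD('n) - 1) A"
    unfolding HA emeasure_surface_density[OF A(1)] using A by (simp add: nn_integral_cmult)
  have "(\<integral>\<^sup>+x. indicator A x \<partial>?H) \<le> (\<integral>\<^sup>+x. ennreal (2 * u) * ?g x \<partial>?H)"
  proof (rule nn_integral_mono)
    fix x
    show "indicator A x \<le> ennreal (2 * u) * ?g x"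
    proof (cases "x \<in> A")
      case True
      then have w: "l \<le> norm (weighted \<beta> x)" "norm (weighted \<beta> x) \<le> u" using lu by auto
      have "1 \<le> 2 * u * (1 / (2 * norm (weighted \<beta> x)))" using w lu(1) by (auto simp: le_divide_eq)
      then have "1 \<le> ennreal (2 * u * (1 / (2 * norm (weighted \<beta> x))))"
        by (metis ennreal_1 ennreal_leI)
      also have "\<dots> = ennreal (2 * u) * ennreal (1 / (2 * norm (weighted \<beta> x)))"
        using w lu(1) by (intro ennreal_mult) auto
      finally show ?thesis using True A by (auto simp: indicator_def norm_gradient_quad)
    qed simp
  qed
  also have "\<dots> = ennreal (2 * u) * emeasure surface_density A"
    unfolding emeasure_surface_density[OF A(1)] norm_gradient_quad
    by (rule nn_integral_cmult) (use A in measurable)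
  finally show "hausdorff_outer (CARD('n) - 1) A \<le> ennreal (2 * u) * emeasure surface_density A"
    unfolding HA using A by simp
qed

text \<open>The factor |b| of the tangent plane formula cancels against the density 1 / (2 |b|), up
  to the oscillation of |weighted \<beta> x| near x0. That costs one more factor (1 + \<epsilon>) /
  (1 - \<epsilon>), hence the exponent n + 1.\<close>

lemma surface_density_locally:
  assumes H: "\<And>b C. b \<noteq> 0 \<Longrightarrow> C \<in> sets borel \<Longrightarrow> C \<subseteq> {y :: real ^ 'n. y \<bullet> b = 1} \<Longrightarrow>
      hausdorff_outer (CARD('n) - 1) C = ennreal (c * norm b) * emeasure lborel (cone_over b C)"
    and c: "c > 0" and x0: "x0 \<in> bdry" and \<epsilon>: "0 < \<epsilon>" "\<epsilon> < 1"
  defines "\<theta> \<equiv> ((1 + \<epsilon>) / (1 - \<epsilon>)) ^ Suc CARD('n)"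
  shows "\<exists>N. open N \<and> x0 \<in> N \<and> (\<forall>A\<in>sets borel. A \<subseteq> N \<inter> bdry \<longrightarrow>
      emeasure surface_density A \<le> ennreal (\<theta> * (c / 2)) * emeasure cone_measure A \<and>
      emeasure cone_measure A \<le> ennreal (\<theta> * (2 / c)) * emeasure surface_density A)"
proof -
  let ?b = "norm (weighted \<beta> x0)" and ?r = "((1 + \<epsilon>) / (1 - \<epsilon>))"
  let ?H = "hausdorff_outer (CARD('n) - 1) :: (real ^ 'n) set \<Rightarrow> _"
  obtain N where N: "open N" "x0 \<in> N"
    "\<And>a. a \<in> N \<Longrightarrow> \<bar>norm (weighted \<beta> a) - ?b\<bar> \<le> \<epsilon> * ?b"
    "\<And>A. A \<in> sets borel \<Longrightarrow> A \<subseteq> N \<inter> bdry \<Longrightarrow>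
      ?H A \<le> ennreal (?r ^ CARD('n) * (c * ?b)) * emeasure lborel (solid_cone A)"
    "\<And>A. A \<in> sets borel \<Longrightarrow> A \<subseteq> N \<inter> bdry \<Longrightarrow>
      ennreal (c * ?b) * emeasure lborel (solid_cone A) \<le> ennreal (?r ^ CARD('n)) * ?H A"
    using surface_cone_chart[OF H c x0 \<epsilon>] by blast
  have "weighted \<beta> x0 \<noteq> 0"
    using x0 by (auto simp: ellipsoid_boundary_def quad_eq_inner)
  then have b: "?b > 0" by simp
  have r: "?r > 0" using \<epsilon> by simp
  have "emeasure surface_density A \<le> ennreal (\<theta> * (c / 2)) * emeasure cone_measure A \<and>
      emeasure cone_measure A \<le> ennreal (\<theta> * (2 / c)) * emeasure surface_density A"
    if A: "A \<in> sets borel" "A \<subseteq> N \<inter> bdry" for A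
  proof -
    have lu: "(1 - \<epsilon>) * ?b \<le> norm (weighted \<beta> a)" "norm (weighted \<beta> a) \<le> (1 + \<epsilon>) * ?b" if "a \<in> A" for a
      using N(3)[of a] that A(2) by (auto simp: algebra_simps abs_le_iff)
    have lpos: "0 < (1 - \<epsilon>) * ?b" using b \<epsilon> by simp
    have Ab: "A \<subseteq> bdry" using A by auto
    note bounds = surface_density_bounds[OF A(1) Ab lpos lu]
    have "emeasure surface_density A \<le> ennreal (1 / (2 * ((1 - \<epsilon>) * ?b))) * ?H A" by (rule bounds(1))
    also have "\<dots> \<le> ennreal (1 / (2 * ((1 - \<epsilon>) * ?b))) * (ennreal (?r ^ CARD('n) * (c * ?b)) * emeasure lborel (solid_cone A))"
      by (intro mult_left_mono N(4) A) auto
    also have "\<dots> = ennreal (1 / (2 * ((1 - \<epsilon>) * ?b)) * (?r ^ CARD('n) * (c * ?b))) * emeasure lborel (solid_cone A)"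
      by (subst ennreal_mult) (use b \<epsilon> c r in \<open>auto simp: mult.assoc\<close>)
    also have "\<dots> \<le> ennreal (\<theta> * (c / 2)) * emeasure lborel (solid_cone A)"
    proof (intro mult_right_mono ennreal_leI)
      have "1 / (2 * ((1 - \<epsilon>) * ?b)) * (?r ^ CARD('n) * (c * ?b)) = (1 / (1 - \<epsilon>)) * (?r ^ CARD('n) * (c / 2))"
        using b \<epsilon> by (simp add: field_simps)
      also have "\<dots> \<le> ?r * (?r ^ CARD('n) * (c / 2))"
        using \<epsilon> c r by (intro mult_right_mono divide_right_mono) auto
      finally show "1 / (2 * ((1 - \<epsilon>) * ?b)) * (?r ^ CARD('n) * (c * ?b)) \<le> \<theta> * (c / 2)"
        by (simp add: \<theta>_def mult.assoc)
    qed simp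
    finally have 1: "emeasure surface_density A \<le> ennreal (\<theta> * (c / 2)) * emeasure cone_measure A"
      using A by (simp add: emeasure_cone_measure)
    have "emeasure lborel (solid_cone A) = ennreal (1 / (c * ?b)) * (ennreal (c * ?b) * emeasure lborel (solid_cone A))"
      using b c by (simp add: mult.assoc[symmetric] ennreal_mult[symmetric])
    also have "\<dots> \<le> ennreal (1 / (c * ?b)) * (ennreal (?r ^ CARD('n)) * (ennreal (2 * ((1 + \<epsilon>) * ?b)) * emeasure surface_density A))"
      by (intro mult_left_mono order_trans[OF N(5)[OF A]] bounds(2)) auto
    also have "\<dots> = ennreal (1 / (c * ?b) * (?r ^ CARD('n) * (2 * ((1 + \<epsilon>) * ?b)))) * emeasure surface_density A"
    proof -
      have "ennreal u * (ennreal v * (ennreal w * x)) = ennreal (u * (v * w)) * x"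
        if "u \<ge> 0" "v \<ge> 0" "w \<ge> 0" for u v w x
        using that by (simp add: ennreal_mult mult.assoc)
      then show ?thesis using b c \<epsilon> r by auto
    qed
    also have "\<dots> \<le> ennreal (\<theta> * (2 / c)) * emeasure surface_density A"
    proof (intro mult_right_mono ennreal_leI)
      have "1 / (c * ?b) * (?r ^ CARD('n) * (2 * ((1 + \<epsilon>) * ?b))) = (1 + \<epsilon>) * (?r ^ CARD('n) * (2 / c))"
      proof -
        have "1 / (c * t) * (p * (2 * ((1 + \<epsilon>) * t))) = (1 + \<epsilon>) * (p * (2 / c))" if "t > 0" for p t
          using that c by (simp add: field_simps)
        then show ?thesis using b .
      qed
      also have "\<dots> \<le> ?r * (?r ^ CARD('n) * (2 / c))"
      proof (rule mult_right_mono)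
        have "(1 + \<epsilon>) / 1 \<le> ?r" using \<epsilon> by (intro frac_le) auto
        then show "1 + \<epsilon> \<le> ?r" by simp
      qed (use r c in simp)
      finally show "1 / (c * ?b) * (?r ^ CARD('n) * (2 * ((1 + \<epsilon>) * ?b))) \<le> \<theta> * (2 / c)"
        by (simp add: \<theta>_def mult.assoc)
    qed simp
    finally have 2: "emeasure cone_measure A \<le> ennreal (\<theta> * (2 / c)) * emeasure surface_density A"
      using A by (simp add: emeasure_cone_measure)
    show ?thesis using 1 2 by blast
  qed
  then show ?thesis using N(1,2) by blast
qed

lemma surface_density_eq_cone_measure:
  "\<exists>c>0. surface_density = density cone_measure (\<lambda>_. ennreal c)"
proof -
  obtain c where c: "c > 0" and H: "\<And>b C. b \<noteq> 0 \<Longrightarrow> C \<in> sets borel \<Longrightarrow> C \<subseteq> {y :: real ^ 'n. y \<bullet> b = 1} \<Longrightarrow>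
      hausdorff_outer (CARD('n) - 1) C = ennreal (c * norm b) * emeasure lborel (cone_over b C)"
    using hausdorff_cone_hyperplane[where 'n = 'n] dim by blast
  have on_bdry: "emeasure surface_density A = ennreal (c / 2) * emeasure cone_measure A"
    if A: "A \<in> sets borel" "A \<subseteq> bdry" for A
  proof -
    have le: "emeasure surface_density A \<le> ennreal \<theta> * (ennreal (c / 2) * emeasure cone_measure A) \<and>
        ennreal (c / 2) * emeasure cone_measure A \<le> ennreal \<theta> * emeasure surface_density A" if \<theta>: "\<theta> > 1" for \<theta>
    proof -
      \<comment> \<open>\<epsilon> is obtained by solving ((1 + \<epsilon>) / (1 -
        \<epsilon>))^(n+1) = \<theta>, so every \<theta> > 1 is admissible and \<theta> can be taken
        to 1.\<close>
      define s where "s = root (Suc CARD('n)) \<theta>"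
      have s: "s > 1" using \<theta> by (simp add: s_def)
      define \<epsilon> where "\<epsilon> = (s - 1) / (s + 1)"
      have \<epsilon>: "0 < \<epsilon>" "\<epsilon> < 1" using s by (auto simp: \<epsilon>_def)
      have e1: "1 + \<epsilon> = 2 * s / (s + 1)" and e2: "1 - \<epsilon> = 2 / (s + 1)"
        using s by (auto simp: \<epsilon>_def divide_simps)
      have "(1 + \<epsilon>) / (1 - \<epsilon>) = s"
        unfolding e1 e2 using s by simp
      then have \<theta>_eq: "((1 + \<epsilon>) / (1 - \<epsilon>)) ^ Suc CARD('n) = \<theta>"
        using \<theta> unfolding s_def by (simp only:) (rule real_root_pow_pos2, auto)
      have loc: "\<exists>N. open N \<and> x \<in> N \<and> (\<forall>A\<in>sets borel. A \<subseteq> N \<inter> bdry \<longrightarrow>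
          emeasure surface_density A \<le> ennreal (\<theta> * (c / 2)) * emeasure cone_measure A \<and>
          emeasure cone_measure A \<le> ennreal (\<theta> * (2 / c)) * emeasure surface_density A)" if x: "x \<in> bdry" for x
        unfolding \<theta>_eq[symmetric]
        by (rule surface_density_locally; (fact H | fact c | fact x | fact \<epsilon>))
      have 1: "emeasure surface_density A \<le> ennreal (\<theta> * (c / 2)) * emeasure cone_measure A"
      proof (rule measure_le_locally[OF sets_surface_density sets_cone_measure compact_bdry _ A])
        fix x assume "x \<in> bdry"
        from loc[OF this] show "\<exists>N. open N \<and> x \<in> N \<and> (\<forall>A\<in>sets borel. A \<subseteq> N \<inter> bdry \<longrightarrow>
            emeasure surface_density A \<le> ennreal (\<theta> * (c / 2)) * emeasure cone_measure A)" by blast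
      qed
      have 2: "emeasure cone_measure A \<le> ennreal (\<theta> * (2 / c)) * emeasure surface_density A"
      proof (rule measure_le_locally[OF sets_cone_measure sets_surface_density compact_bdry _ A])
        fix x assume "x \<in> bdry"
        from loc[OF this] show "\<exists>N. open N \<and> x \<in> N \<and> (\<forall>A\<in>sets borel. A \<subseteq> N \<inter> bdry \<longrightarrow>
            emeasure cone_measure A \<le> ennreal (\<theta> * (2 / c)) * emeasure surface_density A)" by blast
      qed
      have "ennreal (c / 2) * emeasure cone_measure A \<le> ennreal (c / 2) * (ennreal (\<theta> * (2 / c)) * emeasure surface_density A)"
        by (intro mult_left_mono 2) auto
      also have "\<dots> = ennreal \<theta> * emeasure surface_density A"
        using c \<theta> by (simp add: mult.assoc[symmetric] ennreal_mult[symmetric])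
      finally have 3: "ennreal (c / 2) * emeasure cone_measure A \<le> ennreal \<theta> * emeasure surface_density A" .
      have "ennreal (\<theta> * (c / 2)) = ennreal \<theta> * ennreal (c / 2)" using \<theta> c by (intro ennreal_mult) auto
      then show ?thesis using 1 3 by (simp add: mult.assoc)
    qed
    show ?thesis
    proof (rule antisym)
      show "emeasure surface_density A \<le> ennreal (c / 2) * emeasure cone_measure A"
        by (rule ennreal_le_mult_gt_one) (rule conjunct1[OF le])
      show "ennreal (c / 2) * emeasure cone_measure A \<le> emeasure surface_density A"
        by (rule ennreal_le_mult_gt_one) (rule conjunct2[OF le])
    qed
  qed
  have "surface_density = density cone_measure (\<lambda>_. ennreal (c / 2))"
  proof (rule measure_eqI)
    fix A assume "A \<in> sets surface_density"
    then have A [measurable]: "A \<in> sets borel" by simp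
    have "emeasure surface_density A = emeasure surface_density (A \<inter> bdry)"
      by (subst (1 2) emeasure_surface_density) (auto intro!: nn_integral_cong simp: indicator_def)
    also have "\<dots> = ennreal (c / 2) * emeasure cone_measure (A \<inter> bdry)"
      by (rule on_bdry) auto
    also have "emeasure cone_measure (A \<inter> bdry) = emeasure cone_measure A"
    proof -
      \<comment> \<open>Radial projections of nonzero points lie on the boundary, so the cone
        measure has no mass elsewhere.\<close>
      have "solid_cone (A \<inter> bdry) = solid_cone A"
        using radial_bdry by (auto simp: solid_cone_def punctured_def quad_pos_iff)
      then show ?thesis by (simp add: emeasure_cone_measure)
    qed
    finally show "emeasure surface_density A = emeasure (density cone_measure (\<lambda>_. ennreal (c / 2))) A"
      by (simp add: emeasure_density nn_integral_cmult)
  qed simp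
  then show ?thesis using c by (intro exI[of _ "c / 2"]) auto
qed

definition cone_integral :: "(real ^ 'n \<Rightarrow> real) \<Rightarrow> real" where
  "cone_integral f = (LINT x|lborel. indicator punctured x * f (radial x))"

theorem surface_integral_eq_cone_integral:
  "\<exists>c>0. \<forall>f\<in>borel_measurable borel.
    (LINT x:bdry|surface_measure. f x / norm (gradient q x)) = c * cone_integral f"
proof -
  obtain c where c: "c > 0" "surface_density = density cone_measure (\<lambda>_. ennreal c)"
    using surface_density_eq_cone_measure by blast
  have "(LINT x:bdry|surface_measure. f x / norm (gradient q x)) = c * cone_integral f"
    if f [measurable]: "f \<in> borel_measurable borel" for f
  proof -
    have "(LINT x:bdry|surface_measure. f x / norm (gradient q x))
      = (LINT x|hausdorff_measure (CARD('n) - 1). (indicator bdry x / norm (gradient q x)) *\<^sub>R f x)"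
      unfolding set_lebesgue_integral_def surface_measure_def by (intro Bochner_Integration.integral_cong) auto
    also have "\<dots> = (LINT x|surface_density. f x)"
      unfolding surface_density_def norm_gradient_quad
      by (rule integral_density[symmetric]) auto
    also have "\<dots> = (LINT x|cone_measure. c *\<^sub>R f x)"
      unfolding c(2) by (rule integral_density) (use c in auto)
    also have "\<dots> = c * (LINT x|cone_measure. f x)" by simp
    also have "(LINT x|cone_measure. f x) = (LINT x|density lborel (indicator punctured). f (radial x))"
      unfolding cone_measure_def by (rule integral_distr) auto
    also have "density lborel (indicator punctured) = density lborel (\<lambda>x. ennreal (indicator punctured x))"
      by (intro arg_cong2[where f = density] refl ext) (simp add: indicator_def)
    also have "(LINT x|\<dots>. f (radial x)) = (LINT x|lborel. indicator punctured x *\<^sub>R f (radial x))"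
      by (rule integral_density) auto
    finally show ?thesis by (simp add: cone_integral_def)
  qed
  then show ?thesis using c by blast
qed

end

subsection \<open>The divergence theorem on the ellipsoid\<close>

lemma lborel_integral_scaleR:
  fixes F :: "'a::euclidean_space \<Rightarrow> real"
  assumes [measurable]: "F \<in> borel_measurable borel" and c: "c > 0"
  shows "(LINT x|lborel. F x) = c ^ DIM('a) * (LINT x|lborel. F (c *\<^sub>R x))"
proof -
  have "(LINT x|lborel. F x) = (LINT x|density (distr lborel borel (\<lambda>x. 0 + c *\<^sub>R x)) (\<lambda>_. \<bar>c\<bar> ^ DIM('a)). F x)"
    using c lborel_affine[of c "0::'a"] by simp
  also have "\<dots> = c ^ DIM('a) * (LINT x|lborel. F (c *\<^sub>R x))"
    using c by (subst integral_density) (auto simp: integral_distr)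
  finally show ?thesis .
qed

lemma lborel_integral_translate:
  fixes F :: "'a::euclidean_space \<Rightarrow> real"
  assumes [measurable]: "F \<in> borel_measurable borel"
  shows "(LINT x|lborel. F (x + v)) = (LINT x|lborel. F x)"
    and "integrable lborel F \<Longrightarrow> integrable lborel (\<lambda>x. F (x + v))"
proof -
  have v: "(\<lambda>x. x + v) = (+) v" by (auto simp: add.commute)
  have d: "distr lborel borel (\<lambda>x. x + v) = lborel" unfolding v by (rule lborel_distr_plus)
  show "(LINT x|lborel. F (x + v)) = (LINT x|lborel. F x)"
    using integral_distr[of "\<lambda>x. x + v" lborel borel F] by (simp add: d)
  show "integrable lborel (\<lambda>x. F (x + v))" if "integrable lborel F"
    using integrable_distr_eq[of "\<lambda>x. x + v" lborel borel F] that by (simp add: d)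
qed

lemma integrable_bounded_support:
  fixes f :: "'a::euclidean_space \<Rightarrow> real"
  assumes "f \<in> borel_measurable borel" "bounded S" "\<And>x. x \<notin> S \<Longrightarrow> f x = 0" "\<And>x. \<bar>f x\<bar> \<le> B"
  shows "integrable lborel f"
proof -
  obtain R where "\<And>x. x \<in> S \<Longrightarrow> norm x \<le> R" using assms(2) by (auto simp: bounded_iff)
  then have R: "S \<subseteq> cball 0 R" by auto
  show ?thesis
  proof (rule Bochner_Integration.integrable_bound)
    show "integrable lborel (\<lambda>x. B * indicator (cball (0::'a) R) x)"
      using emeasure_lborel_cball_finite[of "0::'a" R] by (intro integrable_mult_right) (auto simp: integrable_indicator_iff)
    have "B \<ge> 0" using assms(4) abs_ge_zero order_trans by blast
    have "norm (f x) \<le> norm (B * indicator (cball (0::'a) R) x)" for x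
      using assms(3)[of x] assms(4)[of x] subsetD[OF R, of x] \<open>B \<ge> 0\<close> by (cases "x \<in> cball 0 R") auto
    then show "AE x in lborel. norm (f x) \<le> norm (B * indicator (cball (0::'a) R) x)" by simp
  qed (use assms(1) in simp)
qed

context ellipsoid
begin

abbreviation "cE \<equiv> closed_ellipsoid \<beta>"

definition "oE = {x. q x < 1}"

lemma cE_def: "cE = {x. q x \<le> 1}"
  by (simp add: closed_ellipsoid_def)

lemma compact_cE: "compact cE"
proof -
  have "closed {x. q x \<le> 1}" by (intro closed_Collect_le continuous_intros)
  then show ?thesis using bounded_quad_le[of 1] by (simp add: cE_def compact_eq_bounded_closed)
qed

lemma cE_borel [measurable]: "cE \<in> sets borel"
  using compact_cE by (simp add: borel_closed compact_imp_closed)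

lemma open_oE: "open oE"
  unfolding oE_def by (intro open_Collect_less continuous_intros)

lemma oE_borel [measurable]: "oE \<in> sets borel"
  using open_oE by simp

lemma bounded_oE: "bounded oE"
  by (rule bounded_subset[OF bounded_quad_le[of 1]]) (auto simp: oE_def)

lemma oE_subset_cE: "oE \<subseteq> cE" and bdry_subset_cE: "bdry \<subseteq> cE" and cE_eq_Un: "cE = oE \<union> bdry"
  by (auto simp: oE_def cE_def ellipsoid_boundary_def)

lemma quad_convex_combination:
  assumes "0 \<le> s" "s \<le> 1"
  shows "q ((1 - s) *\<^sub>R x + s *\<^sub>R y) \<le> (1 - s) * q x + s * q y"
proof -
  have "q ((1 - s) *\<^sub>R x + s *\<^sub>R y) = (1 - s) * q x + s * q y - s * (1 - s) * q (x - y)"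
    unfolding quad_def sum_distrib_left sum_subtractf[symmetric] sum.distrib[symmetric]
    by (intro sum.cong) (simp_all add: power2_eq_square algebra_simps)
  moreover have "s * (1 - s) * q (x - y) \<ge> 0" using assms by simp
  ultimately show ?thesis by linarith
qed

lemma convex_cE: "convex cE"
  unfolding convex_alt
proof (intro ballI allI impI)
  fix x y s assume x: "x \<in> cE" and y: "y \<in> cE" and s: "0 \<le> s \<and> s \<le> (1::real)"
  have "q ((1 - s) *\<^sub>R x + s *\<^sub>R y) \<le> (1 - s) * q x + s * q y"
    using s by (intro quad_convex_combination) auto
  also have "\<dots> \<le> (1 - s) * 1 + s * 1"
    using x y s by (intro add_mono mult_left_mono) (auto simp: cE_def)
  finally show "(1 - s) *\<^sub>R x + s *\<^sub>R y \<in> cE" by (simp add: cE_def)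
qed

text \<open>Dilating a boundary point by 1 + t leaves the ellipsoid, so the boundary lies in the
  frontier of a convex set, which is negligible.\<close>

lemma bdry_null: "emeasure lborel bdry = 0"
proof -
  have "bdry \<subseteq> frontier cE"
  proof
    fix x assume x: "x \<in> bdry"
    have "x \<notin> interior cE"
    proof
      assume "x \<in> interior cE"
      then obtain e where e: "e > 0" "ball x e \<subseteq> cE" by (meson mem_interior)
      define N where "N = norm x + 1"
      have N: "N > 0" "norm x \<le> N" by (auto simp: N_def add_nonneg_pos)
      define t where "t = e / (2 * N)"
      have t: "t > 0" using e N by (simp add: t_def)
      have "norm (t *\<^sub>R x) < e"
      proof -
        have "t * norm x \<le> t * N" using t N by simp
        also have "\<dots> = e / 2" using N by (simp add: t_def)
        finally show ?thesis using e t by simp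
      qed
      then have "(1 + t) *\<^sub>R x \<in> ball x e" by (simp add: dist_norm algebra_simps)
      then have "q ((1 + t) *\<^sub>R x) \<le> 1" using e by (auto simp: cE_def)
      then have "(1 + t)\<^sup>2 \<le> 1" using x by (simp add: quad_scaleR ellipsoid_boundary_def)
      then show False using t by (simp add: power2_eq_square algebra_simps)
         (smt (verit) mult_pos_pos)
    qed
    then show "x \<in> frontier cE" using x bdry_subset_cE closure_subset by (auto simp: frontier_def)
  qed
  then have "negligible bdry"
    using negligible_subset[OF negligible_convex_frontier[OF convex_cE]] by blast
  then have "emeasure lebesgue bdry = 0" by (subst (asm) negligible_iff_emeasure0) auto
  then show ?thesis by simp
qed

text \<open>Only the behaviour of \<open>p\<close> on lines in the direction \<open>v\<close> matters: extended by zero, \<open>p\<close> is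
  Lipschitz in that direction, so the vanishing integral of its difference quotients passes to the limit.\<close>

lemma integral_directional_derivative_zero:
  assumes U: "open U" "cE \<subseteq> U"
    and deriv: "\<And>x. x \<in> U \<Longrightarrow> ((\<lambda>t. p (x + t *\<^sub>R v)) has_real_derivative g x) (at 0)"
    and cont: "continuous_on cE p" "continuous_on cE g"
    and zero: "\<And>x. x \<in> bdry \<Longrightarrow> p x = 0"
  shows "(LINT x|lborel. indicator oE x * g x) = 0"
proof -
  define P where "P x = indicator cE x * p x" for x
  have Pm [measurable]: "P \<in> borel_measurable borel"
    unfolding P_def using borel_measurable_continuous_on_indicator[OF cE_borel cont(1)] by simp
  have gm [measurable]: "(\<lambda>x. indicator oE x * g x) \<in> borel_measurable borel"
    using borel_measurable_continuous_on_indicator[OF oE_borel continuous_on_subset[OF cont(2) oE_subset_cE]] by simp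
  obtain B where B: "\<And>x. x \<in> cE \<Longrightarrow> \<bar>p x\<bar> \<le> B"
    using compact_imp_bounded[OF compact_continuous_image[OF cont(1) compact_cE]] by (auto simp: bounded_iff)
  obtain C where C0: "\<And>x. x \<in> cE \<Longrightarrow> \<bar>g x\<bar> \<le> C"
    using compact_imp_bounded[OF compact_continuous_image[OF cont(2) compact_cE]] by (auto simp: bounded_iff)
  have "0 \<in> cE" by (simp add: cE_def)
  then have C: "C \<ge> 0" and B0: "B \<ge> 0" using C0 B abs_ge_zero order_trans by blast+
  \<comment> \<open>A derivative at 0 from every base point is a derivative at every t along the
    line.\<close>
  have DERIV: "((\<lambda>t. p (x + t *\<^sub>R v)) has_real_derivative g (x + t *\<^sub>R v)) (at t)" if "x + t *\<^sub>R v \<in> U" for x t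
  proof -
    have "((\<lambda>s. p (x + (s + t) *\<^sub>R v)) has_real_derivative g (x + t *\<^sub>R v)) (at 0)"
      using deriv[OF that] by (simp add: algebra_simps)
    then show ?thesis using DERIV_shift[of "\<lambda>t. p (x + t *\<^sub>R v)" "g (x + t *\<^sub>R v)" 0 t] by simp
  qed
  have lip_in: "\<bar>p (x + t *\<^sub>R v) - p x\<bar> \<le> C * t" if x: "x \<in> cE" "x + t *\<^sub>R v \<in> cE" and t: "t > 0" for x t
  proof -
    have seg: "x + s *\<^sub>R v \<in> cE" if s: "0 \<le> s" "s \<le> t" for s
    proof -
      have "(1 - s / t) *\<^sub>R x + (s / t) *\<^sub>R (x + t *\<^sub>R v) \<in> cE"
        using convexD_alt[OF convex_cE x, of "s / t"] s t by auto
      also have "(1 - s / t) *\<^sub>R x + (s / t) *\<^sub>R (x + t *\<^sub>R v) = x + s *\<^sub>R v"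
        using t by (simp add: algebra_simps)
      finally show ?thesis .
    qed
    obtain z where z: "0 < z" "z < t" "p (x + t *\<^sub>R v) - p (x + 0 *\<^sub>R v) = (t - 0) * g (x + z *\<^sub>R v)"
      using MVT2[OF t, of "\<lambda>s. p (x + s *\<^sub>R v)" "\<lambda>s. g (x + s *\<^sub>R v)"] DERIV seg U(2) by blast
    then have "\<bar>p (x + t *\<^sub>R v) - p x\<bar> = t * \<bar>g (x + z *\<^sub>R v)\<bar>" using t by (simp add: abs_mult)
    also have "\<dots> \<le> t * C" using z t seg[of z] by (intro mult_left_mono C0) auto
    finally show ?thesis by (simp add: mult.commute)
  qed
  \<comment> \<open>A segment from inside to outside meets the boundary, where p vanishes; the
    Lipschitz estimate is then needed on its inner part only.\<close>
  have cross: "\<exists>s. 0 < s \<and> s < t \<and> x + s *\<^sub>R v \<in> bdry"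
    if t: "t > 0" and ends: "(q x < 1 \<and> q (x + t *\<^sub>R v) > 1) \<or> (q x > 1 \<and> q (x + t *\<^sub>R v) < 1)" for x t
  proof -
    have c: "continuous_on {0..t} (\<lambda>s. q (x + s *\<^sub>R v))" by (intro continuous_intros)
    have "\<exists>s\<ge>0. s \<le> t \<and> q (x + s *\<^sub>R v) = 1"
    proof (cases "q x < 1")
      case True
      then show ?thesis using ends t by (intro IVT'[OF _ _ _ c]) auto
    next
      case False
      then show ?thesis using ends t by (intro IVT2'[OF _ _ _ c]) auto
    qed
    then obtain s where s: "s \<ge> 0" "s \<le> t" "q (x + s *\<^sub>R v) = 1" by blast
    moreover have "s \<noteq> 0" using s ends by auto
    moreover have "s \<noteq> t" using s ends by auto
    ultimately show ?thesis by (intro exI[of _ s]) (auto simp: ellipsoid_boundary_def)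
  qed
  have lip: "\<bar>P (x + t *\<^sub>R v) - P x\<bar> \<le> C * t" if t: "t > 0" for x t
  proof -
    let ?y = "x + t *\<^sub>R v"
    have Pz: "P z = 0" if "q z \<ge> 1" for z
      using that zero[of z] by (cases "q z = 1") (auto simp: P_def cE_def indicator_def ellipsoid_boundary_def)
    have Pin: "P z = p z" if "q z \<le> 1" for z using that by (simp add: P_def cE_def)
    consider "q x \<le> 1" "q ?y \<le> 1" | "q x < 1" "q ?y > 1" | "q x > 1" "q ?y < 1" | "q x \<ge> 1" "q ?y \<ge> 1"
      by linarith
    then show ?thesis
    proof cases
      case 1 then show ?thesis using lip_in[of x t] t by (simp add: Pin cE_def)
    next
      case 2
      then obtain s where s: "0 < s" "s < t" "x + s *\<^sub>R v \<in> bdry" using cross[OF t, of x] by blast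
      have "\<bar>p (x + s *\<^sub>R v) - p x\<bar> \<le> C * s"
      proof (rule lip_in)
        show "x + s *\<^sub>R v \<in> cE" using s bdry_subset_cE by blast
      qed (use s 2 in \<open>auto simp: cE_def\<close>)
      also have "\<dots> \<le> C * t" using s C by (intro mult_left_mono) auto
      finally show ?thesis using 2 s(3) by (simp add: Pz Pin zero)
    next
      case 3
      then obtain s where s: "0 < s" "s < t" "x + s *\<^sub>R v \<in> bdry" using cross[OF t, of x] by blast
      have e: "x + s *\<^sub>R v + (t - s) *\<^sub>R v = ?y" by (simp add: algebra_simps)
      have "\<bar>p (x + s *\<^sub>R v + (t - s) *\<^sub>R v) - p (x + s *\<^sub>R v)\<bar> \<le> C * (t - s)"
      proof (rule lip_in)
        show "x + s *\<^sub>R v \<in> cE" using s bdry_subset_cE by blast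
        show "x + s *\<^sub>R v + (t - s) *\<^sub>R v \<in> cE" unfolding e using 3 by (simp add: cE_def)
      qed (use s in simp)
      also have "\<dots> \<le> C * t" using s C by (intro mult_left_mono) auto
      finally show ?thesis using 3 s(3) unfolding e by (simp add: Pz Pin zero)
    next
      case 4 then show ?thesis using C t by (simp add: Pz)
    qed
  qed
  define h where "h k = 1 / real (Suc k)" for k
  have h: "h k > 0" "h k \<le> 1" for k by (auto simp: h_def)
  \<comment> \<open>Difference quotients of the extension by zero; translation invariance gives them
    integral 0.\<close>
  define D where "D k x = (P (x + h k *\<^sub>R v) - P x) / h k" for k x
  have Dm [measurable]: "D k \<in> borel_measurable borel" for k unfolding D_def by measurable
  have Pint: "integrable lborel P"
    by (rule integrable_bounded_support[OF Pm compact_imp_bounded[OF compact_cE], of B])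
       (use B B0 in \<open>auto simp: P_def indicator_def\<close>)
  have D0: "(LINT x|lborel. D k x) = 0" for k
  proof -
    have "(LINT x|lborel. D k x) = ((LINT x|lborel. P (x + h k *\<^sub>R v)) - (LINT x|lborel. P x)) / h k"
      unfolding D_def using Pint lborel_integral_translate(2)[OF Pm Pint] by simp
    then show ?thesis by (simp add: lborel_integral_translate(1)[OF Pm])
  qed
  obtain R where R: "\<And>x. x \<in> cE \<Longrightarrow> norm x \<le> R"
    using compact_imp_bounded[OF compact_cE] by (auto simp: bounded_iff)
  \<comment> \<open>Steps have length at most |v|, so outside this ball neither end of a step lies
    in the ellipsoid and the quotient vanishes.\<close>
  let ?K = "cball (0 :: real ^ 'n) (R + norm v)"
  have Dbound: "\<bar>D k x\<bar> \<le> C * indicator ?K x" for k x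
  proof (cases "x \<in> ?K")
    case True
    have "\<bar>P (x + h k *\<^sub>R v) - P x\<bar> \<le> C * h k" by (rule lip[OF h(1)])
    then show ?thesis using True h(1)[of k] by (simp add: D_def pos_divide_le_eq)
  next
    case False
    have "norm (h k *\<^sub>R v) \<le> norm v" using h[of k] mult_right_mono[of "h k" 1 "norm v"] by simp
    then have "x \<notin> cE" "x + h k *\<^sub>R v \<notin> cE"
      using False R[of x] R[of "x + h k *\<^sub>R v"] norm_triangle_ineq4[of "x + h k *\<^sub>R v" "h k *\<^sub>R v"] norm_ge_zero[of v]
      by auto
    then show ?thesis using False by (simp add: D_def P_def)
  qed
  have hlim: "h \<longlonglongrightarrow> 0" unfolding h_def by (rule LIMSEQ_Suc[OF lim_1_over_n])
  have mv: "(\<lambda>k. x + h k *\<^sub>R v) \<longlonglongrightarrow> x" for x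
    using tendsto_add[OF tendsto_const tendsto_scaleR[OF hlim tendsto_const], of x v] by simp
  have conv: "(\<lambda>k. D k x) \<longlonglongrightarrow> indicator oE x * g x" if x: "x \<notin> bdry" for x
  proof (cases "q x < 1")
    case True
    then have xo: "x \<in> oE" "x \<in> cE" by (auto simp: oE_def cE_def)
    have "\<forall>\<^sub>F k in sequentially. x + h k *\<^sub>R v \<in> oE"
      using topological_tendstoD[OF mv open_oE xo(1)] .
    then have ev: "\<forall>\<^sub>F k in sequentially. (p (x + h k *\<^sub>R v) - p (x + 0 *\<^sub>R v)) / (h k - 0) = D k x"
      by eventually_elim (use xo in \<open>auto simp: D_def P_def oE_def cE_def\<close>)
    have "((\<lambda>t. (p (x + t *\<^sub>R v) - p (x + 0 *\<^sub>R v)) / (t - 0)) \<longlongrightarrow> g x) (at 0)"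
      using deriv[of x] xo U by (auto simp: has_field_derivative_iff)
    then have "(\<lambda>k. (p (x + h k *\<^sub>R v) - p (x + 0 *\<^sub>R v)) / (h k - 0)) \<longlonglongrightarrow> g x"
      by (rule filterlim_compose) (use hlim h(1) in \<open>auto simp: filterlim_at less_imp_neq[symmetric]\<close>)
    then show ?thesis using Lim_transform_eventually[OF _ ev] xo by simp
  next
    case False
    then have qx: "q x > 1" using x by (auto simp: ellipsoid_boundary_def)
    have "open {x. q x > 1}" by (intro open_Collect_less continuous_intros)
    from topological_tendstoD[OF mv this] qx have "\<forall>\<^sub>F k in sequentially. q (x + h k *\<^sub>R v) > 1" by auto
    then have "\<forall>\<^sub>F k in sequentially. D k x = 0"
      by eventually_elim (use qx in \<open>auto simp: D_def P_def cE_def\<close>)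
    then show ?thesis using False by (simp add: oE_def tendsto_eventually)
  qed
  have "(\<lambda>k. LINT x|lborel. D k x) \<longlonglongrightarrow> (LINT x|lborel. indicator oE x * g x)"
  proof (rule integral_dominated_convergence[where w = "\<lambda>x. C * indicator ?K x"])
    show "integrable lborel (\<lambda>x. C * indicator ?K x)"
      using emeasure_lborel_cball_finite[of "0 :: real ^ 'n" "R + norm v"] by (intro integrable_mult_right) (auto simp: integrable_indicator_iff)
    have "AE x in lborel. x \<notin> bdry" using bdry_null by (intro AE_not_in) (auto simp: null_sets_def)
    then show "AE x in lborel. (\<lambda>k. D k x) \<longlonglongrightarrow> indicator oE x * g x"
      by eventually_elim (rule conv)
    show "AE x in lborel. norm (D k x) \<le> C * indicator ?K x" for k using Dbound by simp
  qed auto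
  then show ?thesis by (simp add: D0 LIMSEQ_const_iff)
qed

end

text \<open>N / (2 k + N) is the mean of q^k over an N-dimensional ellipsoid. Thus k + 1 times the
  mean of q^k stays bounded, whereas k + 1 times the mean of q^k (1 - q) tends to 0.\<close>

lemma shell_coefficient_bounds:
  fixes N k :: real
  assumes "N \<ge> 1" "k \<ge> 0"
  shows "(k + 1) * (N / (2 * k + N)) \<le> N"
    and "(k + 1) * (N / (2 * k + N) - N / (2 * (k + 1) + N)) \<le> N / (2 * k + N)"
proof -
  have den: "2 * k + N > 0" "2 * (k + 1) + N > 0" using assms by (simp_all add: add_nonneg_pos add_pos_pos)
  have "(k + 1) / (2 * k + N) \<le> 1" using den assms by simp
  then have "N * ((k + 1) / (2 * k + N)) \<le> N * 1" using assms by (intro mult_left_mono) auto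
  then show "(k + 1) * (N / (2 * k + N)) \<le> N" by (simp add: mult.commute)
  have "N / (2 * k + N) - N / (2 * (k + 1) + N) = N / (2 * k + N) * (2 / (2 * (k + 1) + N))"
    using den by (simp add: divide_simps) (simp add: algebra_simps)
  then have "(k + 1) * (N / (2 * k + N) - N / (2 * (k + 1) + N)) = N / (2 * k + N) * (2 * (k + 1) / (2 * (k + 1) + N))"
    by (simp add: ac_simps)
  also have "\<dots> \<le> N / (2 * k + N) * 1"
    using den assms by (intro mult_left_mono) auto
  finally show "(k + 1) * (N / (2 * k + N) - N / (2 * (k + 1) + N)) \<le> N / (2 * k + N)" by simp
qed

section \<open>Powers of q against radial functions and concentration at the boundary\<close>

context ellipsoid
begin

lemma punctured_radial_bdry: "x \<in> punctured \<Longrightarrow> radial x \<in> bdry"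
  by (rule radial_bdry) (auto simp: punctured_def)

lemma cone_integral_cong:
  assumes "\<And>a. a \<in> bdry \<Longrightarrow> f a = g a"
  shows "cone_integral f = cone_integral g"
proof -
  have "(\<lambda>x. indicator punctured x * f (radial x)) = (\<lambda>x. indicator punctured x * g (radial x))"
  proof
    fix x show "indicator punctured x * f (radial x) = indicator punctured x * g (radial x)"
      using assms punctured_radial_bdry by (cases "x \<in> punctured") auto
  qed
  then show ?thesis unfolding cone_integral_def by (simp only:)
qed

lemma bounded_punctured: "bounded punctured"
  by (rule bounded_subset[OF bounded_oE]) (auto simp: punctured_def oE_def)

lemma integrable_cone_integrand:
  fixes f :: "real ^ 'n \<Rightarrow> real"
  assumes [measurable]: "f \<in> borel_measurable borel" and B: "\<And>a. a \<in> bdry \<Longrightarrow> \<bar>f a\<bar> \<le> B"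
  shows "integrable lborel (\<lambda>x. indicator punctured x * f (radial x))"
proof (rule integrable_bounded_support[OF _ bounded_punctured, of _ "\<bar>B\<bar>"])
  fix x show "\<bar>indicator punctured x * f (radial x)\<bar> \<le> \<bar>B\<bar>"
    using B[OF punctured_radial_bdry[of x]] by (cases "x \<in> punctured") auto
qed auto

text \<open>The function is constant on rays, so a dilation by \<tau> changes only the volume
  element.\<close>

lemma cone_integral_scaled:
  assumes [measurable]: "f \<in> borel_measurable borel" and \<tau>: "0 < \<tau>" "\<tau> \<le> 1"
  shows "(LINT x|lborel. indicator {x. q x < \<tau>\<^sup>2} x * (indicator punctured x * f (radial x))) = \<tau> ^ CARD('n) * cone_integral f"
proof -
  let ?F = "\<lambda>x. indicator {x. q x < \<tau>\<^sup>2} x * (indicator punctured x * f (radial x))"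
  have "(LINT x|lborel. ?F x) = \<tau> ^ CARD('n) * (LINT x|lborel. ?F (\<tau> *\<^sub>R x))"
    using lborel_integral_scaleR[of ?F \<tau>] \<tau> by simp
  also have "(\<lambda>x. ?F (\<tau> *\<^sub>R x)) = (\<lambda>x. indicator punctured x * f (radial x))"
  proof
    fix x
    have t2: "\<tau>\<^sup>2 > 0" "\<tau>\<^sup>2 \<le> 1" using \<tau> by (auto simp: power_le_one)
    have "\<tau>\<^sup>2 * q x < 1" if "q x < 1" using that t2 quad_nonneg[of x]
      by (smt (verit) mult_left_le_one_le)
    then show "?F (\<tau> *\<^sub>R x) = indicator punctured x * f (radial x)"
      using t2 \<tau> by (auto simp: indicator_def punctured_def quad_scaleR radial_scaleR zero_less_mult_iff)
  qed
  finally show ?thesis by (simp add: cone_integral_def)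
qed

text \<open>A layer-cake computation in place of polar coordinates: q^k is the integral of w \<tau>
  = 2 k \<tau>^(2k-1) over 0 \<le> \<tau> \<le> sqrt q. After exchanging the integrals, the inner
  one runs over the points with \<tau>^2 \<le> q and equals 1 - \<tau>^n times the cone integral of
  f; integrating w \<tau> (1 - \<tau>^n) over the unit interval gives n / (2 k + n).\<close>

lemma cone_integral_quad_power:
  fixes f :: "real ^ 'n \<Rightarrow> real"
  assumes f [measurable]: "f \<in> borel_measurable borel" and B: "\<And>a. a \<in> bdry \<Longrightarrow> \<bar>f a\<bar> \<le> B"
  shows "(LINT x|lborel. indicator punctured x * (q x ^ k * f (radial x))) = CARD('n) / (2 * k + CARD('n)) * cone_integral f"
proof (cases k)
  \<comment> \<open>Treated apart, since the layer formula needs 0^(2k) = 0.\<close>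
  case 0
  then show ?thesis by (simp add: cone_integral_def)
next
  case (Suc j)
  let ?n = "CARD('n)"
  define G where "G x = indicator punctured x * f (radial x)" for x
  have G [measurable]: "G \<in> borel_measurable borel" unfolding G_def by measurable
  have Gint: "integrable lborel G" unfolding G_def by (rule integrable_cone_integrand[OF f B])
  have GB: "\<bar>G x\<bar> \<le> \<bar>B\<bar>" for x
    using B[OF punctured_radial_bdry[of x]] by (cases "x \<in> punctured") (auto simp: G_def)
  define w where "w \<tau> = 2 * k * \<tau> ^ (2 * k - 1)" for \<tau> :: real
  have w [measurable]: "w \<in> borel_measurable borel" unfolding w_def by measurable
  define K where "K x \<tau> = indicator {0..1} \<tau> * w \<tau> * (indicator {x. \<tau>\<^sup>2 \<le> q x} x * G x)" for x \<tau>
  have Kint: "integrable (lborel \<Otimes>\<^sub>M lborel) (case_prod K)"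
    unfolding lborel_prod
  proof (rule integrable_bounded_support[where S = "cE \<times> {0..1}" and B = "2 * k * \<bar>B\<bar>"])
    have "case_prod K \<in> borel_measurable (borel \<Otimes>\<^sub>M borel)"
      unfolding K_def indicator_def by measurable
    then show "case_prod K \<in> borel_measurable borel" by (simp add: borel_prod)
    show "bounded (cE \<times> {0..1::real})" by (intro bounded_Times compact_imp_bounded compact_cE) auto
    fix z :: "(real ^ 'n) \<times> real"
    obtain x \<tau> where z: "z = (x, \<tau>)" by (cases z)
    show "case_prod K z = 0" if "z \<notin> cE \<times> {0..1}"
      using that by (auto simp: z K_def G_def indicator_def punctured_def cE_def)
    show "\<bar>case_prod K z\<bar> \<le> 2 * k * \<bar>B\<bar>"
    proof (cases "0 \<le> \<tau> \<and> \<tau> \<le> 1")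
      case True
      then have "\<bar>w \<tau>\<bar> \<le> 2 * k" by (simp add: w_def abs_mult power_le_one mult_left_le)
      moreover have "\<bar>indicator {x. \<tau>\<^sup>2 \<le> q x} x * G x\<bar> \<le> \<bar>B\<bar>" using GB[of x] by (simp add: indicator_def)
      ultimately have "\<bar>w \<tau>\<bar> * \<bar>indicator {x. \<tau>\<^sup>2 \<le> q x} x * G x\<bar> \<le> 2 * k * \<bar>B\<bar>" by (intro mult_mono) auto
      then show ?thesis using True by (simp add: z K_def abs_mult)
    qed (auto simp: z K_def indicator_def)
  qed
  have "(LINT x|lborel. (LINT \<tau>|lborel. K x \<tau>)) = (LINT x|lborel. indicator punctured x * (q x ^ k * f (radial x)))"
  proof (rule Bochner_Integration.integral_cong[OF refl])
    fix x :: "real ^ 'n"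
    show "(LINT \<tau>|lborel. K x \<tau>) = indicator punctured x * (q x ^ k * f (radial x))"
    proof (cases "x \<in> punctured")
      case True
      then have qx: "0 < q x" "q x < 1" by (auto simp: punctured_def)
      have s: "0 \<le> sqrt (q x)" "sqrt (q x) \<le> 1" using qx by auto
      have "K x \<tau> = (w \<tau> * indicator {0..sqrt (q x)} \<tau>) * G x" for \<tau>
      proof (cases "\<tau> \<ge> 0")
        case True
        then have "\<tau>\<^sup>2 \<le> q x \<longleftrightarrow> \<tau> \<le> sqrt (q x)"
          using qx by (metis real_le_rsqrt real_sqrt_le_iff real_sqrt_unique)
        moreover have "\<tau> \<le> 1" if "\<tau> \<le> sqrt (q x)" using that s(2) by (rule order_trans)
        ultimately show ?thesis using True by (auto simp: K_def indicator_def)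
      qed (simp add: K_def indicator_def)
      then have "(LINT \<tau>|lborel. K x \<tau>) = (LINT \<tau>|lborel. w \<tau> * indicator {0..sqrt (q x)} \<tau>) * G x" by simp
      also have "(LINT \<tau>|lborel. w \<tau> * indicator {0..sqrt (q x)} \<tau>) = sqrt (q x) ^ (2 * k) - 0 ^ (2 * k)"
        using s by (intro integral_FTC_Icc_real) (auto simp: w_def intro!: derivative_eq_intros continuous_intros)
      also have "\<dots> = q x ^ k" using qx Suc by (simp add: power_mult)
      finally show ?thesis using True by (simp add: G_def)
    qed (simp add: K_def G_def)
  qed
  moreover have "(LINT \<tau>|lborel. (LINT x|lborel. K x \<tau>)) = CARD('n) / (2 * k + CARD('n)) * cone_integral f"
  proof -
    have inner: "(LINT x|lborel. K x \<tau>) = ((w \<tau> - w \<tau> * \<tau> ^ ?n) * indicator {0..1} \<tau>) * cone_integral f" for \<tau>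
    proof (cases "0 < \<tau> \<and> \<tau> \<le> 1")
      case True
      have "(LINT x|lborel. indicator {x. \<tau>\<^sup>2 \<le> q x} x * G x) = (LINT x|lborel. G x - indicator {x. q x < \<tau>\<^sup>2} x * G x)"
        by (intro Bochner_Integration.integral_cong) (auto simp: indicator_def)
      also have "\<dots> = (LINT x|lborel. G x) - (LINT x|lborel. indicator {x. q x < \<tau>\<^sup>2} x * G x)"
        by (intro Bochner_Integration.integral_diff Gint integrable_bounded_support[OF _ bounded_punctured, of _ "\<bar>B\<bar>"])
           (use GB in \<open>auto simp: indicator_def G_def\<close>)
      also have "\<dots> = cone_integral f - \<tau> ^ ?n * cone_integral f"
        using cone_integral_scaled[OF f] True by (simp add: G_def cone_integral_def)
      finally have I: "(LINT x|lborel. indicator {x. \<tau>\<^sup>2 \<le> q x} x * G x) = cone_integral f - \<tau> ^ ?n * cone_integral f" .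
      have "K x \<tau> = w \<tau> * (indicator {x. \<tau>\<^sup>2 \<le> q x} x * G x)" for x using True by (simp add: K_def)
      then have "(LINT x|lborel. K x \<tau>) = w \<tau> * (cone_integral f - \<tau> ^ ?n * cone_integral f)" by (simp add: I)
      then show ?thesis using True by (simp add: algebra_simps)
    next
      case False
      then have "\<tau> = 0 \<or> \<not> (0 \<le> \<tau> \<and> \<tau> \<le> 1)" by auto
      then show ?thesis using Suc by (auto simp: K_def w_def indicator_def)
    qed
    let ?W = "\<lambda>\<tau>::real. \<tau> ^ (2 * k) - 2 * k / (2 * k + ?n) * \<tau> ^ (2 * k + ?n)"
    have "(LINT \<tau>|lborel. (w \<tau> - w \<tau> * \<tau> ^ ?n) * indicator {0..1} \<tau>) = ?W 1 - ?W 0"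
    proof (rule integral_FTC_Icc_real)
      fix \<tau> :: real
      have "((\<lambda>\<tau>. \<tau> ^ (2 * k + ?n)) has_real_derivative (real (2 * k + ?n) * \<tau> ^ (2 * k + ?n - 1))) (at \<tau>)"
        by (auto intro!: derivative_eq_intros)
      moreover have "2 * k + ?n - 1 = (2 * k - 1) + ?n" using Suc by simp
      ultimately have "((\<lambda>\<tau>. 2 * k / (2 * k + ?n) * \<tau> ^ (2 * k + ?n)) has_real_derivative 
          (2 * k / (2 * k + ?n) * (real (2 * k + ?n) * (\<tau> ^ (2 * k - 1) * \<tau> ^ ?n)))) (at \<tau>)"
        by (intro DERIV_cmult) (simp add: power_add)
      moreover have "2 * k / (2 * k + ?n) * (real (2 * k + ?n) * (\<tau> ^ (2 * k - 1) * \<tau> ^ ?n)) = w \<tau> * \<tau> ^ ?n"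
        using Suc by (simp add: w_def)
      ultimately have "((\<lambda>\<tau>. 2 * k / (2 * k + ?n) * \<tau> ^ (2 * k + ?n)) has_real_derivative w \<tau> * \<tau> ^ ?n) (at \<tau>)" by simp
      moreover have "((\<lambda>\<tau>. \<tau> ^ (2 * k)) has_real_derivative w \<tau>) (at \<tau>)"
        by (auto intro!: derivative_eq_intros simp: w_def)
      ultimately show "(?W has_real_derivative (w \<tau> - w \<tau> * \<tau> ^ ?n)) (at \<tau>)" by (intro DERIV_diff)
      show "isCont (\<lambda>\<tau>. w \<tau> - w \<tau> * \<tau> ^ ?n) \<tau>" unfolding w_def by (intro continuous_intros)
    qed simp
    also have "\<dots> = ?n / (2 * k + ?n)" using Suc by (simp add: field_simps)
    finally show ?thesis unfolding inner by simp
  qed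
  moreover have "(LINT \<tau>|lborel. (LINT x|lborel. K x \<tau>)) = (LINT x|lborel. (LINT \<tau>|lborel. K x \<tau>))"
    by (rule lborel_pair.Fubini_integral[OF Kint])
  ultimately show ?thesis by simp
qed

lemma integrable_oE:
  fixes u :: "real ^ 'n \<Rightarrow> real"
  assumes "continuous_on cE u"
  shows "integrable lborel (\<lambda>x. indicator oE x * u x)" "(\<lambda>x. indicator oE x * u x) \<in> borel_measurable borel"
proof -
  obtain B where B: "\<And>x. x \<in> cE \<Longrightarrow> \<bar>u x\<bar> \<le> B"
    using compact_imp_bounded[OF compact_continuous_image[OF assms compact_cE]] by (auto simp: bounded_iff)
  show m: "(\<lambda>x. indicator oE x * u x) \<in> borel_measurable borel"
    using borel_measurable_continuous_on_indicator[OF oE_borel continuous_on_subset[OF assms oE_subset_cE]] by simp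
  show "integrable lborel (\<lambda>x. indicator oE x * u x)"
  proof (rule integrable_bounded_support[OF m bounded_oE, of "\<bar>B\<bar>"])
    fix x show "\<bar>indicator oE x * u x\<bar> \<le> \<bar>B\<bar>" using B[of x] oE_subset_cE by (cases "x \<in> oE") auto
  qed auto
qed

text \<open>Near the boundary x and \<open>radial x\<close> are close and uniform continuity gives
  e; farther inside 1 - q is bounded below, and a large C absorbs the oscillation of h.\<close>

lemma radial_approximation:
  assumes h: "continuous_on cE h" and e: "e > 0"
  shows "\<exists>C\<ge>0. \<forall>x\<in>punctured. \<bar>h x - h (radial x)\<bar> \<le> e + C * (1 - q x)"
proof -
  obtain B where B: "\<And>x. x \<in> cE \<Longrightarrow> \<bar>h x\<bar> \<le> B"
    using compact_imp_bounded[OF compact_continuous_image[OF h compact_cE]] by (auto simp: bounded_iff)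
  have "0 \<in> cE" by (simp add: cE_def)
  then have B0: "B \<ge> 0" using B abs_ge_zero order_trans by blast
  obtain R where R: "R > 0" "\<And>x. x \<in> cE \<Longrightarrow> norm x \<le> R"
    using compact_imp_bounded[OF compact_cE] by (auto simp: bounded_pos)
  obtain \<delta> where \<delta>: "\<delta> > 0" "\<And>x y. x \<in> cE \<Longrightarrow> y \<in> cE \<Longrightarrow> dist x y < \<delta> \<Longrightarrow> dist (h x) (h y) < e"
    using compact_uniformly_continuous[OF h compact_cE] e unfolding uniformly_continuous_on_def by metis
  \<comment> \<open>If (1 - q x) R \<ge> \<delta>, then C (1 - q x) \<ge> 2 B, which bounds any
    difference of two values of h.\<close>
  define C where "C = 2 * B * R / \<delta>"
  have C: "C \<ge> 0" using B0 R \<delta> by (simp add: C_def)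
  have "\<bar>h x - h (radial x)\<bar> \<le> e + C * (1 - q x)" if x: "x \<in> punctured" for x
  proof -
    define a where "a = radial x"
    have qx: "0 < q x" "q x < 1" using x by (auto simp: punctured_def)
    have a: "a \<in> bdry" "a \<in> cE" using punctured_radial_bdry[OF x] bdry_subset_cE by (auto simp: a_def)
    have xc: "x \<in> cE" using qx by (simp add: cE_def)
    have xa: "x = sqrt (q x) *\<^sub>R a" using qx by (simp add: a_def radial_def)
    have sq: "q x \<le> sqrt (q x)" "sqrt (q x) \<le> 1"
    proof -
      show s1: "sqrt (q x) \<le> 1" using qx by simp
      have "q x = sqrt (q x) * sqrt (q x)" using qx by simp
      also have "\<dots> \<le> 1 * sqrt (q x)" using s1 qx by (intro mult_right_mono) auto
      finally show "q x \<le> sqrt (q x)" by simp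
    qed
    have "dist x a = norm ((sqrt (q x) - 1) *\<^sub>R a)" by (subst xa) (simp add: dist_norm algebra_simps)
    also have "\<dots> = (1 - sqrt (q x)) * norm a" using sq by simp
    also have "\<dots> \<le> (1 - q x) * R" using sq R a by (intro mult_mono) auto
    finally have d: "dist x a \<le> (1 - q x) * R" .
    show ?thesis
    proof (cases "(1 - q x) * R < \<delta>")
      case True
      then have "dist (h x) (h a) < e" using \<delta>(2)[OF xc a(2)] d by simp
      moreover have "C * (1 - q x) \<ge> 0" using C qx by simp
      ultimately show ?thesis by (simp add: a_def dist_real_def)
    next
      case False
      then have "2 * B * 1 \<le> 2 * B * ((1 - q x) * R / \<delta>)"
        using \<delta>(1) B0 by (intro mult_left_mono) auto
      also have "\<dots> = C * (1 - q x)" by (simp add: C_def)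
      finally have "2 * B \<le> C * (1 - q x)" by simp
      moreover have "\<bar>h x - h a\<bar> \<le> 2 * B" using B[OF xc] B[OF a(2)] by linarith
      ultimately show ?thesis using e by (simp add: a_def)
    qed
  qed
  then show ?thesis using C by blast
qed

text \<open>The weights \<open>(k + 1) * q x ^ k\<close> concentrate at the boundary, where \<open>h\<close> and \<open>h \<circ> radial\<close> agree.\<close>

lemma shell_limit:
  assumes h: "continuous_on cE h"
  shows "(\<lambda>k. real (Suc k) * (LINT x|lborel. indicator oE x * (q x ^ k * h x))) \<longlonglongrightarrow> CARD('n) / 2 * cone_integral h"
proof -
  let ?n = "real CARD('n)"
  \<comment> \<open>h is controlled on the ellipsoid only; cut off to the boundary it becomes a
    Borel function with the same cone integral.\<close>
  define f where "f a = indicator bdry a * h a" for a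
  have f [measurable]: "f \<in> borel_measurable borel"
    using borel_measurable_continuous_on_indicator[OF bdry_borel continuous_on_subset[OF h bdry_subset_cE]]
    by (simp add: f_def[abs_def])
  obtain B where B0: "\<And>x. x \<in> cE \<Longrightarrow> \<bar>h x\<bar> \<le> B"
    using compact_imp_bounded[OF compact_continuous_image[OF h compact_cE]] by (auto simp: bounded_iff)
  then have B: "\<bar>f a\<bar> \<le> B" if "a \<in> bdry" for a using that bdry_subset_cE by (auto simp: f_def)
  have fh: "cone_integral f = cone_integral h" by (rule cone_integral_cong) (simp add: f_def)
  define L where "L = cone_integral (\<lambda>_. 1)"
  have L0: "L \<ge> 0" unfolding L_def cone_integral_def by (rule integral_nonneg_AE) simp
  define T where "T k = (LINT x|lborel. indicator oE x * (q x ^ k * h x))" for k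
  define S where "S k = (LINT x|lborel. indicator punctured x * (q x ^ k * f (radial x)))" for k
  have S: "S k = ?n / (2 * k + ?n) * cone_integral h" for k
    unfolding S_def using cone_integral_quad_power[OF f B, of k] by (simp add: fh)
  have one: "(LINT x|lborel. indicator punctured x * q x ^ k) = ?n / (2 * k + ?n) * L" for k
    using cone_integral_quad_power[of "\<lambda>_. 1" 1 k] by (simp add: L_def)
  have punct_o: "AE x in lborel. indicator oE x = (indicator punctured x :: real)"
    using AE_lborel_singleton[of "0 :: real ^ 'n"]
    by eventually_elim (auto simp: indicator_def oE_def punctured_def quad_pos_iff)
  have hq: "continuous_on cE (\<lambda>x. q x ^ k * h x)" for k by (intro continuous_intros h)
  have Tint: "integrable lborel (\<lambda>x. indicator oE x * (q x ^ k * h x))" for k by (rule integrable_oE(1)[OF hq])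
  have Sint: "integrable lborel (\<lambda>x. indicator punctured x * (q x ^ k * f (radial x)))" for k
  proof (rule integrable_bounded_support[OF _ bounded_punctured, of _ "\<bar>B\<bar>"])
    fix x show "\<bar>indicator punctured x * (q x ^ k * f (radial x))\<bar> \<le> \<bar>B\<bar>"
    proof (cases "x \<in> punctured")
      case True
      then have "\<bar>q x ^ k\<bar> * \<bar>f (radial x)\<bar> \<le> 1 * \<bar>B\<bar>"
        using B[OF punctured_radial_bdry] by (intro mult_mono) (auto simp: punctured_def power_le_one intro: order_trans[OF _ abs_ge_self])
      then show ?thesis using True by (simp add: abs_mult)
    qed simp
  qed auto
  have oneint: "integrable lborel (\<lambda>x. indicator punctured x * q x ^ k)" for k
    by (rule integrable_bounded_support[OF _ bounded_punctured, of _ 1])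
       (auto simp: indicator_def punctured_def power_le_one)
  \<comment> \<open>This is \<open>radial_approximation\<close> integrated against q^k; the term C
    (1 - q) produces the difference of consecutive moments.\<close>
  have diff: "\<bar>T k - S k\<bar> \<le> e * (?n / (2 * k + ?n) * L) + C * ((?n / (2 * k + ?n) - ?n / (2 * Suc k + ?n)) * L)"
    if C: "\<And>x. x \<in> punctured \<Longrightarrow> \<bar>h x - h (radial x)\<bar> \<le> e + C * (1 - q x)" for k e C
  proof -
    let ?D = "\<lambda>x. indicator oE x * (q x ^ k * h x) - indicator punctured x * (q x ^ k * f (radial x))"
    let ?M = "\<lambda>x. e * (indicator punctured x * q x ^ k) + C * (indicator punctured x * q x ^ k - indicator punctured x * q x ^ Suc k)"
    have Mint: "integrable lborel ?M"
      by (intro Bochner_Integration.integrable_add integrable_mult_right Bochner_Integration.integrable_diff oneint)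
    have Dint: "integrable lborel ?D" by (intro Bochner_Integration.integrable_diff Tint Sint)
    have "\<bar>T k - S k\<bar> = \<bar>LINT x|lborel. ?D x\<bar>"
      unfolding T_def S_def using Tint Sint by simp
    also have "\<dots> \<le> (LINT x|lborel. \<bar>?D x\<bar>)" by (rule integral_abs_bound)
    also have "\<dots> \<le> (LINT x|lborel. ?M x)"
    proof (rule integral_mono_AE)
      show "AE x in lborel. \<bar>?D x\<bar> \<le> ?M x"
        using punct_o
      proof eventually_elim
        fix x assume eq: "indicator oE x = (indicator punctured x :: real)"
        show "\<bar>?D x\<bar> \<le> ?M x"
        proof (cases "x \<in> punctured")
          case True
          have "?D x = q x ^ k * (h x - h (radial x))"
            using True eq punctured_radial_bdry[OF True] by (simp add: f_def algebra_simps)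
          then have "\<bar>?D x\<bar> = q x ^ k * \<bar>h x - h (radial x)\<bar>" by (simp add: abs_mult)
          also have "\<dots> \<le> q x ^ k * (e + C * (1 - q x))" using C[OF True] by (intro mult_left_mono) auto
          also have "\<dots> = ?M x" using True by (simp add: algebra_simps)
          finally show ?thesis .
        qed (use eq in simp)
      qed
    qed (use Dint Mint in auto)
    also have "\<dots> = e * (?n / (2 * k + ?n) * L) + C * ((?n / (2 * k + ?n) - ?n / (2 * Suc k + ?n)) * L)"
    proof -
      let ?I = "\<lambda>k x. indicator punctured x * q x ^ k :: real"
      have "(LINT x|lborel. ?M x) = (LINT x|lborel. e * ?I k x) + (LINT x|lborel. C * (?I k x - ?I (Suc k) x))"
        by (intro Bochner_Integration.integral_add integrable_mult_right Bochner_Integration.integrable_diff oneint)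
      also have "\<dots> = e * (LINT x|lborel. ?I k x) + C * ((LINT x|lborel. ?I k x) - (LINT x|lborel. ?I (Suc k) x))"
        by (simp only: integral_mult_right_zero Bochner_Integration.integral_diff[OF oneint oneint])
      finally show ?thesis unfolding one by (simp only: left_diff_distrib of_nat_mult of_nat_numeral)
    qed
    finally show ?thesis by (simp only: of_nat_mult of_nat_numeral)
  qed
  have n: "?n \<ge> 1" using dim by simp
  have lim1: "(\<lambda>k. real (Suc k) * (T k - S k)) \<longlonglongrightarrow> 0"
  proof (rule LIMSEQ_I)
    fix r :: real assume r: "r > 0"
    \<comment> \<open>The summand 1 keeps the denominator of e positive, as only L \<ge> 0 is known
      here.\<close>
    define M where "M = ?n * L + 1"
    have M: "M > 0" "?n * L < M" using L0 n by (auto simp: M_def add_nonneg_pos)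
    define e where "e = r / (2 * M)"
    have e: "e > 0" using r M by (simp add: e_def)
    have eL: "e * (?n * L) < r / 2"
    proof -
      have "e * (?n * L) < e * M" using e M by (intro mult_strict_left_mono)
      also have "\<dots> = r / 2" using M by (simp add: e_def)
      finally show ?thesis .
    qed
    obtain C where C: "C \<ge> 0" "\<And>x. x \<in> punctured \<Longrightarrow> \<bar>h x - h (radial x)\<bar> \<le> e + C * (1 - q x)"
      using radial_approximation[OF h e] by blast
    obtain N :: nat where N: "C * (?n * L) / (r / 2) < real N" using reals_Archimedean2 by blast
    have "norm (real (Suc k) * (T k - S k) - 0) < r" if k: "k \<ge> N" for k
    proof -
      have den: "2 * real k + ?n > 0" "2 * real (Suc k) + ?n > 0" using n by linarith+
      have k1: "real (Suc k) = real k + 1" by simp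
      have a1: "real (Suc k) * (?n / (2 * k + ?n)) \<le> ?n"
        unfolding k1 of_nat_mult of_nat_numeral using shell_coefficient_bounds(1)[OF n, of "real k"] by simp
      have a2: "real (Suc k) * (?n / (2 * k + ?n) - ?n / (2 * Suc k + ?n)) \<le> ?n / (2 * k + ?n)"
        unfolding of_nat_mult of_nat_numeral k1 using shell_coefficient_bounds(2)[OF n, of "real k"] by simp
      have "norm (real (Suc k) * (T k - S k) - 0) = real (Suc k) * \<bar>T k - S k\<bar>" by (simp add: abs_mult)
      also have "\<dots> \<le> real (Suc k) * (e * (?n / (2 * k + ?n) * L) + C * ((?n / (2 * k + ?n) - ?n / (2 * Suc k + ?n)) * L))"
        using diff[OF C(2), of k] unfolding of_nat_mult of_nat_numeral by (rule mult_left_mono) simp_all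
      also have "\<dots> = e * L * (real (Suc k) * (?n / (2 * k + ?n))) + C * L * (real (Suc k) * (?n / (2 * k + ?n) - ?n / (2 * Suc k + ?n)))"
        by (simp only: algebra_simps)
      also have "\<dots> \<le> e * L * ?n + C * L * (?n / (2 * k + ?n))"
        using a1 a2 e L0 C(1) by (intro add_mono mult_left_mono) auto
      also have "C * L * (?n / (2 * k + ?n)) \<le> r / 2"
      proof -
        have "C * (?n * L) \<le> r / 2 * real N" using N r by (simp add: pos_divide_less_eq mult.commute)
        also have "\<dots> \<le> r / 2 * (2 * k + ?n)" using k r n by (intro mult_left_mono) auto
        finally show ?thesis using den by (simp add: pos_divide_le_eq mult.commute mult.left_commute)
      qed
      also have "e * L * ?n + r / 2 < r" using eL by (simp add: algebra_simps)
      finally show ?thesis by simp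
    qed
    then show "\<exists>no. \<forall>k\<ge>no. norm (real (Suc k) * (T k - S k) - 0) < r" by blast
  qed
  have lim2: "(\<lambda>k. real (Suc k) * S k) \<longlonglongrightarrow> ?n / 2 * cone_integral h"
  proof -
    have "(\<lambda>k. real (Suc k) * (?n / (2 * k + ?n))) \<longlonglongrightarrow> ?n / 2"
    proof -
      have "(\<lambda>k. (?n - 2) / real (Suc k)) \<longlonglongrightarrow> 0" by (rule LIMSEQ_Suc[OF lim_const_over_n])
      then have "(\<lambda>k. 2 + (?n - 2) / real (Suc k)) \<longlonglongrightarrow> 2 + 0" by (intro tendsto_add tendsto_const)
      then have "(\<lambda>k. ?n / (2 + (?n - 2) / real (Suc k))) \<longlonglongrightarrow> ?n / (2 + 0)" by (intro tendsto_divide tendsto_const) auto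
      \<comment> \<open>Numerator and denominator are divided by k + 1, which leaves a single null
        sequence in the denominator.\<close>
      moreover have "?n / (2 + (?n - 2) / real (Suc k)) = real (Suc k) * (?n / (2 * k + ?n))" for k
      proof -
        have "2 + (?n - 2) / real (Suc k) = (2 * k + ?n) / real (Suc k)" by (simp add: field_simps)
        then show ?thesis by simp
      qed
      ultimately show ?thesis by simp
    qed
    from tendsto_mult[OF this tendsto_const[of "cone_integral h"]] show ?thesis
      unfolding S by (simp add: mult.assoc)
  qed
  have "(\<lambda>k. real (Suc k) * (T k - S k) + real (Suc k) * S k) \<longlonglongrightarrow> 0 + ?n / 2 * cone_integral h"
    by (rule tendsto_add[OF lim1 lim2])
  then show ?thesis by (simp add: T_def algebra_simps)
qed

text \<open>The derivative of the cut-off factor 1 - q^(k+1) produces exactly the weights (k + 1)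
  q^k of \<open>shell_limit\<close>. The interior side converges by domination, and n / 2 is the
  limit of (k + 1) n / (2 k + n).\<close>

theorem divergence_theorem:
  assumes U: "open U" "cE \<subseteq> U"
    and deriv: "\<And>x. x \<in> U \<Longrightarrow> ((\<lambda>t. f (x + t *\<^sub>R v)) has_real_derivative g x) (at 0)"
    and cont: "continuous_on cE f" "continuous_on cE g"
  shows "(LINT x|lborel. indicator oE x * g x) = CARD('n) / 2 * cone_integral (\<lambda>x. (gradient q x \<bullet> v) * f x)"
proof -
  define h where "h x = (gradient q x \<bullet> v) * f x" for x
  have h: "continuous_on cE h" unfolding h_def gradient_quad by (intro continuous_intros cont)
  have qd: "((\<lambda>t. q (x + t *\<^sub>R v)) has_real_derivative gradient q x \<bullet> v) (at 0)" for x
  proof -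
    have "q (x + t *\<^sub>R v) = q x + t * (gradient q x \<bullet> v) + t\<^sup>2 * q v" for t
      by (simp add: quad_eq_inner gradient_quad linear_add[OF linear_weighted] linear_cmul[OF linear_weighted]
          inner_add_left inner_add_right inner_weighted_commute[of v \<beta> x] inner_commute[of "weighted \<beta> x"] power2_eq_square algebra_simps)
    then show ?thesis by (auto intro!: derivative_eq_intros)
  qed
  have eq: "(LINT x|lborel. indicator oE x * ((1 - q x ^ Suc k) * g x)) = real (Suc k) * (LINT x|lborel. indicator oE x * (q x ^ k * h x))" for k
  proof -
    define p where "p x = (1 - q x ^ Suc k) * f x" for x
    define g' where "g' x = (1 - q x ^ Suc k) * g x - real (Suc k) * (q x ^ k * h x)" for x
    have "(LINT x|lborel. indicator oE x * g' x) = 0"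
    proof (rule integral_directional_derivative_zero[OF U, where p = p and v = v])
      show "continuous_on cE p" unfolding p_def by (intro continuous_intros cont)
      show "continuous_on cE g'" unfolding g'_def by (intro continuous_intros cont h)
      show "p x = 0" if "x \<in> bdry" for x using that by (simp add: p_def ellipsoid_boundary_def)
      fix x assume x: "x \<in> U"
      have "((\<lambda>t. q (x + t *\<^sub>R v) ^ Suc k) has_real_derivative real (Suc k) * (gradient q x \<bullet> v * q x ^ k)) (at 0)"
        using DERIV_power[OF qd[of x], of "Suc k"] by simp
      then have "((\<lambda>t. 1 - q (x + t *\<^sub>R v) ^ Suc k) has_real_derivative 0 - real (Suc k) * (gradient q x \<bullet> v * q x ^ k)) (at 0)"
        by (intro DERIV_diff DERIV_const)
      from DERIV_mult[OF this deriv[OF x]]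
      show "((\<lambda>t. p (x + t *\<^sub>R v)) has_real_derivative g' x) (at 0)"
        unfolding p_def by (rule DERIV_cong) (simp add: g'_def h_def algebra_simps)
    qed
    moreover have "(LINT x|lborel. indicator oE x * g' x)
      = (LINT x|lborel. indicator oE x * ((1 - q x ^ Suc k) * g x) - real (Suc k) * (indicator oE x * (q x ^ k * h x)))"
      by (intro Bochner_Integration.integral_cong) (auto simp: g'_def algebra_simps)
    also have "\<dots> = (LINT x|lborel. indicator oE x * ((1 - q x ^ Suc k) * g x)) - real (Suc k) * (LINT x|lborel. indicator oE x * (q x ^ k * h x))"
    proof -
      have "integrable lborel (\<lambda>x. indicator oE x * ((1 - q x ^ Suc k) * g x))"
        by (intro integrable_oE continuous_intros cont)
      moreover have "integrable lborel (\<lambda>x. real (Suc k) * (indicator oE x * (q x ^ k * h x)))"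
        by (intro integrable_mult_right integrable_oE continuous_intros h)
      ultimately show ?thesis by (simp only: Bochner_Integration.integral_diff integral_mult_right_zero)
    qed
    finally show ?thesis by simp
  qed
  have gint: "integrable lborel (\<lambda>x. indicator oE x * g x)" by (rule integrable_oE(1)[OF cont(2)])
  have "(\<lambda>k. LINT x|lborel. indicator oE x * ((1 - q x ^ Suc k) * g x)) \<longlonglongrightarrow> (LINT x|lborel. indicator oE x * g x)"
  proof (rule integral_dominated_convergence[where w = "\<lambda>x. \<bar>indicator oE x * g x\<bar>"])
    show "(\<lambda>x. indicator oE x * ((1 - q x ^ Suc k) * g x)) \<in> borel_measurable lborel" for k
      using integrable_oE(2)[of "\<lambda>x. (1 - q x ^ Suc k) * g x"] by (simp add: continuous_intros cont)
    show "AE x in lborel. (\<lambda>k. indicator oE x * ((1 - q x ^ Suc k) * g x)) \<longlonglongrightarrow> indicator oE x * g x"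
    proof (rule AE_I2)
      fix x
      show "(\<lambda>k. indicator oE x * ((1 - q x ^ Suc k) * g x)) \<longlonglongrightarrow> indicator oE x * g x"
      proof (cases "x \<in> oE")
        case True
        then have "(\<lambda>k. q x ^ k) \<longlonglongrightarrow> 0" by (intro LIMSEQ_power_zero) (simp add: oE_def)
        then have "(\<lambda>k. q x ^ Suc k) \<longlonglongrightarrow> 0" by (rule LIMSEQ_Suc)
        then have "(\<lambda>k. (1 - q x ^ Suc k) * g x) \<longlonglongrightarrow> (1 - 0) * g x" by (intro tendsto_intros)
        then show ?thesis using True by simp
      qed simp
    qed
    show "AE x in lborel. norm (indicator oE x * ((1 - q x ^ Suc k) * g x)) \<le> \<bar>indicator oE x * g x\<bar>" for k
    proof (rule AE_I2)
      fix x
      show "norm (indicator oE x * ((1 - q x ^ Suc k) * g x)) \<le> \<bar>indicator oE x * g x\<bar>"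
      proof (cases "x \<in> oE")
        case True
        then have "0 \<le> q x ^ Suc k" "q x ^ Suc k \<le> 1" by (auto simp: oE_def simp del: power_Suc intro!: power_le_one)
        then have "\<bar>1 - q x ^ Suc k\<bar> * \<bar>g x\<bar> \<le> 1 * \<bar>g x\<bar>" by (intro mult_right_mono) auto
        then show ?thesis using True by (simp add: abs_mult del: power_Suc)
      qed simp
    qed
  qed (use gint integrable_oE(2)[OF cont(2)] in auto)
  then have "(\<lambda>k. real (Suc k) * (LINT x|lborel. indicator oE x * (q x ^ k * h x))) \<longlonglongrightarrow> (LINT x|lborel. indicator oE x * g x)"
    unfolding eq .
  then have "(LINT x|lborel. indicator oE x * g x) = CARD('n) / 2 * cone_integral h"
    using LIMSEQ_unique shell_limit[OF h] by blast
  then show ?thesis by (simp add: h_def[abs_def])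
qed

end

subsection \<open>Polynomials\<close>

lemma partial_eqI: "(f has_derivative f') (at x) \<Longrightarrow> partial j f x = f' (axis j 1)"
  by (simp add: partial_def frechet_derivative_at[symmetric])

lemma partial_directional:
  assumes "f differentiable (at x)"
  shows "((\<lambda>t. f (x + t *\<^sub>R axis j 1)) has_real_derivative partial j f x) (at 0)"
proof -
  obtain f' where f': "(f has_derivative f') (at x)" using assms by (auto simp: differentiable_def)
  have "((\<lambda>t::real. x + t *\<^sub>R axis j 1) has_derivative (\<lambda>t. t *\<^sub>R axis j 1)) (at 0)"
    by (auto intro!: derivative_eq_intros)
  from has_derivative_compose[OF this, of f f'] f'
  have "((\<lambda>t. f (x + t *\<^sub>R axis j 1)) has_derivative (\<lambda>t. f' (t *\<^sub>R axis j 1))) (at 0)" by simp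
  moreover have "(\<lambda>t. f' (t *\<^sub>R axis j 1)) = (*) (partial j f x)"
    using linear_cmul[OF has_derivative_linear[OF f']] by (auto simp: partial_eqI[OF f'])
  ultimately show ?thesis by (simp add: has_field_derivative_def)
qed

lemma partial_add:
  assumes "f differentiable (at x)" "g differentiable (at x)"
  shows "partial j (\<lambda>x. f x + g x) x = partial j f x + partial j g x"
proof -
  obtain f' g' where d: "(f has_derivative f') (at x)" "(g has_derivative g') (at x)"
    using assms by (auto simp: differentiable_def)
  show ?thesis by (simp add: partial_eqI[OF has_derivative_add[OF d]] d[THEN partial_eqI])
qed

lemma partial_mult:
  assumes "f differentiable (at x)" "g differentiable (at x)"
  shows "partial j (\<lambda>x. f x * g x) x = f x * partial j g x + partial j f x * g x"
proof -
  obtain f' g' where d: "(f has_derivative f') (at x)" "(g has_derivative g') (at x)"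
    using assms by (auto simp: differentiable_def)
  show ?thesis by (simp add: partial_eqI[OF has_derivative_mult[OF d]] d[THEN partial_eqI])
qed

lemma partial_const [simp]: "partial j (\<lambda>x. c) x = 0"
  by (simp add: partial_eqI[OF has_derivative_const])

lemma real_polynomial_function_derivative:
  assumes "real_polynomial_function f"
  shows "\<exists>f'. (\<forall>x. (f has_derivative f' x) (at x)) \<and> (\<forall>v. real_polynomial_function (\<lambda>x. f' x v))"
  using assms
proof induction
  case (linear f)
  then show ?case
    by (intro exI[of _ "\<lambda>x. f"]) (auto intro: bounded_linear_imp_has_derivative)
next
  case (const c)
  show ?case by (intro exI[of _ "\<lambda>x v. 0"]) auto
next
  case (add f g)
  then obtain f' g' where "\<And>x. (f has_derivative f' x) (at x)" "\<And>v. real_polynomial_function (\<lambda>x. f' x v)"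
    "\<And>x. (g has_derivative g' x) (at x)" "\<And>v. real_polynomial_function (\<lambda>x. g' x v)" by blast
  then show ?case
    by (intro exI[of _ "\<lambda>x v. f' x v + g' x v"]) (auto intro: has_derivative_add)
next
  case (mult f g)
  then obtain f' g' where "\<And>x. (f has_derivative f' x) (at x)" "\<And>v. real_polynomial_function (\<lambda>x. f' x v)"
    "\<And>x. (g has_derivative g' x) (at x)" "\<And>v. real_polynomial_function (\<lambda>x. g' x v)" by blast
  then show ?case
    by (intro exI[of _ "\<lambda>x v. f x * g' x v + f' x v * g x"])
       (auto intro!: has_derivative_mult real_polynomial_function.intros(3)[OF real_polynomial_function.intros(4) real_polynomial_function.intros(4)] mult.hyps)
qed

lemma real_polynomial_function_differentiable:
  "real_polynomial_function f \<Longrightarrow> f differentiable (at x)"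
  using real_polynomial_function_derivative[of f] unfolding differentiable_def by blast

lemma real_polynomial_function_continuous_on:
  "real_polynomial_function f \<Longrightarrow> continuous_on S f"
  by (simp add: continuous_at_imp_continuous_on differentiable_imp_continuous_within real_polynomial_function_differentiable)

lemma real_polynomial_function_partial [intro]:
  assumes "real_polynomial_function f"
  shows "real_polynomial_function (partial j f)"
proof -
  obtain f' where f': "\<And>x. (f has_derivative f' x) (at x)" "\<And>v. real_polynomial_function (\<lambda>x. f' x v)"
    using real_polynomial_function_derivative[OF assms] by blast
  have "partial j f = (\<lambda>x. f' x (axis j 1))" by (rule ext) (rule partial_eqI[OF f'(1)])
  then show ?thesis using f'(2) by simp
qed

lemma real_polynomial_function_C2: "real_polynomial_function f \<Longrightarrow> C2_on U f"
  unfolding C2_on_def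
  by (intro conjI allI ballI real_polynomial_function_differentiable real_polynomial_function_continuous_on
      real_polynomial_function_partial)

text \<open>On the line through 0 and x the function is a polynomial in one variable with infinitely
  many zeros near 0, so it also vanishes at parameter 1.\<close>

lemma real_polynomial_function_zero_open:
  fixes f :: "'a::real_normed_vector \<Rightarrow> real"
  assumes f: "real_polynomial_function f" and S: "open S" "0 \<in> S" and z: "\<And>x. x \<in> S \<Longrightarrow> f x = 0"
  shows "f x = 0"
proof -
  have "polynomial_function (\<lambda>t::real. t *\<^sub>R x)"
    by (rule polynomial_function_bounded_linear) (rule bounded_linear_scaleR_left)
  then have "real_polynomial_function (f \<circ> (\<lambda>t::real. t *\<^sub>R x))"
    by (rule real_polynomial_function_compose) (rule f)
  then obtain a n where an: "\<And>t. f (t *\<^sub>R x) = (\<Sum>i\<le>n. a i * t ^ i)"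
    unfolding real_polynomial_function_iff_sum by (auto simp: o_def fun_eq_iff)
  obtain e where e: "e > 0" "ball 0 e \<subseteq> S" using S open_contains_ball by metis
  define r where "r = e / (norm x + 1)"
  have n1: "norm x + 1 > 0" by (simp add: add_nonneg_pos)
  have r: "r > 0" using e n1 by (simp add: r_def)
  have zero: "(\<Sum>i\<le>n. a i * t ^ i) = 0" if t: "0 < t" "t < r" for t
  proof -
    have "t * norm x \<le> t * (norm x + 1)" using t by simp
    also have "\<dots> < r * (norm x + 1)" using t n1 by (intro mult_strict_right_mono)
    also have "\<dots> = e" using n1 by (simp add: r_def)
    finally have "t *\<^sub>R x \<in> S" using e t by auto
    then show ?thesis using z an by metis
  qed
  have "infinite {0<..<r}" using r by simp
  moreover have "{0<..<r} \<subseteq> {t. (\<Sum>i\<le>n. a i * t ^ i) = 0}" using zero by auto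
  ultimately have "\<not> finite {t. (\<Sum>i\<le>n. a i * t ^ i) = 0}" using finite_subset by blast
  then have "\<forall>i\<le>n. a i = 0" using polyfun_finite_roots[of a n] by blast
  then show ?thesis using an[of 1] by simp
qed

section \<open>Monomials and degree bounds\<close>

definition monomial :: "('n::finite \<Rightarrow> nat) \<Rightarrow> real ^ 'n \<Rightarrow> real" where
  "monomial \<alpha> x = (\<Prod>i\<in>UNIV. (x $ i) ^ \<alpha> i)"

definition multiindices :: "nat \<Rightarrow> ('n::finite \<Rightarrow> nat) set" where
  "multiindices d = {\<alpha>. (\<Sum>i\<in>UNIV. \<alpha> i) < d}"

text \<open>The strict bound accommodates the zero polynomial at d = 0, so that truncated
  subtraction in d - 1 treats degrees that would drop below zero correctly.\<close>

definition poly_lt :: "nat \<Rightarrow> (real ^ 'n \<Rightarrow> real) \<Rightarrow> bool" where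
  "poly_lt d f \<longleftrightarrow> (\<exists>c. \<forall>x. f x = (\<Sum>\<alpha>\<in>multiindices d. c \<alpha> * monomial \<alpha> x))"

lemma degree_le_iff_poly_lt: "degree_le f d \<longleftrightarrow> poly_lt (Suc d) f"
  by (simp add: degree_le_def poly_lt_def multiindices_def monomial_def less_Suc_eq_le)

lemma finite_multiindices [simp]: "finite (multiindices d :: ('n::finite \<Rightarrow> nat) set)"
proof (rule finite_subset)
  show "multiindices d \<subseteq> PiE (UNIV :: 'n set) (\<lambda>_. {..d})"
  proof
    fix \<alpha> :: "'n \<Rightarrow> nat" assume "\<alpha> \<in> multiindices d"
    then have s: "(\<Sum>i\<in>UNIV. \<alpha> i) < d" by (simp add: multiindices_def)
    have "\<alpha> i \<le> d" for i using member_le_sum[of i UNIV \<alpha>] s by simp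
    then show "\<alpha> \<in> PiE UNIV (\<lambda>_. {..d})" by auto
  qed
qed (simp add: finite_PiE)

text \<open>The exponents \<open>\<gamma> k\<close> may coincide, so terms are regrouped. Terms with
  coefficient 0 are exempt from the degree bound: differentiation produces them from monomials that
  do not involve the variable.\<close>

lemma poly_ltI_sum:
  fixes \<gamma> :: "'k \<Rightarrow> 'n::finite \<Rightarrow> nat"
  assumes K: "finite K" and deg: "\<And>k. k \<in> K \<Longrightarrow> a k \<noteq> 0 \<Longrightarrow> (\<Sum>i\<in>UNIV. \<gamma> k i) < d"
    and f: "\<And>x. f x = (\<Sum>k\<in>K. a k * monomial (\<gamma> k) x)"
  shows "poly_lt d f"
  unfolding poly_lt_def
proof (intro exI allI)
  fix x
  let ?K = "{k\<in>K. a k \<noteq> 0}"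
  have "f x = (\<Sum>k\<in>?K. a k * monomial (\<gamma> k) x)"
    unfolding f by (rule sum.mono_neutral_right) (use K in auto)
  also have "\<dots> = (\<Sum>\<alpha>\<in>multiindices d. \<Sum>k\<in>{k\<in>?K. \<gamma> k = \<alpha>}. a k * monomial (\<gamma> k) x)"
    by (rule sum.group[symmetric]) (use K deg finite_multiindices[of d] in \<open>auto simp: multiindices_def\<close>)
  also have "\<dots> = (\<Sum>\<alpha>\<in>multiindices d. (\<Sum>k\<in>{k\<in>?K. \<gamma> k = \<alpha>}. a k) * monomial \<alpha> x)"
    by (intro sum.cong refl) (simp add: sum_distrib_right)
  finally show "f x = (\<Sum>\<alpha>\<in>multiindices d. (\<Sum>k\<in>{k\<in>?K. \<gamma> k = \<alpha>}. a k) * monomial \<alpha> x)" .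
qed

lemma poly_lt_mono: "poly_lt d f \<Longrightarrow> d \<le> e \<Longrightarrow> poly_lt e f"
proof -
  assume de: "d \<le> e" and "poly_lt d f"
  then obtain c where c: "\<And>x. f x = (\<Sum>\<alpha>\<in>multiindices d. c \<alpha> * monomial \<alpha> x)" by (auto simp: poly_lt_def)
  show "poly_lt e f"
    by (rule poly_ltI_sum[where \<gamma> = "\<lambda>\<alpha>. \<alpha>", OF finite_multiindices _ c]) (use de in \<open>auto simp: multiindices_def\<close>)
qed

lemma poly_lt_0: "poly_lt 0 f \<longleftrightarrow> f = (\<lambda>x. 0)"
  by (auto simp: poly_lt_def multiindices_def)

lemma poly_lt_monomial: "(\<Sum>i\<in>UNIV. \<alpha> i) < d \<Longrightarrow> poly_lt d (monomial \<alpha>)"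
  by (rule poly_ltI_sum[of "{()}" "\<lambda>_. 1" "\<lambda>_. \<alpha>"]) auto

lemma poly_lt_zero [simp]: "poly_lt d (\<lambda>x. 0)"
  by (rule poly_ltI_sum[of "{}" _ undefined]) auto

lemma poly_lt_add:
  assumes "poly_lt d f" "poly_lt d g"
  shows "poly_lt d (\<lambda>x. f x + g x)"
proof -
  obtain c c' where "\<And>x. f x = (\<Sum>\<alpha>\<in>multiindices d. c \<alpha> * monomial \<alpha> x)" "\<And>x. g x = (\<Sum>\<alpha>\<in>multiindices d. c' \<alpha> * monomial \<alpha> x)"
    using assms by (auto simp: poly_lt_def)
  then show ?thesis unfolding poly_lt_def
    by (intro exI[of _ "\<lambda>\<alpha>. c \<alpha> + c' \<alpha>"]) (simp add: sum.distrib distrib_right)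
qed

lemma poly_lt_cmult:
  assumes "poly_lt d f"
  shows "poly_lt d (\<lambda>x. r * f x)"
proof -
  obtain c where "\<And>x. f x = (\<Sum>\<alpha>\<in>multiindices d. c \<alpha> * monomial \<alpha> x)"
    using assms by (auto simp: poly_lt_def)
  then show ?thesis unfolding poly_lt_def
    by (intro exI[of _ "\<lambda>\<alpha>. r * c \<alpha>"]) (simp add: sum_distrib_left mult.assoc)
qed

lemma poly_lt_sum: "finite I \<Longrightarrow> (\<And>i. i \<in> I \<Longrightarrow> poly_lt d (f i)) \<Longrightarrow> poly_lt d (\<lambda>x. \<Sum>i\<in>I. f i x)"
  by (induction I rule: finite_induct) (auto intro: poly_lt_add)

lemma monomial_mult: "monomial \<alpha> x * monomial \<gamma> x = monomial (\<lambda>i. \<alpha> i + \<gamma> i) x"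
  by (simp add: monomial_def prod.distrib power_add)

text \<open>The asymmetry is the bookkeeping of strict bounds: degree at most d times degree below e
  has degree below d + e.\<close>

lemma poly_lt_mult:
  fixes f g :: "real ^ 'n \<Rightarrow> real"
  assumes "poly_lt (Suc d) f" "poly_lt e g"
  shows "poly_lt (d + e) (\<lambda>x. f x * g x)"
proof -
  obtain c c' where c: "\<And>x. f x = (\<Sum>\<alpha>\<in>multiindices (Suc d). c \<alpha> * monomial \<alpha> x)" "\<And>x. g x = (\<Sum>\<alpha>\<in>multiindices e. c' \<alpha> * monomial \<alpha> x)"
    using assms by (auto simp: poly_lt_def)
  show ?thesis
  proof (rule poly_ltI_sum)
    show "finite (multiindices (Suc d) \<times> multiindices e :: (('n \<Rightarrow> nat) \<times> ('n \<Rightarrow> nat)) set)" by simp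
    fix x
    show "f x * g x = (\<Sum>k\<in>multiindices (Suc d) \<times> multiindices e. (c (fst k) * c' (snd k)) * monomial (\<lambda>i. fst k i + snd k i) x)"
      unfolding c sum_product sum.cartesian_product monomial_mult[symmetric]
      by (intro sum.cong) (auto simp: algebra_simps)
  next
    fix k :: "('n \<Rightarrow> nat) \<times> ('n \<Rightarrow> nat)"
    assume "k \<in> multiindices (Suc d) \<times> multiindices e"
    then show "(\<Sum>i\<in>UNIV. fst k i + snd k i) < d + e"
      by (auto simp: multiindices_def sum.distrib)
  qed
qed

text \<open>The truncated exponent at \<open>\<alpha> i\<close> = 0 is harmless, since its
  coefficient is 0.\<close>

lemma monomial_has_derivative:
  "(monomial \<alpha> has_derivative (\<lambda>h. \<Sum>i\<in>UNIV. (real (\<alpha> i) * h $ i) * monomial (\<alpha>(i := \<alpha> i - 1)) x)) (at x)"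
proof -
  have "((\<lambda>x. \<Prod>i\<in>UNIV. (x $ i) ^ \<alpha> i) has_derivative
      (\<lambda>h. \<Sum>i\<in>UNIV. (real (\<alpha> i) * (h $ i) * (x $ i) ^ (\<alpha> i - 1)) * (\<Prod>j\<in>UNIV - {i}. (x $ j) ^ \<alpha> j))) (at x)"
    by (rule has_derivative_prod)
       (auto intro!: derivative_eq_intros bounded_linear_imp_has_derivative bounded_linear_vec_nth simp: algebra_simps)
  moreover have "(real (\<alpha> i) * (h $ i) * (x $ i) ^ (\<alpha> i - 1)) * (\<Prod>j\<in>UNIV - {i}. (x $ j) ^ \<alpha> j)
    = (real (\<alpha> i) * h $ i) * monomial (\<alpha>(i := \<alpha> i - 1)) x" for h i
    unfolding monomial_def by (subst prod.remove[of UNIV i]) (auto intro!: prod.cong)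
  moreover have "(\<lambda>x. \<Prod>i\<in>UNIV. (x $ i) ^ \<alpha> i) = monomial \<alpha>" by (simp add: monomial_def[abs_def])
  ultimately show ?thesis by (simp only:)
qed

lemma partial_monomial: "partial j (monomial \<alpha>) x = real (\<alpha> j) * monomial (\<alpha>(j := \<alpha> j - 1)) x"
proof -
  let ?M = "\<lambda>i. monomial (\<alpha>(i := \<alpha> i - 1)) x"
  have "partial j (monomial \<alpha>) x = (\<Sum>i\<in>UNIV. (real (\<alpha> i) * axis j 1 $ i) * ?M i)"
    by (rule partial_eqI[OF monomial_has_derivative])
  also have "\<dots> = (\<Sum>i\<in>UNIV. if i = j then real (\<alpha> j) * ?M j else 0)"
    by (intro sum.cong) (auto simp: axis_def)
  finally show ?thesis by simp
qed

lemma real_polynomial_function_monomial [intro]: "real_polynomial_function (monomial \<alpha>)"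
  unfolding monomial_def
  by (intro real_polynomial_function_prod real_polynomial_function_power real_polynomial_function.intros(1) bounded_linear_vec_nth) auto

lemma poly_lt_imp_real_polynomial_function:
  assumes "poly_lt d f"
  shows "real_polynomial_function f"
proof -
  obtain c where "\<And>x. f x = (\<Sum>\<alpha>\<in>multiindices d. c \<alpha> * monomial \<alpha> x)"
    using assms by (auto simp: poly_lt_def)
  then have f: "f = (\<lambda>x. \<Sum>\<alpha>\<in>multiindices d. c \<alpha> * monomial \<alpha> x)" by auto
  show ?thesis unfolding f by (intro real_polynomial_function_sum real_polynomial_function.intros(4) real_polynomial_function.intros(2)) auto
qed

lemma partial_sum:
  assumes "finite I" "\<And>i. i \<in> I \<Longrightarrow> f i differentiable (at x)"
  shows "partial j (\<lambda>x. \<Sum>i\<in>I. f i x) x = (\<Sum>i\<in>I. partial j (f i) x)"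
proof -
  have "((\<lambda>x. \<Sum>i\<in>I. f i x) has_derivative (\<lambda>h. \<Sum>i\<in>I. frechet_derivative (f i) (at x) h)) (at x)"
    using assms by (intro has_derivative_sum) (simp add: frechet_derivative_works)
  from partial_eqI[OF this] show ?thesis by (simp add: partial_def)
qed

lemma partial_cmult: "f differentiable (at x) \<Longrightarrow> partial j (\<lambda>x. c * f x) x = c * partial j f x"
  using partial_mult[of "\<lambda>_. c" x f j] by simp

lemma poly_lt_partial:
  fixes f :: "real ^ 'n \<Rightarrow> real"
  assumes "poly_lt d f"
  shows "poly_lt (d - 1) (partial j f)"
proof -
  obtain c where "\<And>x. f x = (\<Sum>\<alpha>\<in>multiindices d. c \<alpha> * monomial \<alpha> x)"
    using assms by (auto simp: poly_lt_def)
  then have f: "f = (\<lambda>x. \<Sum>\<alpha>\<in>multiindices d. c \<alpha> * monomial \<alpha> x)" by auto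
  have dm: "monomial \<alpha> differentiable (at x)" for \<alpha> :: "'n \<Rightarrow> nat" and x
    by (rule real_polynomial_function_differentiable) auto
  have "partial j f x = (\<Sum>\<alpha>\<in>multiindices d. c \<alpha> * (real (\<alpha> j) * monomial (\<alpha>(j := \<alpha> j - 1)) x))" for x
    unfolding f by (subst partial_sum) (auto simp: partial_cmult[OF dm] partial_monomial intro: dm)
  then show ?thesis
  proof (intro poly_ltI_sum[where K = "multiindices d" and \<gamma> = "\<lambda>\<alpha>. \<alpha>(j := \<alpha> j - 1)" and a = "\<lambda>\<alpha>. c \<alpha> * real (\<alpha> j)"])
    fix \<alpha> :: "'n \<Rightarrow> nat" assume \<alpha>: "\<alpha> \<in> multiindices d" "c \<alpha> * real (\<alpha> j) \<noteq> 0"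
    have "(\<Sum>i\<in>UNIV. \<alpha> i) = \<alpha> j + (\<Sum>i\<in>UNIV - {j}. \<alpha> i)" by (rule sum.remove) auto
    moreover have "(\<Sum>i\<in>UNIV. (\<alpha>(j := \<alpha> j - 1)) i) = (\<alpha> j - 1) + (\<Sum>i\<in>UNIV - {j}. \<alpha> i)"
      by (subst sum.remove[of _ j]) auto
    ultimately show "(\<Sum>i\<in>UNIV. (\<alpha>(j := \<alpha> j - 1)) i) < d - 1"
      using \<alpha> by (auto simp: multiindices_def)
  qed (auto simp: mult.assoc)
qed

lemma poly_lt_const: "poly_lt (Suc d) (\<lambda>x. c)"
  by (rule poly_ltI_sum[of "{()}" "\<lambda>_. c" "\<lambda>_ _. 0"]) (auto simp: monomial_def)

lemma monomial_single: "monomial (\<lambda>j. if j = i then k else 0) x = (x $ i) ^ k"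
  unfolding monomial_def by (subst prod.remove[of UNIV i]) auto

lemma poly_lt_coordinate_power: "k < d \<Longrightarrow> poly_lt d (\<lambda>x. (x $ i) ^ k)"
  using poly_lt_monomial[of "\<lambda>j. if j = i then k else 0" d] by (simp add: monomial_single[abs_def] sum.delta)

lemma real_polynomial_function_imp_poly_lt:
  fixes f :: "real ^ 'n \<Rightarrow> real"
  assumes "real_polynomial_function f"
  shows "\<exists>d. poly_lt (Suc d) f"
  using assms
proof induction
  case (linear f)
  have fx: "f x = (\<Sum>i\<in>UNIV. f (axis i 1) * (x $ i) ^ 1)" for x
  proof -
    have "x = (\<Sum>i\<in>UNIV. x $ i *\<^sub>R axis i 1)"
      by (simp add: vec_eq_iff axis_def if_distrib cong: if_cong)
    then have "f x = f (\<Sum>i\<in>UNIV. x $ i *\<^sub>R axis i 1)" by simp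
    then show ?thesis using linear by (simp add: linear_conv_bounded_linear[symmetric] linear_sum linear_cmul mult.commute)
  qed
  have f_eq: "f = (\<lambda>x. \<Sum>i\<in>UNIV. f (axis i 1) * (x $ i) ^ 1)" by (rule ext) (rule fx)
  have "poly_lt (Suc 1) f"
    by (subst f_eq) (intro poly_lt_sum poly_lt_cmult poly_lt_coordinate_power, simp_all)
  then show ?case by blast
next
  case (const c)
  then show ?case using poly_lt_const by blast
next
  case (add f g)
  then obtain d e where "poly_lt (Suc d) f" "poly_lt (Suc e) g" by blast
  then show ?case
    by (intro exI[of _ "max d e"] poly_lt_add) (auto elim!: poly_lt_mono)
next
  case (mult f g)
  then obtain d e where "poly_lt (Suc d) f" "poly_lt (Suc e) g" by blast
  then have "poly_lt (d + Suc e) (\<lambda>x. f x * g x)" by (rule poly_lt_mult)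
  then show ?case by (intro exI[of _ "d + e"]) simp
qed

subsection \<open>The Neumann problem for polynomials\<close>

text \<open>T is linear on the span only: it will be built from partial derivatives, which are
  additive only where the functions are differentiable. T maps a basis to an independent family of
  the same size, which must span again.\<close>

lemma (in vector_space) injective_on_span_imp_surjective:
  assumes S: "finite S"
    and add: "\<And>x y. x \<in> span S \<Longrightarrow> y \<in> span S \<Longrightarrow> T (x + y) = T x + T y"
    and scale: "\<And>r x. x \<in> span S \<Longrightarrow> T (scale r x) = scale r (T x)"
    and into: "\<And>x. x \<in> span S \<Longrightarrow> T x \<in> span S"
    and inj: "\<And>x. x \<in> span S \<Longrightarrow> T x = 0 \<Longrightarrow> x = 0"
    and y: "y \<in> span S"
  shows "\<exists>x\<in>span S. T x = y"
proof -
  have T0: "T 0 = 0" using scale[of 0 0] span_zero by simp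
  obtain B where B: "B \<subseteq> S" "independent B" "S \<subseteq> span B" using maximal_independent_subset by blast
  have fB: "finite B" using B S finite_subset by blast
  have BS: "span B = span S"
    using span_mono[OF B(1)] span_minimal[OF B(3) subspace_span] by (rule antisym)
  have Tsum: "(\<Sum>b\<in>C. scale (u b) b) \<in> span S \<and> T (\<Sum>b\<in>C. scale (u b) b) = (\<Sum>b\<in>C. scale (u b) (T b))"
    if "C \<subseteq> B" for C u
    using finite_subset[OF that fB] that
  proof (induction C rule: finite_induct)
    case (insert b C)
    have "b \<in> span S" using insert.prems B span_base by blast
    then show ?case using insert by (simp add: add scale span_add span_scale)
  qed (simp add: T0 span_zero)
  have injB: "inj_on T B"
  proof (rule inj_onI)
    fix a b assume ab: "a \<in> B" "b \<in> B" "T a = T b"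
    have sp: "a \<in> span S" "scale (-1) b \<in> span S" using ab B span_base span_scale by blast+
    have "b \<in> span S" using ab B span_base by blast
    then have "T (a + scale (-1) b) = 0" using ab(3) by (simp only: add[OF sp] scale) simp
    then have "a + scale (-1) b = 0" using inj[OF span_add[OF sp]] by simp
    then show "a = b" by simp
  qed
  have ind: "independent (T ` B)"
    unfolding dependent_finite[OF finite_imageI[OF fB]]
  proof (intro notI, elim exE conjE bexE)
    fix u v assume v: "v \<in> T ` B" "u v \<noteq> 0" and z: "(\<Sum>v\<in>T ` B. scale (u v) v) = 0"
    have "(\<Sum>b\<in>B. scale (u (T b)) (T b)) = 0" using z by (simp add: sum.reindex[OF injB])
    then have "(\<Sum>b\<in>B. scale (u (T b)) b) = 0"
      using Tsum[OF order_refl, of "\<lambda>b. u (T b)"] inj by metis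
    then have "u (T b) = 0" if "b \<in> B" for b
      using independentD[OF B(2) fB order_refl, of "\<lambda>b. u (T b)"] that by simp
    then show False using v by blast
  qed
  have sub: "T ` B \<subseteq> span B" using into B BS span_base by blast
  have "span B \<subseteq> span (T ` B)"
  proof
    fix x assume x: "x \<in> span B"
    show "x \<in> span (T ` B)"
    proof (rule ccontr)
      \<comment> \<open>A vector outside the span of the image of \<open>B\<close> could be adjoined
        to that image, giving card B + 1 independent vectors in the span of
        \<open>B\<close>.\<close>
      assume nx: "x \<notin> span (T ` B)"
      then have "independent (insert x (T ` B))" using ind by (rule independent_insertI)
      moreover have "insert x (T ` B) \<subseteq> span B" using x sub by blast
      ultimately have "card (insert x (T ` B)) \<le> card B"
        using independent_span_bound[OF fB] by blast
      moreover have "x \<notin> T ` B" using nx span_base by blast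
      then have "card (insert x (T ` B)) = Suc (card B)"
        using fB injB by (simp add: card_image)
      ultimately show False by simp
    qed
  qed
  then have "y \<in> span (T ` B)" using y BS by blast
  then obtain u where "y = (\<Sum>v\<in>T ` B. scale (u v) v)"
    using span_finite[OF finite_imageI[OF fB]] by auto
  then have "y = (\<Sum>b\<in>B. scale (u (T b)) (T b))" by (simp add: sum.reindex[OF injB])
  then show ?thesis using Tsum[OF order_refl, of "\<lambda>b. u (T b)"] by metis
qed

global_interpretation fun_space: vector_space "\<lambda>(c::real) (f :: 'a \<Rightarrow> real). (\<lambda>x. c * f x)"
  by unfold_locales (auto simp: fun_eq_iff algebra_simps)

section \<open>Cone integrals of fluxes and uniqueness for the Neumann problem\<close>

context ellipsoid
begin

text \<open>F is continuous on the closed ellipsoid only; cutting it off to the boundary makes it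
  Borel and keeps its values along \<open>radial\<close>.\<close>

lemma radial_continuous_integrable:
  fixes F :: "real ^ 'n \<Rightarrow> real"
  assumes F: "continuous_on cE F"
  shows "integrable lborel (\<lambda>x. indicator punctured x * F (radial x))"
proof -
  define f where "f a = indicator bdry a * F a" for a
  have f: "f \<in> borel_measurable borel"
    using borel_measurable_continuous_on_indicator[OF bdry_borel continuous_on_subset[OF F bdry_subset_cE]]
    by (simp add: f_def[abs_def])
  obtain B where "\<And>x. x \<in> cE \<Longrightarrow> \<bar>F x\<bar> \<le> B"
    using compact_imp_bounded[OF compact_continuous_image[OF F compact_cE]] by (auto simp: bounded_iff)
  then have "integrable lborel (\<lambda>x. indicator punctured x * f (radial x))"
    using bdry_subset_cE by (intro integrable_cone_integrand[OF f, of B]) (auto simp: f_def)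
  moreover have "(\<lambda>x. indicator punctured x * f (radial x)) = (\<lambda>x. indicator punctured x * F (radial x))"
    by (rule ext) (auto simp: f_def indicator_def punctured_radial_bdry)
  ultimately show ?thesis by simp
qed

lemma cone_integral_sum:
  assumes "finite I" "\<And>i. i \<in> I \<Longrightarrow> continuous_on cE (F i)"
  shows "cone_integral (\<lambda>x. \<Sum>i\<in>I. F i x) = (\<Sum>i\<in>I. cone_integral (F i))"
  unfolding cone_integral_def sum_distrib_left
  by (rule Bochner_Integration.integral_sum) (rule radial_continuous_integrable, rule assms)

lemma cone_integral_diff:
  assumes "continuous_on cE F" "continuous_on cE G"
  shows "cone_integral (\<lambda>x. F x - G x) = cone_integral F - cone_integral G"
  unfolding cone_integral_def right_diff_distrib
  by (rule Bochner_Integration.integral_diff) (intro radial_continuous_integrable assms)+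

lemma cone_integral_cmult: "cone_integral (\<lambda>x. c * F x) = c * cone_integral F"
  unfolding cone_integral_def by (simp add: mult.left_commute)

lemma cone_integral_const: "cone_integral (\<lambda>x. c) = c * cone_integral (\<lambda>x. 1)"
  using cone_integral_cmult[of c "\<lambda>x. 1"] by simp

text \<open>Positive total mass is what turns a vanishing integral of the constant h 0 into h 0 =
  0.\<close>

lemma cone_integral_one_pos: "cone_integral (\<lambda>x. 1) > 0"
proof -
  have "emeasure lborel punctured > 0"
  proof (rule emeasure_lborel_open_pos)
    show "open punctured" unfolding punctured_def
      by (intro open_Collect_conj open_Collect_less continuous_intros)
    obtain K where K: "K > 0" "\<And>x. norm (weighted \<beta> x) \<le> K * norm x" using weighted_bound by blast
    obtain k :: 'n where True by simp
    \<comment> \<open>Since q y \<le> K |y|^2, this multiple of an axis has q at most K / (sqrt K +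
      1)^2 < 1.\<close>
    let ?x = "(1 / (sqrt K + 1)) *\<^sub>R axis k (1::real) :: real ^ 'n"
    have s: "sqrt K > 0" using K by simp
    then have s1: "sqrt K + 1 > 0" by linarith
    have "q ?x \<le> norm ?x * (K * norm ?x)"
      unfolding quad_eq_inner using norm_cauchy_schwarz[of ?x "weighted \<beta> ?x"] K(2)[of ?x]
      by (meson mult_left_mono norm_ge_zero order_trans)
    also have "\<dots> = (sqrt K / (sqrt K + 1))\<^sup>2" using s K by (simp add: power2_eq_square)
    also have "\<dots> < 1"
    proof -
      have "sqrt K / (sqrt K + 1) < 1" by (subst pos_divide_less_eq[OF s1]) simp
      moreover have "0 \<le> sqrt K / (sqrt K + 1)" using s by simp
      ultimately show ?thesis by (subst power_less_one_iff) auto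
    qed
    finally have "q ?x < 1" .
    moreover have "?x \<noteq> 0" using less_imp_neq[OF s1] by auto
    ultimately have "?x \<in> punctured" unfolding punctured_def quad_pos_iff by blast
    then show "punctured \<noteq> {}" by blast
  qed
  moreover have "emeasure lborel punctured < \<infinity>" using bounded_punctured by (rule emeasure_bounded_finite)
  ultimately have "measure lborel punctured > 0" by (simp add: measure_def enn2real_positive_iff)
  then show ?thesis by (simp add: cone_integral_def)
qed

text \<open>Written along the axes so that \<open>divergence_theorem\<close>, which treats one
  direction at a time, applies to each summand.\<close>

definition flux :: "(real ^ 'n \<Rightarrow> real) \<Rightarrow> real ^ 'n \<Rightarrow> real" where
  "flux h x = (\<Sum>i\<in>UNIV. (gradient q x \<bullet> axis i 1) * partial i h x)"

lemma flux_eq_gradient: "flux h x = gradient h x \<bullet> gradient q x"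
  unfolding flux_def inner_axis by (simp add: gradient_def inner_vec_def mult.commute)

lemma continuous_on_gradient_quad [continuous_intros]: "continuous_on S (\<lambda>x. gradient q x \<bullet> v)"
  unfolding gradient_quad by (intro continuous_intros)

text \<open>The divergence theorem for the vector field with components \<open>H i\<close>,
  assembled from one application per axis.\<close>

lemma cone_integral_flux:
  assumes U: "open U" "cE \<subseteq> U"
    and h: "\<And>i x. x \<in> U \<Longrightarrow> H i differentiable (at x)"
    and c: "\<And>i. continuous_on U (partial i (H i))"
  shows "cone_integral (\<lambda>x. \<Sum>i\<in>UNIV. (gradient q x \<bullet> axis i 1) * H i x)
    = 2 / CARD('n) * (LINT x|lborel. indicator oE x * (\<Sum>i\<in>UNIV. partial i (H i) x))"
proof -
  have cH: "continuous_on cE (H i)" for i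
    using h U by (intro continuous_at_imp_continuous_on) (auto intro: differentiable_imp_continuous_within)
  have cP: "continuous_on cE (partial i (H i))" for i using c U continuous_on_subset by blast
  have "cone_integral (\<lambda>x. \<Sum>i\<in>UNIV. (gradient q x \<bullet> axis i 1) * H i x)
    = (\<Sum>i\<in>UNIV. cone_integral (\<lambda>x. (gradient q x \<bullet> axis i 1) * H i x))"
    by (intro cone_integral_sum continuous_intros cH) simp
  also have "\<dots> = (\<Sum>i\<in>UNIV. 2 / CARD('n) * (LINT x|lborel. indicator oE x * partial i (H i) x))"
  proof (rule sum.cong[OF refl])
    fix i :: 'n
    have "(LINT x|lborel. indicator oE x * partial i (H i) x)
      = CARD('n) / 2 * cone_integral (\<lambda>x. (gradient q x \<bullet> axis i 1) * H i x)"
      by (rule divergence_theorem[OF U _ cH cP]) (rule partial_directional[OF h])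
    moreover have "Y = 2 / c * X" if "X = c / 2 * Y" "c > 0" for X Y c :: real
      using that by (simp add: field_simps)
    ultimately show "cone_integral (\<lambda>x. (gradient q x \<bullet> axis i 1) * H i x)
      = 2 / CARD('n) * (LINT x|lborel. indicator oE x * partial i (H i) x)" using dim by simp
  qed
  also have "\<dots> = 2 / CARD('n) * (LINT x|lborel. (\<Sum>i\<in>UNIV. indicator oE x * partial i (H i) x))"
    by (subst Bochner_Integration.integral_sum) (auto intro: integrable_oE cP simp: sum_distrib_left)
  finally show ?thesis by (simp add: sum_distrib_left)
qed

lemma cone_integral_harmonic:
  assumes "harmonic_on U h" "cE \<subseteq> U"
  shows "cone_integral (flux h) = 0"
proof -
  have U: "open U" and C2: "C2_on U h" and lap: "\<And>x. x \<in> U \<Longrightarrow> laplacian h x = 0"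
    using assms(1) by (auto simp: harmonic_on_def)
  have "cone_integral (flux h) = 2 / CARD('n) * (LINT x|lborel. indicator oE x * (\<Sum>i\<in>UNIV. partial i (partial i h) x))"
    unfolding flux_def[abs_def] by (rule cone_integral_flux[OF U assms(2)]) (use C2 in \<open>auto simp: C2_on_def\<close>)
  also have "(\<lambda>x. indicator oE x * (\<Sum>i\<in>UNIV. partial i (partial i h) x)) = (\<lambda>x. 0)"
  proof
    fix x show "indicator oE x * (\<Sum>i\<in>UNIV. partial i (partial i h) x) = 0"
      using lap[of x] assms(2) oE_subset_cE by (cases "x \<in> oE") (auto simp: laplacian_def)
  qed
  finally show ?thesis by simp
qed

lemma gradient_zero_imp_const:
  fixes h :: "real ^ 'n \<Rightarrow> real"
  assumes h: "real_polynomial_function h" and z: "\<And>i x. partial i h x = 0"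
  shows "h x = h y"
proof -
  obtain h' where h': "\<And>x. (h has_derivative h' x) (at x)"
    using real_polynomial_function_derivative[OF h] by blast
  have "h' x = (\<lambda>v. 0)" for x
  proof
    fix v :: "real ^ 'n"
    have "v = (\<Sum>i\<in>UNIV. v $ i *\<^sub>R axis i 1)"
      by (simp add: vec_eq_iff axis_def if_distrib cong: if_cong)
    then have "h' x v = h' x (\<Sum>i\<in>UNIV. v $ i *\<^sub>R axis i 1)" by simp
    also have "\<dots> = (\<Sum>i\<in>UNIV. v $ i * h' x (axis i 1))"
      using has_derivative_linear[OF h'[of x]] by (simp add: linear_sum linear_cmul)
    also have "\<dots> = 0" using z by (simp add: partial_eqI[OF h'])
    finally show "h' x v = 0" .
  qed
  then have "(h has_derivative (\<lambda>v. 0)) (at x within UNIV)" for x using h'[of x] by simp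
  then obtain c where "\<And>x. x \<in> UNIV \<Longrightarrow> h x = c"
    using has_derivative_zero_constant[of UNIV h] by (metis convex_UNIV)
  then show ?thesis by simp
qed

text \<open>The divergence theorem for \<open>\<nabla>h\<close> gives \<open>h 0 = 0\<close>; then, for \<open>h \<nabla>h\<close>, it gives \<open>\<integral> \<parallel>\<nabla>h\<parallel>\<^sup>2 = 0\<close>.\<close>

lemma neumann_uniqueness:
  fixes h :: "real ^ 'n \<Rightarrow> real"
  assumes h: "real_polynomial_function h" and lap: "\<And>x. laplacian h x = 0"
    and b: "\<And>x. x \<in> bdry \<Longrightarrow> flux h x + h 0 = 0"
  shows "h x = 0"
proof -
  have C2: "C2_on UNIV h" using h by (rule real_polynomial_function_C2)
  have harm: "harmonic_on UNIV h" using C2 lap by (simp add: harmonic_on_def)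
  have "cone_integral (flux h) = cone_integral (\<lambda>x. - h 0)"
    by (rule cone_integral_cong) (use b in \<open>simp add: eq_neg_iff_add_eq_0\<close>)
  then have h0: "h 0 = 0"
    using cone_integral_harmonic[OF harm] cone_integral_const[of "- h 0"] cone_integral_one_pos by simp
  have dh: "h differentiable (at x)" "partial i h differentiable (at x)" for i x
    using h by (auto intro!: real_polynomial_function_differentiable)
  have cp: "continuous_on S (partial i h)" "continuous_on S (partial i (partial i h))" "continuous_on S h" for S i
    using h by (auto intro!: real_polynomial_function_continuous_on)
  have pm: "partial i (\<lambda>x. h x * partial i h x) x = h x * partial i (partial i h) x + (partial i h x)\<^sup>2" for i x
    using partial_mult[OF dh(1)[of x] dh(2)[of i x], of i] by (simp add: power2_eq_square)
  have "cone_integral (\<lambda>x. \<Sum>i\<in>UNIV. (gradient q x \<bullet> axis i 1) * (h x * partial i h x))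
    = 2 / CARD('n) * (LINT x|lborel. indicator oE x * (\<Sum>i\<in>UNIV. partial i (\<lambda>x. h x * partial i h x) x))"
  proof (rule cone_integral_flux[of UNIV])
    show "(\<lambda>x. h x * partial i h x) differentiable (at x)" for i x
      by (intro differentiable_mult dh)
    show "continuous_on UNIV (partial i (\<lambda>x. h x * partial i h x))" for i
      unfolding pm[abs_def] by (intro continuous_intros cp)
  qed auto
  also have "cone_integral (\<lambda>x. \<Sum>i\<in>UNIV. (gradient q x \<bullet> axis i 1) * (h x * partial i h x)) = cone_integral (\<lambda>x. 0)"
  proof (rule cone_integral_cong)
    fix x assume "x \<in> bdry"
    then have "h x * flux h x = 0" using b h0 by auto
    then show "(\<Sum>i\<in>UNIV. (gradient q x \<bullet> axis i 1) * (h x * partial i h x)) = 0"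
      by (simp add: flux_def sum_distrib_left algebra_simps)
  qed
  also have "cone_integral (\<lambda>x. 0) = 0" using cone_integral_const[of 0] by simp
  also have "(\<lambda>x. indicator oE x * (\<Sum>i\<in>UNIV. partial i (\<lambda>x. h x * partial i h x) x))
    = (\<lambda>x. indicator oE x * (\<Sum>i\<in>UNIV. (partial i h x)\<^sup>2))"
  proof
    fix x
    have "(\<Sum>i\<in>UNIV. partial i (\<lambda>x. h x * partial i h x) x) = h x * laplacian h x + (\<Sum>i\<in>UNIV. (partial i h x)\<^sup>2)"
      unfolding pm sum.distrib laplacian_def sum_distrib_left ..
    then show "indicator oE x * (\<Sum>i\<in>UNIV. partial i (\<lambda>x. h x * partial i h x) x) = indicator oE x * (\<Sum>i\<in>UNIV. (partial i h x)\<^sup>2)"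
      by (simp add: lap)
  qed
  finally have int0: "(LINT x|lborel. indicator oE x * (\<Sum>i\<in>UNIV. (partial i h x)\<^sup>2)) = 0" by simp
  let ?e = "\<lambda>x. \<Sum>i\<in>UNIV. (partial i h x)\<^sup>2"
  have ce: "continuous_on S ?e" for S by (intro continuous_intros cp)
  have e0: "?e x \<ge> 0" for x by (simp add: sum_nonneg)
  have "AE x in lborel. indicator oE x * ?e x = 0"
    using integral_nonneg_eq_0_iff_AE[OF integrable_oE(1)[OF ce]] int0 e0 by simp
  \<comment> \<open>A point with positive value would have a neighbourhood of positive volume on
    which the integrand is positive.\<close>
  have "?e x = 0" if x: "x \<in> oE" for x
  proof (rule ccontr)
    assume "?e x \<noteq> 0"
    define W where "W = oE \<inter> {x. 0 < ?e x}"
    have "open W" unfolding W_def by (intro open_Int open_oE open_Collect_less continuous_on_const ce)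
    moreover have "x \<in> W" using x \<open>?e x \<noteq> 0\<close> e0[of x] by (simp add: W_def order_less_le)
    ultimately have "emeasure lborel W > 0" by (intro emeasure_lborel_open_pos) auto
    moreover have "emeasure lborel W = 0"
    proof -
      have "AE x in lborel. x \<notin> W"
        using \<open>AE x in lborel. indicator oE x * ?e x = 0\<close>
        by eventually_elim (auto simp: W_def)
      then show ?thesis using \<open>open W\<close> AE_iff_measurable[of W lborel "\<lambda>x. x \<notin> W"] by simp
    qed
    ultimately show False by simp
  qed
  then have p0: "partial i h x = 0" if "x \<in> oE" for i x
    using that by (simp add: sum_nonneg_eq_0_iff)
  have "0 \<in> oE" by (simp add: oE_def)
  \<comment> \<open>The partial derivatives are polynomials, so vanishing on the open ellipsoid
    spreads to the whole space.\<close>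
  have "partial i h x = 0" for i x
    using real_polynomial_function_zero_open[OF real_polynomial_function_partial[OF h] open_oE \<open>0 \<in> oE\<close> p0] .
  then show "h x = 0" using gradient_zero_imp_const[OF h] h0 by metis
qed

section \<open>Existence of polynomial solutions\<close>

lemma poly_lt_quad: "poly_lt 3 (\<lambda>x. q x - 1)"
proof -
  have "poly_lt 3 (\<lambda>x. (\<Sum>j\<in>UNIV. \<beta> $ j * (x $ j) ^ 2) + (- 1))"
    using poly_lt_const[of 2 "-1"] by (intro poly_lt_add poly_lt_sum poly_lt_cmult poly_lt_coordinate_power) (auto simp: numeral_3_eq_3)
  then show ?thesis by (simp add: quad_def[abs_def])
qed

text \<open>Each partial derivative lowers the degree by one and its linear coefficient restores it.
  This keeps the boundary operator within a fixed degree and leads to deg h \<le> deg f.\<close>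

lemma poly_lt_flux: "poly_lt (Suc m) h \<Longrightarrow> poly_lt (Suc m) (flux h)"
proof -
  assume h: "poly_lt (Suc m) h"
  have "poly_lt (Suc m) (\<lambda>x. (2 * \<beta> $ i * (x $ i) ^ 1) * partial i h x)" for i
  proof -
    have a1: "poly_lt (Suc 1) (\<lambda>x. 2 * \<beta> $ i * (x $ i) ^ 1)"
      by (intro poly_lt_cmult poly_lt_coordinate_power) simp
    have a2: "poly_lt m (partial i h)" using poly_lt_partial[OF h, of i] by simp
    show ?thesis using poly_lt_mult[OF a1 a2] by (simp only: plus_1_eq_Suc)
  qed
  then have "poly_lt (Suc m) (\<lambda>x. \<Sum>i\<in>UNIV. (2 * \<beta> $ i * (x $ i) ^ 1) * partial i h x)"
    by (intro poly_lt_sum) auto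
  moreover have "flux h = (\<lambda>x. \<Sum>i\<in>UNIV. (2 * \<beta> $ i * (x $ i) ^ 1) * partial i h x)"
    by (rule ext) (simp add: flux_def gradient_quad weighted_def inner_axis mult.assoc)
  ultimately show ?thesis by simp
qed

text \<open>A pair \<open>(h, g)\<close> is encoded as one function \<open>F\<close> on \<open>bool \<times> real ^ 'n\<close>, so that the pairs form a vector
  space of real functions.\<close>

lemma neumann_poly_solvable:
  assumes f: "poly_lt (Suc m) f"
  shows "\<exists>h g. poly_lt (Suc m) h \<and> (\<forall>x. laplacian h x = 0) \<and> (\<forall>x. flux h x + h 0 + (q x - 1) * g x = f x)"
proof -
  define inc :: "bool \<Rightarrow> ('n \<Rightarrow> nat) \<Rightarrow> bool \<times> (real ^ 'n) \<Rightarrow> real" where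
    "inc b \<alpha> = (\<lambda>(c, x). if c = b then monomial \<alpha> x else 0)" for b \<alpha>
  \<comment> \<open>Truncated subtraction: for m \<le> 1 the Laplacian vanishes and the second
    component is trivial.\<close>
  define S where "S = inc True ` multiindices (Suc m) \<union> inc False ` multiindices (m - 1)"
  have S: "finite S" by (simp add: S_def)
  define V :: "(bool \<times> (real ^ 'n) \<Rightarrow> real) set" where "V = {F. poly_lt (Suc m) (\<lambda>x. F (True, x)) \<and> poly_lt (m - 1) (\<lambda>x. F (False, x))}"
  have "fun_space.span S = V"
  proof
    have "S \<subseteq> V"
      by (auto simp: S_def V_def inc_def multiindices_def intro: poly_lt_monomial)
    moreover have "fun_space.subspace V"
      unfolding fun_space.subspace_def V_def by (auto intro: poly_lt_add poly_lt_cmult)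
    ultimately show "fun_space.span S \<subseteq> V" by (rule fun_space.span_minimal)
    show "V \<subseteq> fun_space.span S"
    proof
      fix F assume "F \<in> V"
      then obtain c c' where c: "\<And>x. F (True, x) = (\<Sum>\<alpha>\<in>multiindices (Suc m). c \<alpha> * monomial \<alpha> x)"
        "\<And>x. F (False, x) = (\<Sum>\<alpha>\<in>multiindices (m - 1). c' \<alpha> * monomial \<alpha> x)"
        unfolding V_def poly_lt_def by blast
      have sum_apply: "(\<Sum>i\<in>I. G i) z = (\<Sum>i\<in>I. G i z)" for I :: "('n \<Rightarrow> nat) set" and G and z :: "bool \<times> (real ^ 'n)"
        by (induction I rule: infinite_finite_induct) (auto simp: zero_fun_def plus_fun_def)
      have "F = (\<Sum>\<alpha>\<in>multiindices (Suc m). (\<lambda>z. c \<alpha> * inc True \<alpha> z)) + (\<Sum>\<alpha>\<in>multiindices (m - 1). (\<lambda>z. c' \<alpha> * inc False \<alpha> z))"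
      proof
        fix z :: "bool \<times> (real ^ 'n)"
        obtain b x where z: "z = (b, x)" by (cases z)
        show "F z = ((\<Sum>\<alpha>\<in>multiindices (Suc m). (\<lambda>z. c \<alpha> * inc True \<alpha> z)) + (\<Sum>\<alpha>\<in>multiindices (m - 1). (\<lambda>z. c' \<alpha> * inc False \<alpha> z))) z"
          unfolding plus_fun_def sum_apply z by (cases b) (simp_all add: c inc_def)
      qed
      also have "\<dots> \<in> fun_space.span S"
        by (intro fun_space.span_add fun_space.span_sum fun_space.span_scale fun_space.span_base) (auto simp: S_def)
      finally show "F \<in> fun_space.span S" .
    qed
  qed
  define T :: "(bool \<times> (real ^ 'n) \<Rightarrow> real) \<Rightarrow> bool \<times> (real ^ 'n) \<Rightarrow> real" where
    "T F = (\<lambda>(b, x). if b then flux (\<lambda>x. F (True, x)) x + F (True, 0) + (q x - 1) * F (False, x)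
                     else laplacian (\<lambda>x. F (True, x)) x)" for F
  note sV = \<open>fun_space.span S = V\<close>
  have poly: "real_polynomial_function (\<lambda>x. F (b, x))" if "F \<in> V" for F b
    using that poly_lt_imp_real_polynomial_function by (cases b) (auto simp: V_def)
  have d1: "(\<lambda>x. F (True, x)) differentiable (at x)" and d2: "partial i (\<lambda>x. F (True, x)) differentiable (at x)"
    if "F \<in> V" for F i x
    using poly[OF that] by (auto intro!: real_polynomial_function_differentiable)
  have "\<exists>F\<in>fun_space.span S. T F = (\<lambda>(b, x). if b then f x else 0)"
  proof (rule fun_space.injective_on_span_imp_surjective[OF S])
    fix F G assume "F \<in> fun_space.span S" "G \<in> fun_space.span S"
    then have FG: "F \<in> V" "G \<in> V" by (simp_all add: sV)
    have p1: "partial i (\<lambda>x. F (True, x) + G (True, x)) = (\<lambda>x. partial i (\<lambda>x. F (True, x)) x + partial i (\<lambda>x. G (True, x)) x)" for i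
      by (rule ext) (rule partial_add[OF d1[OF FG(1)] d1[OF FG(2)]])
    show "T (F + G) = T F + T G"
      by (rule ext)
         (auto simp: T_def flux_def laplacian_def p1 partial_add[OF d2[OF FG(1)] d2[OF FG(2)]] sum.distrib algebra_simps)
  next
    fix r F assume "F \<in> fun_space.span S"
    then have F: "F \<in> V" by (simp add: sV)
    have p1: "partial i (\<lambda>x. r * F (True, x)) = (\<lambda>x. r * partial i (\<lambda>x. F (True, x)) x)" for i
      by (rule ext) (rule partial_cmult[OF d1[OF F]])
    show "T (\<lambda>z. r * F z) = (\<lambda>z. r * T F z)"
      by (rule ext)
         (auto simp: T_def flux_def laplacian_def p1 partial_cmult[OF d2[OF F]] sum_distrib_left algebra_simps)
  next
    fix F assume "F \<in> fun_space.span S"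
    then have F: "F \<in> V" by (simp add: sV)
    have hF: "poly_lt (Suc m) (\<lambda>x. F (True, x))" and gF: "poly_lt (m - 1) (\<lambda>x. F (False, x))" using F by (auto simp: V_def)
    have "poly_lt (Suc m) (\<lambda>x. (q x - 1) * F (False, x))"
    proof (cases m)
      \<comment> \<open>For m = 0 the general bound 2 + (m - 1) for the product is too weak, but
        then g = 0.\<close>
      case 0
      then show ?thesis using gF by (simp add: poly_lt_0 fun_eq_iff)
    next
      case (Suc k)
      then show ?thesis using poly_lt_mult[of 2 "\<lambda>x. q x - 1" "m - 1"] poly_lt_quad gF by (simp add: numeral_3_eq_3 numeral_2_eq_2)
    qed
    then have "poly_lt (Suc m) (\<lambda>x. flux (\<lambda>x. F (True, x)) x + F (True, 0) + (q x - 1) * F (False, x))"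
      using hF by (intro poly_lt_add poly_lt_flux poly_lt_const)
    moreover have "poly_lt (m - 1) (laplacian (\<lambda>x. F (True, x)))"
      unfolding laplacian_def[abs_def] using poly_lt_partial[OF poly_lt_partial[OF hF]] by (intro poly_lt_sum) auto
    ultimately have "T F \<in> V" by (simp add: V_def T_def)
    then show "T F \<in> fun_space.span S" by (simp add: sV)
  next
    fix F assume "F \<in> fun_space.span S" and TF: "T F = 0"
    then have F: "F \<in> V" by (simp add: sV)
    have t: "flux (\<lambda>x. F (True, x)) x + F (True, 0) + (q x - 1) * F (False, x) = 0" for x
      using fun_cong[OF TF, of "(True, x)"] by (simp add: T_def)
    have l: "laplacian (\<lambda>x. F (True, x)) x = 0" for x
      using fun_cong[OF TF, of "(False, x)"] by (simp add: T_def)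
    \<comment> \<open>On the boundary the term with q - 1 drops out, which leaves the hypothesis of
      \<open>neumann_uniqueness\<close>.\<close>
    have h0: "F (True, x) = 0" for x
    proof (rule neumann_uniqueness[where h = "\<lambda>x. F (True, x)"])
      show "flux (\<lambda>x. F (True, x)) x + F (True, 0) = 0" if "x \<in> bdry" for x
        using t[of x] that by (simp add: ellipsoid_boundary_def)
    qed (use poly[OF F] l in auto)
    have "flux (\<lambda>x. F (True, x)) x = 0" for x by (simp add: flux_def h0)
    then have "(q x - 1) * F (False, x) = 0" for x using t[of x] h0 by simp
    \<comment> \<open>q - 1 has no zeros in the open ellipsoid, so g vanishes there and, being a
      polynomial, everywhere.\<close>
    then have "F (False, x) = 0" if "x \<in> oE" for x using that by (force simp: oE_def)
    then have "F (False, x) = 0" for x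
      using real_polynomial_function_zero_open[OF poly[OF F] open_oE, of False x] by (simp add: oE_def)
    then have "F (b, x) = 0" for b x using h0 by (cases b) auto
    then show "F = 0" by (auto simp: zero_fun_def)
  next
    show "(\<lambda>(b, x). if b then f x else 0) \<in> fun_space.span S"
      using f by (simp add: sV V_def)
  qed
  then obtain F where F: "F \<in> V" "T F = (\<lambda>(b, x). if b then f x else 0)" by (auto simp: sV)
  show ?thesis
  proof (rule exI[of _ "\<lambda>x. F (True, x)"], rule exI[of _ "\<lambda>x. F (False, x)"], intro conjI allI)
    show "poly_lt (Suc m) (\<lambda>x. F (True, x))" using F(1) by (simp add: V_def)
    show "laplacian (\<lambda>x. F (True, x)) x = 0" for x
      using fun_cong[OF F(2), of "(False, x)"] by (simp add: T_def)
    show "flux (\<lambda>x. F (True, x)) x + F (True, 0) + (q x - 1) * F (False, x) = f x" for x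
      using fun_cong[OF F(2), of "(True, x)"] by (simp add: T_def)
  qed
qed

text \<open>In flux h = f - h 0 both the flux and f have cone integral 0, so h 0 times the positive
  total mass is 0.\<close>

lemma neumann_poly_solution:
  assumes f: "poly_lt (Suc m) f" and I: "cone_integral f = 0"
  shows "\<exists>h. poly_lt (Suc m) h \<and> harmonic_on UNIV h \<and> (\<forall>x\<in>bdry. flux h x = f x)"
proof -
  obtain h g where h: "poly_lt (Suc m) h" "\<And>x. laplacian h x = 0" "\<And>x. flux h x + h 0 + (q x - 1) * g x = f x"
    using neumann_poly_solvable[OF f] by blast
  have hp: "real_polynomial_function h" and fp: "real_polynomial_function f"
    using h(1) f poly_lt_imp_real_polynomial_function by blast+
  have harm: "harmonic_on UNIV h" using h(2) real_polynomial_function_C2[OF hp] by (simp add: harmonic_on_def)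
  have eq: "flux h x = f x - h 0" if "x \<in> bdry" for x
    using h(3)[of x] that by (simp add: ellipsoid_boundary_def)
  have "0 = cone_integral (flux h)" using cone_integral_harmonic[OF harm] by simp
  also have "\<dots> = cone_integral (\<lambda>x. f x - h 0)" by (rule cone_integral_cong) (rule eq)
  also have "\<dots> = - (h 0 * cone_integral (\<lambda>x. 1))"
    using I cone_integral_const[of "h 0"]
    by (subst cone_integral_diff) (auto intro: real_polynomial_function_continuous_on fp)
  finally have "h 0 = 0" using cone_integral_one_pos by simp
  then show ?thesis using h(1) harm eq by auto
qed

lemma gradient_quad_nonzero: "x \<in> bdry \<Longrightarrow> gradient q x \<noteq> 0"
  by (auto simp: gradient_quad ellipsoid_boundary_def quad_eq_inner)

lemma normal_derivative_eq_iff: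
  assumes "x \<in> bdry"
  shows "normal_derivative \<beta> h x = y / norm (gradient q x) \<longleftrightarrow> gradient h x \<bullet> gradient q x = y"
  using gradient_quad_nonzero[OF assms]
  by (simp add: normal_derivative_def unit_normal_def inverse_eq_divide)

end

theorem theorem2p2:
  fixes \<beta> :: "real ^ 'n" and f :: "real ^ 'n \<Rightarrow> real"
  assumes "CARD('n) \<ge> 2"
    and "\<And>j. \<beta> $ j > 0"
    and "real_polynomial_function f"
  defines "a \<equiv> (LINT x:ellipsoid_boundary \<beta>|surface_measure. f x / norm (gradient (quad \<beta>) x)) = 0"
    and "b \<equiv> (\<exists>h. real_polynomial_function h \<and> harmonic_on UNIV h \<and> poly_degree h \<le> poly_degree f \<and>
                (\<forall>x\<in>ellipsoid_boundary \<beta>. gradient h x \<bullet> gradient (quad \<beta>) x = f x))"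
    and "c \<equiv> (\<exists>h. harmonic_on_closed (closed_ellipsoid \<beta>) h \<and>
                (\<forall>x\<in>ellipsoid_boundary \<beta>.
                   normal_derivative \<beta> h x = f x / norm (gradient (quad \<beta>) x)))"
  shows "(a \<longleftrightarrow> b) \<and> (b \<longleftrightarrow> c)"
proof -
  interpret ellipsoid \<beta> using assms(1,2) by unfold_locales
  obtain \<kappa> where \<kappa>: "\<kappa> > 0" "\<And>f. f \<in> borel_measurable borel \<Longrightarrow>
      (LINT x:bdry|surface_measure. f x / norm (gradient q x)) = \<kappa> * cone_integral f"
    using surface_integral_eq_cone_integral by blast
  have "f \<in> borel_measurable borel"
    by (intro borel_measurable_continuous_onI real_polynomial_function_continuous_on assms(3))
  then have a: "a \<longleftrightarrow> cone_integral f = 0" using \<kappa> by (simp add: a_def)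
  have c: "c \<longleftrightarrow> (\<exists>h. harmonic_on_closed cE h \<and> (\<forall>x\<in>bdry. flux h x = f x))"
    unfolding c_def flux_eq_gradient using normal_derivative_eq_iff by metis
  have "a \<Longrightarrow> b"
  proof -
    assume a
    show b
    proof (cases "f = (\<lambda>x. 0)")
      \<comment> \<open>The zero polynomial has degree -\<infinity>, so only h = 0 meets the degree
        bound, while \<open>neumann_poly_solution\<close> bounds degrees by natural numbers.\<close>
      case True
      have "gradient (\<lambda>x. 0) x = 0" for x :: "real ^ 'n" by (simp add: gradient_def vec_eq_iff)
      moreover have "harmonic_on UNIV (\<lambda>x :: real ^ 'n. 0)"
        using real_polynomial_function_C2[of "\<lambda>x :: real ^ 'n. 0"]
        by (auto simp: harmonic_on_def laplacian_def partial_const[abs_def])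
      ultimately show ?thesis unfolding b_def True by (intro exI[of _ "\<lambda>x. 0"]) auto
    next
      case False
      define d where "d = (LEAST d. degree_le f d)"
      have "\<exists>d. degree_le f d"
        using real_polynomial_function_imp_poly_lt[OF assms(3)] by (simp add: degree_le_iff_poly_lt)
      then have "degree_le f d" unfolding d_def by (rule LeastI_ex)
      then have "poly_lt (Suc d) f" by (simp add: degree_le_iff_poly_lt)
      then obtain h where h: "poly_lt (Suc d) h" "harmonic_on UNIV h" "\<And>x. x \<in> bdry \<Longrightarrow> flux h x = f x"
        using neumann_poly_solution \<open>a\<close> a by blast
      have "(LEAST d. degree_le h d) \<le> d" by (rule Least_le) (use h(1) in \<open>simp add: degree_le_iff_poly_lt\<close>)
      then have "poly_degree h \<le> poly_degree f" using False by (simp add: poly_degree_def d_def)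
      then show ?thesis unfolding b_def
        using h poly_lt_imp_real_polynomial_function[OF h(1)] by (intro exI[of _ h]) (simp add: flux_eq_gradient)
    qed
  qed
  moreover have "b \<Longrightarrow> c"
    unfolding b_def c flux_eq_gradient harmonic_on_closed_def by blast
  moreover have "c \<Longrightarrow> a"
  proof -
    assume c
    then obtain h U where h: "harmonic_on U h" "cE \<subseteq> U" "\<And>x. x \<in> bdry \<Longrightarrow> flux h x = f x"
      unfolding c harmonic_on_closed_def by blast
    have "cone_integral f = cone_integral (flux h)" by (rule cone_integral_cong) (simp add: h(3))
    then show a using cone_integral_harmonic[OF h(1,2)] a by simp
  qed
  ultimately show ?thesis by blast
qed

end
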